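(* Let $J:(0,1]\to(0,\infty)$ be measurable with $\inf_{t\in(0,1]}J(t)/t>0$, let $j\in\mathbb N$, and let $\|\cdot\|_{X(0,1)}$, $\|\cdot\|_{Y(0,1)}$ be rearrangement-invariant norms. Assume that $Y(0,1)\ne L^\infty(0,1)$ or $\int_0^1\frac{dr}{J(r)}=\infty$. Then the following are equivalent: (i) $H^j_J:X(0,1)\rightarrow\rightarrow Y(0,1)$; (ii) $\lim_{a\to0_+}\sup_{\|f\|_{X(0,1)}\le1}\|\chi_{(0,a)}H^j_Jf\|_{Y(0,1)}=0$; (iii) $X^r_{j,J}(0,1)\overset{*}{\hookrightarrow}Y(0,1)$.
   Context: Rearrangement-invariant norms: $f^*(t)=\inf\{\lambda\ge0:\lambda_1(\{|f|>\lambda\})\le t\}$. A rearrangement-invariant (r.i.) norm on $(0,1)$ is a functional $\|\cdot\|_{X(0,1)}$ on measurable functions with values in $[0,\infty]$ satisfying: for $f,g\ge0$, $a\ge0$, $\|f\|=0$ iff $f=0$ a.e., $\|af\|=a\|f\|$, $\|f+g\|\le\|f\|+\|g\|$; $f\le g$ a.e. $\Rightarrow\|f\|\le\|g\|$; $0\le f_k\uparrow f$ a.e. $\Rightarrow\|f_k\|\uparrow\|f\|$; $\|1\|<\infty$; $\int_0^1f\le C\|f\|$; equimeasurable functions have equal norm. Associate norm: $\|f\|_{X'(0,1)}=\sup_{\|g\|_{X(0,1)}\le1}\int_0^1|fg|$. $Y(0,1)\ne L^\infty(0,1)$ means inequality as sets. $T:X(0,1)\rightarrow\rightarrow Y(0,1)$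 means $T$ maps bounded subsets of $X(0,1)$ into relatively compact subsets of $Y(0,1)$. Almost-compact embedding: $X(0,1)\overset{*}{\hookrightarrow}Y(0,1)$ means $\lim_{a\to0_+}\sup_{\|f\|_{X(0,1)}\le1}\|\chi_{(0,a)}f^*\|_{Y(0,1)}=0$. Operators: $H^j_Jf(t)=\frac{1}{(j-1)!}\int_t^1\frac{|f(s)|}{J(s)}\big(\int_t^s\frac{dr}{J(r)}\big)^{j-1}ds$ and $R^j_Jf(t)=\frac{1}{(j-1)!J(t)}\int_0^t\big(\int_s^t\frac{dr}{J(r)}\big)^{j-1}|f(s)|ds$, $t\in(0,1)$. $X^r_{j,J}(0,1)$ is the r.i. space whose associate norm is $\|f\|_{(X^r_{j,J})'(0,1)}=\|R^j_Jf^*\|_{X'(0,1)}$ (this is an r.i. norm; $X^r_{j,J}(0,1)$ is the smallest r.i. space into which $H^j_J$ maps $X(0,1)$ boundedly). *)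

theory Defs
  imports "HOL-Analysis.Analysis"
begin

text \<open>All functions live on the interval (0,1) with Lebesgue measure.
  Norms are functionals on nonnegative measurable functions with values in [0,\<infinity>];
  the norm of a real function f is the functional applied to |f|.\<close>

abbreviation I01 :: "real measure" where
  "I01 \<equiv> lebesgue_on {0<..<1}"

definition ri_norm :: "((real \<Rightarrow> ennreal) \<Rightarrow> ennreal) \<Rightarrow> bool" where
  "ri_norm \<rho> \<longleftrightarrow>
     (\<forall>f \<in> borel_measurable I01. \<rho> f = 0 \<longleftrightarrow> (AE x in I01. f x = 0)) \<and>
     (\<forall>f \<in> borel_measurable I01. \<forall>a::real. a \<ge> 0 \<longrightarrow>
         \<rho> (\<lambda>x. ennreal a * f x) = ennreal a * \<rho> f) \<and>
     (\<forall>f \<in> borel_measurable I01. \<forall>g \<in> borel_measurable I01.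
         \<rho> (\<lambda>x. f x + g x) \<le> \<rho> f + \<rho> g) \<and>
     (\<forall>f \<in> borel_measurable I01. \<forall>g \<in> borel_measurable I01.
         (AE x in I01. f x \<le> g x) \<longrightarrow> \<rho> f \<le> \<rho> g) \<and>
     (\<forall>F f. (\<forall>k. F k \<in> borel_measurable I01) \<longrightarrow> f \<in> borel_measurable I01 \<longrightarrow>
         (AE x in I01. incseq (\<lambda>k. F k x) \<and> (\<lambda>k. F k x) \<longlonglongrightarrow> f x) \<longrightarrow>
         \<rho> f = (SUP k. \<rho> (F k))) \<and>
     \<rho> (\<lambda>_. 1) < \<infinity> \<and>
     (\<exists>C::real. \<forall>f \<in> borel_measurable I01. (\<integral>\<^sup>+ x. f x \<partial>I01) \<le> ennreal C * \<rho> f) \<and>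
     (\<forall>f \<in> borel_measurable I01. \<forall>g \<in> borel_measurable I01.
         (\<forall>c::ennreal. emeasure I01 {x \<in> space I01. f x > c}
                      = emeasure I01 {x \<in> space I01. g x > c}) \<longrightarrow> \<rho> f = \<rho> g)"

definition ri_space :: "((real \<Rightarrow> ennreal) \<Rightarrow> ennreal) \<Rightarrow> (real \<Rightarrow> real) set" where
  "ri_space \<rho> = {f. f \<in> borel_measurable I01 \<and> \<rho> (\<lambda>x. ennreal \<bar>f x\<bar>) < \<infinity>}"

definition Linf_space :: "(real \<Rightarrow> real) set" where
  "Linf_space = {f. f \<in> borel_measurable I01 \<and> (\<exists>C. AE x in I01. \<bar>f x\<bar> \<le> C)}"

definition rearr :: "(real \<Rightarrow> ennreal) \<Rightarrow> real \<Rightarrow> ennreal" where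
  "rearr f t = Inf {c::ennreal. emeasure I01 {x \<in> space I01. f x > c} \<le> ennreal t}"

definition assoc_norm :: "((real \<Rightarrow> ennreal) \<Rightarrow> ennreal) \<Rightarrow> (real \<Rightarrow> ennreal) \<Rightarrow> ennreal" where
  "assoc_norm \<rho> g = (SUP h \<in> {h \<in> borel_measurable I01. \<rho> h \<le> 1}. \<integral>\<^sup>+ x. h x * g x \<partial>I01)"

definition IJ :: "(real \<Rightarrow> real) \<Rightarrow> real \<Rightarrow> real \<Rightarrow> ennreal" where
  "IJ J t s = (\<integral>\<^sup>+ r. indicator {t<..<s} r * ennreal (1 / J r) \<partial>lborel)"

text \<open>H^j_J applied to a nonnegative function (for real f we apply it to |f|).\<close>
definition HJ :: "(real \<Rightarrow> real) \<Rightarrow> nat \<Rightarrow> (real \<Rightarrow> ennreal) \<Rightarrow> real \<Rightarrow> ennreal" where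
  "HJ J j f t = ennreal (1 / fact (j - 1)) *
     (\<integral>\<^sup>+ s. indicator {t<..<1} s * f s * ennreal (1 / J s) * IJ J t s ^ (j - 1) \<partial>lborel)"

definition RJ :: "(real \<Rightarrow> real) \<Rightarrow> nat \<Rightarrow> (real \<Rightarrow> ennreal) \<Rightarrow> real \<Rightarrow> ennreal" where
  "RJ J j f t = ennreal (1 / (fact (j - 1) * J t)) *
     (\<integral>\<^sup>+ s. indicator {0<..<t} s * IJ J s t ^ (j - 1) * f s \<partial>lborel)"

text \<open>Norm of X^r_{j,J}: the r.i. norm whose associate norm is g \<mapsto> ||R^j_J g*||_{X'};
  by the Lorentz-Luxemburg theorem it is the associate of that norm.\<close>
definition XrJ_norm :: "((real \<Rightarrow> ennreal) \<Rightarrow> ennreal) \<Rightarrow> (real \<Rightarrow> real) \<Rightarrow> nat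
    \<Rightarrow> (real \<Rightarrow> ennreal) \<Rightarrow> ennreal" where
  "XrJ_norm \<rho> J j g = (SUP h \<in> {h \<in> borel_measurable I01.
        assoc_norm \<rho> (RJ J j (rearr h)) \<le> 1}. \<integral>\<^sup>+ x. h x * g x \<partial>I01)"

definition HJ_compact :: "(real \<Rightarrow> real) \<Rightarrow> nat \<Rightarrow> ((real \<Rightarrow> ennreal) \<Rightarrow> ennreal)
    \<Rightarrow> ((real \<Rightarrow> ennreal) \<Rightarrow> ennreal) \<Rightarrow> bool" where
  "HJ_compact J j \<rho>X \<rho>Y \<longleftrightarrow>
     (\<forall>f \<in> ri_space \<rho>X. HJ J j (\<lambda>x. ennreal \<bar>f x\<bar>) \<in> borel_measurable I01 \<and>
                         \<rho>Y (HJ J j (\<lambda>x. ennreal \<bar>f x\<bar>)) < \<infinity>) \<and>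
     (\<forall>F::nat \<Rightarrow> real \<Rightarrow> real. \<forall>C::real.
        (\<forall>n. F n \<in> borel_measurable I01 \<and> \<rho>X (\<lambda>x. ennreal \<bar>F n x\<bar>) \<le> ennreal C) \<longrightarrow>
        (\<exists>r g. strict_mono r \<and> g \<in> ri_space \<rho>Y \<and>
           (\<lambda>n. \<rho>Y (\<lambda>t. ennreal \<bar>enn2real (HJ J j (\<lambda>x. ennreal \<bar>F (r n) x\<bar>) t) - g t\<bar>))
             \<longlonglongrightarrow> 0))"

definition almost_compact :: "((real \<Rightarrow> ennreal) \<Rightarrow> ennreal)
    \<Rightarrow> ((real \<Rightarrow> ennreal) \<Rightarrow> ennreal) \<Rightarrow> bool" where
  "almost_compact \<rho>X \<rho>Y \<longleftrightarrow>
     ((\<lambda>a. SUP f \<in> {f. f \<in> borel_measurable I01 \<and> \<rho>X (\<lambda>x. ennreal \<bar>f x\<bar>) \<le> 1}.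
          \<rho>Y (\<lambda>t. indicator {0<..<a} t * rearr (\<lambda>x. ennreal \<bar>f x\<bar>) t)) \<longlongrightarrow> 0) (at_right 0)"

end

theory Submission
  imports Defs "HOL-Probability.Helly_Selection"
begin

text \<open>Write \<open>H\<close>, \<open>R\<close> for the operators; \<open>\<integral> g (H f) = \<integral> f (R g)\<close>, and \<open>H f\<close> is decreasing and right continuous.

  (ii) and (iii) are equivalent because the two suprema agree for every \<open>a\<close>. On the one hand \<open>H\<close> maps
  the unit ball of \<open>X\<close> into that of \<open>X\<^sup>r\<close>, by Hardy--Littlewood and duality. On the other hand, if the
  \<open>Y\<close>-norm of the restriction of \<open>f\<^sup>*\<close> to \<open>(0,a)\<close> exceeds \<open>B\<close>, Lorentz--Luxemburg duality gives a decreasing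
  \<open>h\<close> of \<open>Y'\<close>-norm at most \<open>1/B\<close> with \<open>\<integral>\<^sub>0\<^sup>a f\<^sup>* h > 1\<close>; a function equimeasurable with the restriction of \<open>h\<close> to
  \<open>(0,a)\<close> and arranged along \<open>f\<close> then contradicts \<open>\<parallel>f\<parallel> \<le> 1\<close> in \<open>X\<^sup>r\<close>. For decreasing functions the duality
  reduces, by dyadic step functions and averaging over cyclic shifts, to Hahn--Banach in finitely many dimensions.

  (ii) implies (i): away from the origin \<open>H f\<^sub>n\<close> is bounded and monotone, so Helly's selection theorem and
  dominated convergence apply; near the origin (ii) controls the norms. Dominated convergence holds in \<open>Y\<close>
  because (ii), tested on a constant, makes the fundamental function of \<open>Y\<close> vanish at the origin.

  (i) implies (ii): by compactness \<open>H\<close> is uniformly small on functions concentrated near the origin, since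
  a limit in \<open>Y\<close> of their images must vanish. The images of functions living on \<open>[b,1)\<close> are dominated by
  \<open>(\<integral>\<^sub>t\<^sup>1 1/J)\<^sup>j\<^sup>-\<^sup>1\<close>, which in turn is either bounded or dominated near the origin by the image of a constant restricted to
  \<open>(0,b)\<close>. If \<open>Y = L\<^sup>\<infinity>\<close> and \<open>\<integral>\<^sub>0\<^sup>1 1/J = \<infinity>\<close>, then (i) fails, because \<open>H 1\<close> is unbounded.\<close>

text \<open>The alternative in the hypotheses excludes a real obstruction. If \<open>Y\<close> is
  the space of bounded functions, the norm of \<open>H f\<close> restricted to (0,a) is comparable,
  for every \<open>a\<close>, with the limit of \<open>H f\<close> at the origin, so (ii) always
  fails. Yet for \<open>J = 1\<close>, \<open>j = 1\<close> and \<open>X\<close> the bounded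
  functions, the images of the unit ball are equi-Lipschitz, and (i) holds by Arzela--Ascoli. The
  alternative enters only through the fundamental function of \<open>Y\<close>.

  The lower bound on \<open>J t / t\<close> makes \<open>1 / J\<close> bounded on each [a,1). Hence
  only the origin is singular: beyond \<open>a\<close>, \<open>H f\<close> is bounded by a multiple
  of the L1 norm of \<open>f\<close>, which the norm of \<open>X\<close> controls.

  Right continuity recurs for two reasons. A decreasing right continuous function agrees on (0,1)
  with its rearrangement, which lets \<open>H f\<close> be compared with the rearrangements in
  (iii). It is also the increasing limit of step functions that sample the right ends of dyadic
  cells, which is why duality is proved for such functions only.\<close>

lemma finite_measure_I01: "finite_measure I01"
  by (rule finite_measure_lebesgue_on) simp

lemma sigma_finite_I01: "sigma_finite_measure I01"
  using finite_measure_I01 finite_measure.axioms(1) by blast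

lemma borel_measurable_I01:
  "f \<in> borel_measurable borel \<Longrightarrow> f \<in> borel_measurable I01"
  by (intro measurable_restrict_space1 measurable_completion) simp

lemma id_measurable_I01 [measurable]: "(\<lambda>x. x) \<in> borel_measurable I01"
  by (rule borel_measurable_I01) simp

lemma space_I01 [simp]: "space I01 = {0<..<1}"
  by (simp add: space_restrict_space)

lemma emeasure_I01_borel:
  assumes "S \<in> sets borel" "S \<subseteq> {0<..<1}"
  shows "emeasure I01 S = emeasure lborel S"
  using assms by (subst emeasure_restrict_space) auto

lemma nn_integral_I01: "(\<integral>\<^sup>+x. f x \<partial>I01) = (\<integral>\<^sup>+x. f x * indicator {0<..<1} x \<partial>lborel)"
  by (subst nn_integral_restrict_space) (auto simp: nn_integral_completion)

lemma emeasure_I01_le_1: "emeasure I01 S \<le> 1"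
proof -
  have "emeasure I01 S \<le> emeasure I01 (space I01)"
    by (rule emeasure_space)
  also have "\<dots> = 1"
    using emeasure_I01_borel[of "{0<..<1}"] by simp
  finally show ?thesis .
qed

lemma emeasure_I01_lessThan:
  assumes "m \<le> 1"
  shows "emeasure I01 {t \<in> space I01. ennreal t < m} = m"
proof -
  obtain r where r: "m = ennreal r" "0 \<le> r" "r \<le> 1"
    using assms by (cases m) (auto simp: top_unique)
  have "{t \<in> space I01. ennreal t < m} = {0<..<r}"
    using r by (auto simp: ennreal_less_iff)
  moreover have "emeasure I01 {0<..<r} = ennreal r"
    using r by (subst emeasure_I01_borel) auto
  ultimately show ?thesis using r by simp
qed

lemma emeasure_I01_interval: "0 \<le> a \<Longrightarrow> a \<le> b \<Longrightarrow> b \<le> 1 \<Longrightarrow> emeasure I01 {a<..<b} = ennreal (b - a)"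
  by (subst emeasure_I01_borel) auto

section \<open>Measurability of monotone functions\<close>

lemma down_closed_borel:
  fixes S :: "real set"
  assumes "\<And>x y. y \<in> S \<Longrightarrow> x \<le> y \<Longrightarrow> x \<in> S"
  shows "S \<in> sets borel"
proof -
  consider "S = {}" | "S = UNIV" | z y where "z \<notin> S" "y \<in> S" by auto
  then show ?thesis
  proof cases
    case 3
    have bdd: "bdd_above S" using 3 assms by (meson bdd_aboveI linear)
    have "S \<subseteq> {..Sup S}" using bdd by (auto intro: cSup_upper)
    moreover have "{..<Sup S} \<subseteq> S"
    proof
      fix x assume "x \<in> {..<Sup S}"
      then obtain w where "w \<in> S" "x < w" using less_cSupD[of S x] 3 by auto
      then show "x \<in> S" using assms less_imp_le by blast
    qed
    ultimately have "S = {..Sup S} \<or> S = {..<Sup S}"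
      by (cases "Sup S \<in> S") (auto simp: le_less)
    then show ?thesis by (metis atMost_borel lessThan_borel)
  qed auto
qed

lemma antimono_borel:
  fixes u :: "real \<Rightarrow> ennreal"
  assumes "antimono u"
  shows "u \<in> borel_measurable borel"
proof (rule borel_measurableI_greater)
  fix y
  have "{x. y < u x} \<in> sets borel"
    by (rule down_closed_borel) (use assms in \<open>auto simp: antimono_def intro: less_le_trans\<close>)
  then show "{x \<in> space borel. y < u x} \<in> sets borel" by simp
qed

lemma mono_borel:
  fixes u :: "real \<Rightarrow> ennreal"
  assumes "mono u"
  shows "u \<in> borel_measurable borel"
proof -
  have "(\<lambda>x. u (- x)) \<in> borel_measurable borel"
    by (rule antimono_borel) (use assms in \<open>auto simp: antimono_def mono_def\<close>)
  then have "(\<lambda>x. u (- (- x))) \<in> borel_measurable borel"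
    by (rule measurable_compose[rotated]) simp
  then show ?thesis by simp
qed

section \<open>Rearrangement-invariant norms\<close>

lemma ri_zero_iff: "ri_norm \<rho> \<Longrightarrow> f \<in> borel_measurable I01 \<Longrightarrow> \<rho> f = 0 \<longleftrightarrow> (AE x in I01. f x = 0)"
  unfolding ri_norm_def by blast

lemma ri_scale: "ri_norm \<rho> \<Longrightarrow> f \<in> borel_measurable I01 \<Longrightarrow> 0 \<le> a \<Longrightarrow>
    \<rho> (\<lambda>x. ennreal a * f x) = ennreal a * \<rho> f"
  unfolding ri_norm_def by blast

lemma ri_add: "ri_norm \<rho> \<Longrightarrow> f \<in> borel_measurable I01 \<Longrightarrow> g \<in> borel_measurable I01 \<Longrightarrow>
    \<rho> (\<lambda>x. f x + g x) \<le> \<rho> f + \<rho> g"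
  unfolding ri_norm_def by blast

lemma ri_mono_AE: "ri_norm \<rho> \<Longrightarrow> f \<in> borel_measurable I01 \<Longrightarrow> g \<in> borel_measurable I01 \<Longrightarrow>
    AE x in I01. f x \<le> g x \<Longrightarrow> \<rho> f \<le> \<rho> g"
  unfolding ri_norm_def by blast

lemma ri_mono: "ri_norm \<rho> \<Longrightarrow> f \<in> borel_measurable I01 \<Longrightarrow> g \<in> borel_measurable I01 \<Longrightarrow>
    (\<And>x. 0 < x \<Longrightarrow> x < 1 \<Longrightarrow> f x \<le> g x) \<Longrightarrow> \<rho> f \<le> \<rho> g"
  by (rule ri_mono_AE) (auto intro!: AE_I2)

lemma ri_cong_AE: "ri_norm \<rho> \<Longrightarrow> f \<in> borel_measurable I01 \<Longrightarrow> g \<in> borel_measurable I01 \<Longrightarrow>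
    AE x in I01. f x = g x \<Longrightarrow> \<rho> f = \<rho> g"
  by (rule antisym; rule ri_mono_AE; auto elim: eventually_mono)

lemma ri_cong: "ri_norm \<rho> \<Longrightarrow> f \<in> borel_measurable I01 \<Longrightarrow> g \<in> borel_measurable I01 \<Longrightarrow>
    (\<And>x. 0 < x \<Longrightarrow> x < 1 \<Longrightarrow> f x = g x) \<Longrightarrow> \<rho> f = \<rho> g"
  by (rule ri_cong_AE) (auto intro!: AE_I2)

lemma ri_Sup:
  assumes "ri_norm \<rho>" "\<And>k. F k \<in> borel_measurable I01" "f \<in> borel_measurable I01"
    "\<And>x. 0 < x \<Longrightarrow> x < 1 \<Longrightarrow> incseq (\<lambda>k. F k x)" "\<And>x. 0 < x \<Longrightarrow> x < 1 \<Longrightarrow> f x = (SUP k. F k x)"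
  shows "\<rho> f = (SUP k. \<rho> (F k))"
proof -
  have "AE x in I01. incseq (\<lambda>k. F k x) \<and> (\<lambda>k. F k x) \<longlonglongrightarrow> f x"
    using assms(4,5) by (intro AE_I2) (auto intro: LIMSEQ_SUP)
  then show ?thesis using assms(1-3) unfolding ri_norm_def by blast
qed

lemma ri_Sup_AE:
  assumes "ri_norm \<rho>" "\<And>k. F k \<in> borel_measurable I01" "f \<in> borel_measurable I01"
    "AE x in I01. incseq (\<lambda>k. F k x) \<and> (\<lambda>k. F k x) \<longlonglongrightarrow> f x"
  shows "\<rho> f = (SUP k. \<rho> (F k))"
  using assms unfolding ri_norm_def by blast

lemma ri_one: "ri_norm \<rho> \<Longrightarrow> \<rho> (\<lambda>_. 1) < \<infinity>"
  unfolding ri_norm_def by blast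

lemma ri_L1:
  assumes "ri_norm \<rho>"
  obtains C :: real where "C > 0" "\<And>f. f \<in> borel_measurable I01 \<Longrightarrow> (\<integral>\<^sup>+x. f x \<partial>I01) \<le> ennreal C * \<rho> f"
proof -
  have "\<exists>C::real. \<forall>f \<in> borel_measurable I01. integral\<^sup>N I01 f \<le> ennreal C * \<rho> f"
    using assms unfolding ri_norm_def by (elim conjE) assumption
  then obtain C :: real where C: "\<forall>f \<in> borel_measurable I01. integral\<^sup>N I01 f \<le> ennreal C * \<rho> f" ..
  show ?thesis
  proof (rule that[of "max C 1"])
    fix f :: "real \<Rightarrow> ennreal" assume f: "f \<in> borel_measurable I01"
    have "(\<integral>\<^sup>+x. f x \<partial>I01) \<le> ennreal C * \<rho> f" using C f by blast
    also have "\<dots> \<le> ennreal (max C 1) * \<rho> f"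
      by (intro mult_right_mono ennreal_leI) auto
    finally show "(\<integral>\<^sup>+x. f x \<partial>I01) \<le> ennreal (max C 1) * \<rho> f" .
  qed auto
qed

definition distr_fun :: "(real \<Rightarrow> ennreal) \<Rightarrow> ennreal \<Rightarrow> ennreal" where
  "distr_fun f c = emeasure I01 {x \<in> space I01. c < f x}"

lemma ri_equi:
  assumes "ri_norm \<rho>" "f \<in> borel_measurable I01" "g \<in> borel_measurable I01" "\<And>c. distr_fun f c = distr_fun g c"
  shows "\<rho> f = \<rho> g"
  using assms unfolding ri_norm_def distr_fun_def by blast

lemma ri_const: "ri_norm \<rho> \<Longrightarrow> 0 \<le> a \<Longrightarrow> \<rho> (\<lambda>_. ennreal a) = ennreal a * \<rho> (\<lambda>_. 1)"
  using ri_scale[of \<rho> "\<lambda>_. 1" a] by simp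

lemma ri_one_pos: assumes "ri_norm \<rho>" shows "0 < \<rho> (\<lambda>_. 1)"
proof -
  have "\<not> (AE x in I01. (1::ennreal) = 0)"
  proof
    assume "AE x in I01. (1::ennreal) = 0"
    then have "(\<integral>\<^sup>+x. 1 \<partial>I01) = 0" by (subst nn_integral_0_iff_AE) auto
    then show False using emeasure_I01_interval[of 0 1] by simp
  qed
  then show ?thesis
    using ri_zero_iff[OF assms, of "\<lambda>_. 1"] by (simp add: zero_less_iff_neq_zero)
qed

lemma ri_sum:
  assumes "ri_norm \<rho>" "finite S" "\<And>i. i \<in> S \<Longrightarrow> f i \<in> borel_measurable I01"
  shows "\<rho> (\<lambda>x. \<Sum>i\<in>S. f i x) \<le> (\<Sum>i\<in>S. \<rho> (f i))"
  using assms(2,3)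
proof (induction S rule: finite_induct)
  case empty
  then show ?case using ri_zero_iff[OF assms(1), of "\<lambda>_. 0"] by simp
next
  case (insert i S)
  have "\<rho> (\<lambda>x. \<Sum>i\<in>insert i S. f i x) = \<rho> (\<lambda>x. f i x + (\<Sum>i\<in>S. f i x))"
    using insert by simp
  also have "\<dots> \<le> \<rho> (f i) + \<rho> (\<lambda>x. \<Sum>i\<in>S. f i x)"
    by (rule ri_add[OF assms(1)], rule insert.prems, simp, rule borel_measurable_sum, rule insert.prems, simp)
  also have "\<dots> \<le> \<rho> (f i) + (\<Sum>i\<in>S. \<rho> (f i))"
    using insert by (intro add_left_mono) auto
  finally show ?case using insert by simp
qed

text \<open>The infima over tails of the sequence increase to the limit almost everywhere, so the
  axiom on increasing sequences applies to them, as in the proof of Fatou's lemma for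
  integrals.\<close>

lemma ri_Fatou:
  assumes \<rho>: "ri_norm \<rho>" and F: "\<And>k. F k \<in> borel_measurable I01" and f: "f \<in> borel_measurable I01"
    and lim: "AE x in I01. (\<lambda>k. F k x) \<longlonglongrightarrow> f x" and B: "\<And>k. \<rho> (F k) \<le> B"
  shows "\<rho> f \<le> B"
proof -
  let ?G = "\<lambda>n x. INF k\<in>{n..}. F k x"
  have G [measurable]: "?G n \<in> borel_measurable I01" for n using F by measurable
  have "AE x in I01. incseq (\<lambda>n. ?G n x) \<and> (\<lambda>n. ?G n x) \<longlonglongrightarrow> f x"
    using lim
  proof eventually_elim
    case (elim x)
    have inc: "incseq (\<lambda>n. ?G n x)"
      by (auto simp: incseq_def intro!: INF_superset_mono)
    have "f x = liminf (\<lambda>k. F k x)"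
      using lim_imp_Liminf[OF sequentially_bot elim] by simp
    then have "f x = (SUP n. ?G n x)" by (simp add: liminf_SUP_INF)
    with inc show ?case using LIMSEQ_SUP[OF inc] by auto
  qed
  then have "\<rho> f = (SUP n. \<rho> (?G n))" by (intro ri_Sup_AE[OF \<rho> G f])
  also have "\<dots> \<le> B"
  proof (rule SUP_least)
    fix n
    have "\<rho> (?G n) \<le> \<rho> (F n)" by (rule ri_mono[OF \<rho> G F], rule INF_lower) auto
    then show "\<rho> (?G n) \<le> B" using B order_trans by blast
  qed
  finally show ?thesis .
qed

section \<open>Decreasing rearrangements\<close>

lemma superlevel_set_measurable [simp]: "f \<in> borel_measurable I01 \<Longrightarrow> {x. 0 < x \<and> x < 1 \<and> c < f x} \<in> sets I01"
  for f :: "real \<Rightarrow> ennreal"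
  using measurable_sets[of f I01 borel "{c<..}"]
  by (auto simp: vimage_def Int_def conj_ac)

lemma distr_fun_le_1: "distr_fun f c \<le> 1" unfolding distr_fun_def by (rule emeasure_I01_le_1)

lemma distr_fun_antimono: "f \<in> borel_measurable I01 \<Longrightarrow> c \<le> d \<Longrightarrow> distr_fun f d \<le> distr_fun f c"
  unfolding distr_fun_def by (intro emeasure_mono) (auto intro: le_less_trans simp del: space_I01)

text \<open>This Galois connection carries most later arguments about \<open>rearr\<close>. From
  left to right it is the definition of the infimum. The converse needs right continuity of the
  distribution function: the sets where \<open>f\<close> exceeds \<open>s n\<close>, with
  \<open>s n\<close> decreasing to \<open>c\<close>, exhaust the set where \<open>f\<close> exceeds
  \<open>c\<close>, so some level strictly above \<open>c\<close> still has measure greater than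
  \<open>t\<close>.\<close>

lemma rearr_greater_iff:
  assumes f [measurable]: "f \<in> borel_measurable I01"
  shows "c < rearr f t \<longleftrightarrow> ennreal t < distr_fun f c"
proof
  assume "c < rearr f t"
  then show "ennreal t < distr_fun f c"
    unfolding rearr_def distr_fun_def by (rule contrapos_pp) (auto simp: not_less intro!: Inf_lower)
next
  assume gt: "ennreal t < distr_fun f c"
  have "c \<noteq> top" using gt unfolding distr_fun_def by (metis (no_types, lifting) Collect_empty_eq emeasure_empty not_less_zero not_top_less)
  then obtain r where r: "c = ennreal r" "0 \<le> r" by (cases c) auto
  define s where "s n = ennreal (r + 1 / real (Suc n))" for n
  have s1: "decseq s"
    unfolding decseq_def s_def by (auto intro!: ennreal_leI frac_le)
  have s2: "c < s n" for n unfolding s_def r using r(2) by (intro ennreal_lessI) (auto intro!: add_nonneg_pos)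
  have "(\<lambda>n. r + 1 / real (Suc n)) \<longlonglongrightarrow> r + 0"
    by (intro tendsto_add tendsto_const LIMSEQ_Suc lim_const_over_n)
  then have s3: "s \<longlonglongrightarrow> c"
    unfolding s_def r by (intro tendsto_ennrealI) simp
  note s = s1 s2 s3
  have "(\<Union>n. {x \<in> space I01. s n < f x}) = {x \<in> space I01. c < f x}"
  proof (intro equalityI subsetI)
    fix x assume x: "x \<in> {x \<in> space I01. c < f x}"
    then have "\<forall>\<^sub>F n in sequentially. s n < f x" using s(3) by (auto intro: order_tendstoD)
    then obtain n where "s n < f x" by (auto simp: eventually_sequentially)
    then show "x \<in> (\<Union>n. {x \<in> space I01. s n < f x})" using x by auto
  qed (use s(2) in \<open>auto intro: less_trans\<close>)
  moreover have "(SUP n. emeasure I01 {x \<in> space I01. s n < f x}) = emeasure I01 (\<Union>n. {x \<in> space I01. s n < f x})"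
    using s(1) by (intro SUP_emeasure_incseq)
      (auto simp: incseq_def decseq_def simp del: space_I01 intro: le_less_trans)
  ultimately have "ennreal t < (SUP n. distr_fun f (s n))" using gt by (simp add: distr_fun_def)
  then obtain n where n: "ennreal t < distr_fun f (s n)" by (auto simp: less_SUP_iff)
  have "s n \<le> rearr f t"
    unfolding rearr_def
  proof (rule Inf_greatest)
    fix d assume "d \<in> {c. emeasure I01 {x \<in> space I01. c < f x} \<le> ennreal t}"
    then have "distr_fun f d \<le> ennreal t" by (simp add: distr_fun_def)
    then show "s n \<le> d" using n distr_fun_antimono[OF f, of d "s n"] by (meson leD le_less_trans linear)
  qed
  then show "c < rearr f t" using s(2) less_le_trans by blast
qed

lemma antimono_rearr: "antimono (rearr f)"
  unfolding antimono_def rearr_def by (auto intro!: Inf_superset_mono intro: order_trans ennreal_leI)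

lemma rearr_measurable [measurable]: "rearr f \<in> borel_measurable I01"
  by (intro borel_measurable_I01 antimono_borel antimono_rearr)

text \<open>By \<open>rearr_greater_iff\<close>, the points where \<open>rearr f\<close> exceeds
  \<open>c\<close> form an initial interval of length \<open>distr_fun f c\<close>.\<close>

lemma distr_fun_rearr:
  assumes "f \<in> borel_measurable I01"
  shows "distr_fun (rearr f) c = distr_fun f c"
  unfolding distr_fun_def[of "rearr f"] using rearr_greater_iff[OF assms] emeasure_I01_lessThan[OF distr_fun_le_1]
  by simp

lemma ri_rearr: "ri_norm \<rho> \<Longrightarrow> f \<in> borel_measurable I01 \<Longrightarrow> \<rho> (rearr f) = \<rho> f"
  by (rule ri_equi) (auto simp: distr_fun_rearr)

lemma rearr_cong_distr_fun: "(\<And>c. distr_fun f c = distr_fun g c) \<Longrightarrow> rearr f = rearr g"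
  unfolding rearr_def distr_fun_def by presburger

text \<open>For decreasing functions this is right continuity on \<open>[0,\<infinity>)\<close>.\<close>
definition right_lsc :: "(real \<Rightarrow> ennreal) \<Rightarrow> bool" where
  "right_lsc u \<longleftrightarrow> (\<forall>x c. 0 \<le> x \<longrightarrow> c < u x \<longrightarrow> (\<exists>y>x. c < u y))"

lemma right_lsc_rearr:
  assumes "f \<in> borel_measurable I01"
  shows "right_lsc (rearr f)"
  unfolding right_lsc_def
proof safe
  fix x :: real and c assume x: "0 \<le> x" and c: "c < rearr f x"
  then have l: "ennreal x < distr_fun f c" using rearr_greater_iff[OF assms] by simp
  then obtain m where m: "distr_fun f c = ennreal m" "0 \<le> m"
    using distr_fun_le_1[of f c] by (cases "distr_fun f c") (auto simp: top_unique)
  then have "x < m" using l x by (simp add: ennreal_less_iff)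
  then obtain y where "x < y" "y < m" using dense by blast
  then have "ennreal y < distr_fun f c" using m x by (simp add: ennreal_less_iff)
  then show "\<exists>y>x. c < rearr f y" using rearr_greater_iff[OF assms] \<open>x < y\<close> by blast
qed

text \<open>A decreasing function can differ from its rearrangement at jumps, where the latter takes
  the right limit. This inequality holds at jumps too, because the points where \<open>u\<close>
  exceeds \<open>u t\<close> all lie to the left of \<open>t\<close>.\<close>

lemma rearr_le_antimono:
  assumes u: "\<And>x y. 0 < x \<Longrightarrow> x \<le> y \<Longrightarrow> y < 1 \<Longrightarrow> u y \<le> u x" "u \<in> borel_measurable I01" and t: "0 < t" "t < 1"
  shows "rearr u t \<le> u t"
proof -
  have "{x \<in> space I01. u t < u x} \<subseteq> {0<..<t}"
    using u(1)[OF t(1)] by (auto simp: not_le[symmetric])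
  then have "distr_fun u (u t) \<le> emeasure I01 {0<..<t}"
    unfolding distr_fun_def using t by (intro emeasure_mono) (auto simp: sets_restrict_space)
  also have "\<dots> = ennreal t" using t by (simp add: emeasure_I01_interval)
  finally show ?thesis using rearr_greater_iff[OF u(2), of "u t" t] by (meson leD leI)
qed

text \<open>The condition \<open>rc\<close> is right continuity at \<open>t\<close>: if
  \<open>u\<close> still exceeds \<open>c\<close> at some \<open>y\<close> beyond \<open>t\<close>,
  then it does so on all of (0,y), a set of measure greater than \<open>t\<close>.\<close>

lemma le_rearr_antimono:
  assumes u: "\<And>x y. 0 < x \<Longrightarrow> x \<le> y \<Longrightarrow> y < 1 \<Longrightarrow> u y \<le> u x" "u \<in> borel_measurable I01" and t: "0 < t" "t < 1"
    and rc: "\<And>c. c < u t \<Longrightarrow> \<exists>y>t. y < 1 \<and> c < u y"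
  shows "u t \<le> rearr u t"
proof (rule dense_le)
  fix c assume "c < u t"
  then obtain y where y: "t < y" "y < 1" "c < u y" using rc by blast
  have "ennreal t < ennreal y" using y t by (simp add: ennreal_less_iff)
  also have "\<dots> = emeasure I01 {0<..<y}" using y t by (simp add: emeasure_I01_interval)
  also have "\<dots> \<le> distr_fun u c"
    unfolding distr_fun_def using y u t by (intro emeasure_mono) (auto intro: less_le_trans simp del: space_I01)
  finally show "c \<le> rearr u t" using rearr_greater_iff[OF u(2)] by (simp add: less_imp_le)
qed

section \<open>Layer cake formula and the Hardy--Littlewood inequality\<close>

lemma nn_integral_less_ennreal:
  "(\<integral>\<^sup>+c. indicator {c. 0 \<le> c \<and> ennreal c < y} c \<partial>lborel) = y"
proof (cases y)
  case (real r)
  have "{c. 0 \<le> c \<and> ennreal c < y} = {0..<r}" using real by (auto simp: ennreal_less_iff)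
  then show ?thesis using real by simp
next
  case top
  have "top = (SUP n. of_nat n :: ennreal)" by (simp add: ennreal_SUP_of_nat_eq_top)
  also have "\<dots> \<le> emeasure lborel {0::real..}"
  proof (rule SUP_least)
    fix n
    have "of_nat n = emeasure lborel {0..real n}" by (simp add: ennreal_of_nat_eq_real_of_nat)
    also have "\<dots> \<le> emeasure lborel {0::real..}" by (rule emeasure_mono) auto
    finally show "of_nat n \<le> emeasure lborel {0::real..}" .
  qed
  finally have "emeasure lborel {0::real..} = top" by (simp add: top_unique)
  moreover have "{c. 0 \<le> c \<and> ennreal c < y} = {0..}" using top by auto
  ultimately show ?thesis using top by simp
qed

text \<open>Only the factor \<open>a\<close> is cut into layers. The formula can therefore be
  applied a second time, to \<open>b\<close> against the indicator of a layer of
  \<open>a\<close>.\<close>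

lemma layer_cake_mult:
  assumes [measurable]: "a \<in> borel_measurable I01" "b \<in> borel_measurable I01"
  shows "(\<integral>\<^sup>+x. a x * b x \<partial>I01) =
    (\<integral>\<^sup>+c. indicator {0..} c * (\<integral>\<^sup>+x. b x * indicator {x. ennreal c < a x} x \<partial>I01) \<partial>lborel)"
proof -
  interpret I: sigma_finite_measure I01 by (rule sigma_finite_I01)
  interpret P: pair_sigma_finite I01 lborel ..
  have "(\<integral>\<^sup>+x. a x * b x \<partial>I01) =
      (\<integral>\<^sup>+x. (\<integral>\<^sup>+c. indicator {c. 0 \<le> c \<and> ennreal c < a x} c * b x \<partial>lborel) \<partial>I01)"
    by (subst nn_integral_multc) (auto simp: nn_integral_less_ennreal)
  also have "\<dots> = (\<integral>\<^sup>+x. (\<integral>\<^sup>+c. (if 0 \<le> c \<and> ennreal c < a x then b x else 0) \<partial>lborel) \<partial>I01)"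
    by (intro nn_integral_cong) (auto simp: indicator_def)
  also have "\<dots> = (\<integral>\<^sup>+c. (\<integral>\<^sup>+x. (if 0 \<le> c \<and> ennreal c < a x then b x else 0) \<partial>I01) \<partial>lborel)"
    by (rule P.Fubini'[symmetric]) measurable
  also have "\<dots> = (\<integral>\<^sup>+c. (\<integral>\<^sup>+x. indicator {0..} c * (b x * indicator {x. ennreal c < a x} x) \<partial>I01) \<partial>lborel)"
    by (intro nn_integral_cong) (auto simp: indicator_def)
  also have "\<dots> = (\<integral>\<^sup>+c. indicator {0..} c * (\<integral>\<^sup>+x. b x * indicator {x. ennreal c < a x} x \<partial>I01) \<partial>lborel)"
  proof (intro nn_integral_cong nn_integral_cmult)
    fix c
    have "(\<lambda>x. if ennreal c < a x then b x else 0) \<in> borel_measurable I01" by measurable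
    moreover have "(\<lambda>x. b x * indicator {x. ennreal c < a x} x) = (\<lambda>x. if ennreal c < a x then b x else 0)"
      by (auto simp: indicator_def)
    ultimately show "(\<lambda>x. b x * indicator {x. ennreal c < a x} x) \<in> borel_measurable I01" by simp
  qed
  finally show ?thesis .
qed

text \<open>Two applications of the layer cake formula write the integral of a product as a double
  integral, over levels \<open>c\<close> and \<open>d\<close>, of the measure of the set in
  \<open>le\<close>. Both halves of the rearrangement theory, the Hardy--Littlewood bound and its
  attainment in \<open>resonance\<close>, follow from this comparison.\<close>

lemma nn_integral_mult_mono_distr_fun:
  assumes m [measurable]: "a \<in> borel_measurable I01" "b \<in> borel_measurable I01"
      "a' \<in> borel_measurable I01" "b' \<in> borel_measurable I01"
    and le: "\<And>c d. emeasure I01 {x \<in> space I01. c < a x \<and> d < b x} \<le> emeasure I01 {x \<in> space I01. c < a' x \<and> d < b' x}"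
  shows "(\<integral>\<^sup>+x. a x * b x \<partial>I01) \<le> (\<integral>\<^sup>+x. a' x * b' x \<partial>I01)"
proof -
  have *: "(\<integral>\<^sup>+x. b x * indicator {x. ennreal c < a x} x \<partial>I01) =
      (\<integral>\<^sup>+d. indicator {0..} d * emeasure I01 {x \<in> space I01. ennreal c < a x \<and> ennreal d < b x} \<partial>lborel)"
    if [measurable]: "a \<in> borel_measurable I01" "b \<in> borel_measurable I01" for a b and c :: real
  proof -
    have [measurable]: "indicator {x. ennreal c < a x} \<in> borel_measurable I01"
      by (subst measurable_cong[of _ _ "indicator {x \<in> space I01. ennreal c < a x}"])
         (auto simp: indicator_def simp del: space_I01 intro!: borel_measurable_indicator)
    have "(\<integral>\<^sup>+x. indicator {x. ennreal c < a x} x * indicator {x. ennreal d < b x} x \<partial>I01) =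
        emeasure I01 {x \<in> space I01. ennreal c < a x \<and> ennreal d < b x}" for d
    proof -
      have "(\<integral>\<^sup>+x. indicator {x. ennreal c < a x} x * indicator {x. ennreal d < b x} x \<partial>I01) =
        (\<integral>\<^sup>+x. indicator {x \<in> space I01. ennreal c < a x \<and> ennreal d < b x} x \<partial>I01)"
        by (intro nn_integral_cong) (auto simp: indicator_def)
      also have "\<dots> = emeasure I01 {x \<in> space I01. ennreal c < a x \<and> ennreal d < b x}"
        by (rule nn_integral_indicator) measurable
      finally show ?thesis .
    qed
    then show ?thesis by (subst layer_cake_mult) (auto simp del: space_I01)
  qed
  show ?thesis
    unfolding layer_cake_mult[OF m(1,2)] layer_cake_mult[OF m(3,4)] *[OF m(1,2)] *[OF m(3,4)]
    by (intro nn_integral_mono mult_left_mono le) auto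
qed

text \<open>An intersection of two superlevel sets is no larger than the smaller of the two. For the
  rearrangements these sets are initial intervals, hence nested, and equality holds.\<close>

theorem Hardy_Littlewood:
  assumes [measurable]: "a \<in> borel_measurable I01" "b \<in> borel_measurable I01"
  shows "(\<integral>\<^sup>+x. a x * b x \<partial>I01) \<le> (\<integral>\<^sup>+x. rearr a x * rearr b x \<partial>I01)"
proof (rule nn_integral_mult_mono_distr_fun)
  fix c d
  have "emeasure I01 {x \<in> space I01. c < a x \<and> d < b x} \<le> min (distr_fun a c) (distr_fun b d)"
    unfolding distr_fun_def min_def by (auto intro!: emeasure_mono simp del: space_I01)
  also have "\<dots> = emeasure I01 {t \<in> space I01. ennreal t < min (distr_fun a c) (distr_fun b d)}"
    by (rule emeasure_I01_lessThan[symmetric]) (auto simp: min_def distr_fun_le_1)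
  also have "\<dots> = emeasure I01 {x \<in> space I01. c < rearr a x \<and> d < rearr b x}"
    by (simp add: rearr_greater_iff)
  finally show "emeasure I01 {x \<in> space I01. c < a x \<and> d < b x} \<le>
      emeasure I01 {x \<in> space I01. c < rearr a x \<and> d < rearr b x}" .
qed auto

lemma Hardy_Littlewood_antimono:
  assumes [measurable]: "a \<in> borel_measurable I01" "b \<in> borel_measurable I01"
    and b: "\<And>x y. 0 < x \<Longrightarrow> x \<le> y \<Longrightarrow> y < 1 \<Longrightarrow> b y \<le> b x"
  shows "(\<integral>\<^sup>+x. a x * b x \<partial>I01) \<le> (\<integral>\<^sup>+x. rearr a x * b x \<partial>I01)"
proof -
  have "(\<integral>\<^sup>+x. a x * b x \<partial>I01) \<le> (\<integral>\<^sup>+x. rearr a x * rearr b x \<partial>I01)"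
    by (rule Hardy_Littlewood) measurable
  also have "\<dots> \<le> (\<integral>\<^sup>+x. rearr a x * b x \<partial>I01)"
    using b by (intro nn_integral_mono mult_left_mono rearr_le_antimono) auto
  finally show ?thesis .
qed

section \<open>Realising a decreasing function along another function\<close>

lemma borel_Int_I01: "S \<in> sets borel \<Longrightarrow> S \<inter> {0<..<1} \<in> sets I01"
proof -
  assume "S \<in> sets borel"
  then have "S \<in> sets lebesgue" by simp
  then have "{0<..<1} \<inter> S \<in> (\<inter>) {0<..<1} ` sets lebesgue" by (rule imageI)
  then show ?thesis by (simp only: sets_restrict_space Int_commute)
qed

text \<open>Points are ordered by decreasing value of \<open>f\<close>, and by position among equal
  values. The segment consists of all points above the level \<open>c = rearr f t\<close>, together
  with the left part of the level set at \<open>c\<close> that supplies the missing measure.\<close>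

lemma exists_initial_segment:
  fixes f :: "real \<Rightarrow> ennreal"
  assumes f [measurable]: "f \<in> borel_measurable I01" and t: "0 \<le> t" "t \<le> 1"
  obtains E where "E \<in> sets I01" "emeasure I01 E = ennreal t"
    "\<And>x y. x \<in> E \<Longrightarrow> y \<in> space I01 \<Longrightarrow> f x < f y \<or> (f y = f x \<and> y < x) \<Longrightarrow> y \<in> E"
proof -
  interpret finite_measure I01 by (rule finite_measure_I01)
  define c where "c = rearr f t"
  define A where "A = {x \<in> space I01. c < f x}"
  define B where "B = {x \<in> space I01. f x = c}"
  have A [measurable]: "A \<in> sets I01" unfolding A_def by measurable
  have B [measurable]: "B \<in> sets I01" unfolding B_def by measurable
  have AB: "A \<inter> B = {}" by (auto simp: A_def B_def)
  have I [measurable]: "{0<..<s} \<inter> {0<..<1} \<in> sets I01" for s by (rule borel_Int_I01) simp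
  have Alt: "emeasure I01 A \<le> ennreal t"
    using rearr_greater_iff[OF f, of c t] by (simp add: c_def A_def distr_fun_def)
  have ABge: "ennreal t \<le> emeasure I01 (A \<union> B)"
  proof (cases "c = 0")
    case True
    then have "A \<union> B = space I01" by (auto simp: A_def B_def zero_less_iff_neq_zero)
    then show ?thesis using t emeasure_I01_interval[of 0 1] by simp
  next
    case False
    then obtain q where q: "\<And>n. q n < c" "q \<longlonglongrightarrow> c"
      using approx_from_below_dense_linorder[of 0 c] by (auto simp: zero_less_iff_neq_zero)
    \<comment> \<open>The sequence \<open>q\<close> need not be increasing; the running maximum
      makes the sets \<open>E n\<close> decrease.\<close>
    define E where "E n = {x \<in> space I01. Max (q ` {..n}) < f x}" for n :: nat
    have E [measurable]: "E n \<in> sets I01" for n unfolding E_def by measurable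
    have "(\<Inter>n. E n) = A \<union> B"
    proof (intro equalityI subsetI)
      fix x assume x: "x \<in> (\<Inter>n. E n)"
      then have sp: "x \<in> space I01" by (auto simp: E_def)
      have "q n \<le> f x" for n
      proof -
        have "q n \<le> Max (q ` {..n})" by (intro Max_ge) auto
        also have "\<dots> < f x" using x by (auto simp: E_def)
        finally show ?thesis by simp
      qed
      then have "c \<le> f x" using q(2) by (intro LIMSEQ_le_const2) auto
      then show "x \<in> A \<union> B" using sp by (auto simp: A_def B_def le_less)
    next
      fix x assume "x \<in> A \<union> B"
      then have "x \<in> space I01" "c \<le> f x" by (auto simp: A_def B_def)
      then show "x \<in> (\<Inter>n. E n)" using q(1) by (auto simp: E_def intro: less_le_trans)
    qed
    moreover have "decseq E"
      unfolding decseq_def E_def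
    proof safe
      fix m n :: nat and x assume "m \<le> n" "Max (q ` {..n}) < f x"
      moreover have "Max (q ` {..m}) \<le> Max (q ` {..n})"
        using \<open>m \<le> n\<close> by (intro Max_mono) auto
      ultimately show "Max (q ` {..m}) < f x" by simp
    qed
    then have "(INF n. emeasure I01 (E n)) = emeasure I01 (\<Inter>n. E n)"
      by (intro INF_emeasure_decseq) auto
    moreover have "ennreal t \<le> emeasure I01 (E n)" for n
    proof -
      have "Max (q ` {..n}) < c" using q(1) by auto
      then have "ennreal t < distr_fun f (Max (q ` {..n}))" unfolding c_def using rearr_greater_iff[OF f] by simp
      then show ?thesis by (simp add: distr_fun_def E_def)
    qed
    ultimately show ?thesis by (metis INF_greatest)
  qed
  \<comment> \<open>The measure of the part of the level set to the left of \<open>s\<close> is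
    1-Lipschitz in \<open>s\<close>, so the intermediate value theorem finds a cut with exactly the
    prescribed measure.\<close>
  define \<phi> where "\<phi> s = measure I01 (B \<inter> ({0<..<s} \<inter> {0<..<1}))" for s
  have mA: "measure I01 A \<le> t" using Alt t by (simp add: emeasure_eq_measure)
  have "t \<le> measure I01 (A \<union> B)" using ABge t by (simp add: emeasure_eq_measure)
  also have "\<dots> = measure I01 A + measure I01 B" using AB by (intro finite_measure_Union) auto
  also have "B = B \<inter> ({0<..<1} \<inter> {0<..<1})" by (auto simp: B_def)
  finally have ge: "t - measure I01 A \<le> \<phi> 1" by (simp add: \<phi>_def)
  have lip: "\<phi> s' - \<phi> s \<le> s' - s" "\<phi> s \<le> \<phi> s'" if "0 \<le> s" "s \<le> s'" "s' \<le> 1" for s s'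
  proof -
    have sp: "{s..<s'} \<inter> {0<..<1} \<in> sets I01" by (rule borel_Int_I01) simp
    have "\<phi> s' \<le> measure I01 ((B \<inter> ({0<..<s} \<inter> {0<..<1})) \<union> ({s..<s'} \<inter> {0<..<1}))"
      unfolding \<phi>_def by (intro finite_measure_mono sets.Un sets.Int B I sp) auto
    also have "\<dots> \<le> \<phi> s + measure I01 ({s..<s'} \<inter> {0<..<1})"
      unfolding \<phi>_def by (intro measure_Un_le sets.Int B I sp)
    also have "measure I01 ({s..<s'} \<inter> {0<..<1}) \<le> s' - s"
    proof -
      have "emeasure I01 ({s..<s'} \<inter> {0<..<1}) = emeasure lborel ({s..<s'} \<inter> {0<..<1})"
        by (rule emeasure_I01_borel) auto
      also have "\<dots> \<le> emeasure lborel {s..<s'}" by (rule emeasure_mono) auto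
      finally show ?thesis using that by (simp add: emeasure_eq_measure)
    qed
    finally show "\<phi> s' - \<phi> s \<le> s' - s" by simp
    show "\<phi> s \<le> \<phi> s'" unfolding \<phi>_def using that by (intro finite_measure_mono sets.Int B I) auto
  qed
  have "continuous_on {0..1} \<phi>"
  proof (rule continuous_on_iff[THEN iffD2], intro ballI allI impI)
    fix x e :: real assume x: "x \<in> {0..1}" "0 < e"
    have "dist (\<phi> y) (\<phi> x) \<le> dist y x" if "y \<in> {0..1}" for y
      using lip[of x y] lip[of y x] x that by (cases "x \<le> y") (auto simp: dist_real_def)
    then show "\<exists>d>0. \<forall>y\<in>{0..1}. dist y x < d \<longrightarrow> dist (\<phi> y) (\<phi> x) < e"
      using x(2) by (metis le_less_trans)
  qed
  moreover have "\<phi> 0 \<le> t - measure I01 A" using mA by (simp add: \<phi>_def)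
  ultimately obtain s where s: "0 \<le> s" "s \<le> 1" "\<phi> s = t - measure I01 A"
    using ge IVT'[of \<phi> 0 "t - measure I01 A" 1] by auto
  let ?E = "A \<union> (B \<inter> ({0<..<s} \<inter> {0<..<1}))"
  show ?thesis
  proof (rule that[of ?E])
    show "?E \<in> sets I01" by measurable
    have "measure I01 ?E = measure I01 A + \<phi> s"
      unfolding \<phi>_def using AB by (intro finite_measure_Union sets.Int A B I) auto
    then show "emeasure I01 ?E = ennreal t" using s by (simp add: emeasure_eq_measure)
  next
    fix x y assume "x \<in> ?E" "y \<in> space I01" "f x < f y \<or> (f y = f x \<and> y < x)"
    then show "y \<in> ?E" by (auto simp: A_def B_def intro: less_trans)
  qed
qed

text \<open>\<open>D x\<close> below is the rank of \<open>x\<close> when the points are ordered by decreasing value of \<open>f\<close>,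
  ties being broken by position; it is uniformly distributed.\<close>
lemma resonance:
  fixes f k :: "real \<Rightarrow> ennreal"
  assumes f [measurable]: "f \<in> borel_measurable I01" and k: "antimono k"
  obtains k' where "k' \<in> borel_measurable I01" "\<And>c. distr_fun k' c = distr_fun k c"
    "(\<integral>\<^sup>+x. rearr f x * k x \<partial>I01) \<le> (\<integral>\<^sup>+x. f x * k' x \<partial>I01)"
proof -
  interpret I: finite_measure I01 by (rule finite_measure_I01)
  define before where "before y x \<longleftrightarrow> f x < f y \<or> (f y = f x \<and> y < x)" for x y :: real
  define A where "A x = {y \<in> space I01. before y x}" for x
  define D where "D x = measure I01 (A x)" for x
  have A [measurable]: "A x \<in> sets I01" for x unfolding A_def before_def by measurable
  have kb [measurable]: "k \<in> borel_measurable borel" using k by (rule antimono_borel)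
  have emD: "emeasure I01 (A x) = ennreal (D x)" for x by (simp add: D_def I.emeasure_eq_measure)
  have D01: "0 \<le> D x" "D x \<le> 1" for x
    using emeasure_I01_le_1[of "A x"] unfolding emD by (auto simp: D_def)
  have Dm [measurable]: "D \<in> borel_measurable I01"
  proof -
    have "(\<lambda>x. \<integral>\<^sup>+y. (if f x < f y \<or> (f y = f x \<and> y < x) then 1 else 0) \<partial>I01) \<in> borel_measurable I01"
      by measurable
    moreover have "(\<integral>\<^sup>+y. (if f x < f y \<or> (f y = f x \<and> y < x) then 1 else 0) \<partial>I01) = ennreal (D x)" for x
    proof -
      have "(\<integral>\<^sup>+y. (if f x < f y \<or> (f y = f x \<and> y < x) then 1 else 0) \<partial>I01) = (\<integral>\<^sup>+y. indicator (A x) y \<partial>I01)"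
        by (intro nn_integral_cong) (auto simp: A_def before_def indicator_def)
      then show ?thesis by (simp add: emD)
    qed
    ultimately have "(\<lambda>x. ennreal (D x)) \<in> borel_measurable I01" by simp
    then have "(\<lambda>x. enn2real (ennreal (D x))) \<in> borel_measurable I01" by measurable
    then show ?thesis using D01 by simp
  qed
  have Dmono: "D x \<le> D z" if "before x z" for x z
    unfolding D_def
  proof (rule I.finite_measure_mono[OF _ A])
    show "A x \<subseteq> A z" using that by (auto simp: A_def before_def intro: less_trans)
  qed
  \<comment> \<open>An initial segment \<open>E\<close> of measure \<open>t\<close> separates the
    ranks: points outside \<open>E\<close> have all of \<open>E\<close> before them, hence rank at
    least \<open>t\<close>, and points of \<open>E\<close> are preceded only by points of
    \<open>E\<close>, hence have rank at most \<open>t\<close>.\<close>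
  have bounds: "measure I01 {x \<in> space I01. D x < t} \<le> t \<and> t \<le> measure I01 {x \<in> space I01. D x \<le> t}"
    if t: "0 \<le> t" "t \<le> 1" for t
  proof -
    obtain E where E: "E \<in> sets I01" "emeasure I01 E = ennreal t"
      "\<And>x y. x \<in> E \<Longrightarrow> y \<in> space I01 \<Longrightarrow> before y x \<Longrightarrow> y \<in> E"
      using exists_initial_segment[OF f t] unfolding before_def by metis
    have mE: "measure I01 E = t" using E(2) t by (simp add: I.emeasure_eq_measure)
    have "D x \<ge> t" if x: "x \<in> space I01" "x \<notin> E" for x
    proof -
      have "E \<subseteq> A x"
      proof
        fix y assume y: "y \<in> E"
        then have ysp: "y \<in> space I01" using E(1) sets.sets_into_space by blast
        have "\<not> before x y" using E(3)[OF y x(1)] x(2) by blast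
        then have "before y x" using x(2) y unfolding before_def by (metis linorder_neqE)
        then show "y \<in> A x" using ysp by (simp add: A_def)
      qed
      then show ?thesis unfolding D_def mE[symmetric] by (intro I.finite_measure_mono) auto
    qed
    then have "{x \<in> space I01. D x < t} \<subseteq> E" by force
    moreover have "E \<subseteq> {x \<in> space I01. D x \<le> t}"
    proof
      fix x assume x: "x \<in> E"
      have "A x \<subseteq> E" using E(3)[OF x] by (auto simp: A_def)
      then have "D x \<le> t" unfolding D_def mE[symmetric] using E(1) by (intro I.finite_measure_mono) auto
      then show "x \<in> {x \<in> space I01. D x \<le> t}" using x E(1) sets.sets_into_space by blast
    qed
    moreover have "{x \<in> space I01. D x \<le> t} \<in> sets I01" by measurable
    ultimately show ?thesis
      unfolding mE[symmetric] using E(1) by (intro conjI I.finite_measure_mono)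
  qed
  have ms: "{x \<in> space I01. D x < t} \<in> sets I01" for t by measurable
  \<comment> \<open>The bounds come with strict and weak inequalities the wrong way round; shifting
    \<open>t\<close> by an arbitrary \<open>e\<close> exchanges them.\<close>
  have lt: "measure I01 {x \<in> space I01. D x < t} \<ge> t" if t: "0 \<le> t" "t \<le> 1" for t
  proof (rule field_le_epsilon)
    fix e :: real assume e: "0 < e"
    have "max 0 (t - e) \<le> measure I01 {x \<in> space I01. D x \<le> max 0 (t - e)}"
      using bounds[of "max 0 (t - e)"] t e by auto
    also have "\<dots> \<le> measure I01 {x \<in> space I01. D x < t}" if "t \<noteq> 0"
      using t e that by (intro I.finite_measure_mono ms) auto
    finally show "t \<le> measure I01 {x \<in> space I01. D x < t} + e" using e by (cases "t = 0") auto
  qed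
  have le: "measure I01 {x \<in> space I01. D x \<le> t} \<le> t" if t: "0 \<le> t" "t \<le> 1" for t
  proof (rule field_le_epsilon)
    fix e :: real assume e: "0 < e"
    show "measure I01 {x \<in> space I01. D x \<le> t} \<le> t + e"
    proof (cases "t + e \<le> 1")
      case True
      have "measure I01 {x \<in> space I01. D x \<le> t} \<le> measure I01 {x \<in> space I01. D x < t + e}"
        using e by (intro I.finite_measure_mono ms) auto
      also have "\<dots> \<le> t + e" using bounds[of "t + e"] True t e by auto
      finally show ?thesis .
    next
      case False
      have "measure I01 {x \<in> space I01. D x \<le> t} \<le> 1"
        using emeasure_I01_le_1 by (simp add: I.emeasure_eq_measure)
      then show ?thesis using False by linarith
    qed
  qed
  let ?k' = "\<lambda>x. k (D x)"
  have k'm [measurable]: "?k' \<in> borel_measurable I01" by measurable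
  have km [measurable]: "k \<in> borel_measurable I01" by (rule borel_measurable_I01) measurable
  have distr_fun: "distr_fun ?k' d = distr_fun k d" for d
  proof -
    obtain r where r: "distr_fun k d = ennreal r" "0 \<le> r" "r \<le> 1"
      using distr_fun_le_1[of k d] by (cases "distr_fun k d") (auto simp: top_unique)
    \<comment> \<open>The set where \<open>k\<close> exceeds \<open>d\<close> is an initial interval
      of length \<open>r\<close>. Whether it contains its right end is unknown, so facts 1 and 2
      treat \<open>y < r\<close> and \<open>y \<le> r\<close> separately.\<close>
    have 1: "d < k y" if "0 \<le> y" "y < r" for y
    proof (rule ccontr)
      assume n: "\<not> d < k y"
      have "distr_fun k d \<le> emeasure I01 {0<..<y}"
        unfolding distr_fun_def
      proof (intro emeasure_mono subsetI)
        fix x assume x: "x \<in> {x \<in> space I01. d < k x}"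
        have "\<not> y \<le> x" using antimonoD[OF k, of y x] n x by (auto dest: less_le_trans)
        then show "x \<in> {0<..<y}" using x by auto
      qed (use that r in \<open>auto simp: sets_restrict_space\<close>)
      also have "\<dots> = ennreal y" using that r by (simp add: emeasure_I01_interval)
      finally show False using r that by simp
    qed
    have 2: "y \<le> r" if "0 \<le> y" "y \<le> 1" "d < k y" for y
    proof -
      have "ennreal y = emeasure I01 {0<..<y}" using that by (simp add: emeasure_I01_interval)
      also have "\<dots> \<le> distr_fun k d"
        unfolding distr_fun_def
      proof (intro emeasure_mono subsetI)
        fix x assume "x \<in> {0<..<y}"
        then show "x \<in> {x \<in> space I01. d < k x}"
          using that antimonoD[OF k, of x y] by (auto intro: less_le_trans)
      qed (use km in simp)
      finally show ?thesis using r by simp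
    qed
    have "emeasure I01 {x \<in> space I01. D x < r} \<le> distr_fun ?k' d"
      unfolding distr_fun_def using 1 D01 superlevel_set_measurable[OF k'm] by (intro emeasure_mono) auto
    moreover have "distr_fun ?k' d \<le> emeasure I01 {x \<in> space I01. D x \<le> r}"
    proof -
      have "{x \<in> space I01. D x \<le> r} \<in> sets I01" by measurable
      then show ?thesis unfolding distr_fun_def using 2 D01 by (intro emeasure_mono) auto
    qed
    moreover have "ennreal r \<le> emeasure I01 {x \<in> space I01. D x < r}"
      using lt[of r] r by (simp add: I.emeasure_eq_measure)
    moreover have "emeasure I01 {x \<in> space I01. D x \<le> r} \<le> ennreal r"
      using le[of r] r by (simp add: I.emeasure_eq_measure)
    ultimately show ?thesis unfolding r by order
  qed
  show ?thesis
  proof (rule that[OF k'm distr_fun])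
    show "(\<integral>\<^sup>+x. rearr f x * k x \<partial>I01) \<le> (\<integral>\<^sup>+x. f x * k (D x) \<partial>I01)"
    proof (rule nn_integral_mult_mono_distr_fun)
      fix c d
      have "emeasure I01 {x \<in> space I01. c < rearr f x \<and> d < k x} \<le> min (distr_fun (rearr f) c) (distr_fun k d)"
        unfolding distr_fun_def min_def by (auto intro!: emeasure_mono)
      also have "\<dots> = min (distr_fun f c) (distr_fun ?k' d)" by (simp add: distr_fun distr_fun_rearr)
      \<comment> \<open>Superlevel sets of \<open>f\<close> and of \<open>k (D x)\<close> are both
        initial segments of the same order, so one contains the other and their intersection has the
        smaller measure.\<close>
      also have "\<dots> \<le> emeasure I01 {x \<in> space I01. c < f x \<and> d < k (D x)}"
      proof (cases "{x \<in> space I01. d < k (D x)} \<subseteq> {x \<in> space I01. c < f x}")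
        case True
        then have "{x \<in> space I01. c < f x \<and> d < k (D x)} = {x \<in> space I01. d < k (D x)}" by auto
        then show ?thesis by (simp only: distr_fun_def[of ?k', symmetric]) simp
      next
        case False
        then obtain z where z: "z \<in> space I01" "d < k (D z)" "f z \<le> c" by (auto simp: not_less[symmetric])
        have "d < k (D x)" if "c < f x" for x
        proof -
          have "D x \<le> D z" by (rule Dmono) (use z that in \<open>auto simp: before_def\<close>)
          then show ?thesis using z antimonoD[OF k] by (blast intro: less_le_trans)
        qed
        then have "{x \<in> space I01. c < f x \<and> d < k (D x)} = {x \<in> space I01. c < f x}" by auto
        then show ?thesis by (simp only: distr_fun_def[of f, symmetric]) simp
      qed
      finally show "emeasure I01 {x \<in> space I01. c < rearr f x \<and> d < k x} \<le>
          emeasure I01 {x \<in> space I01. c < f x \<and> d < k (D x)}" .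
    qed auto
  qed
qed

section \<open>Step functions and averaging\<close>

definition step_fun :: "nat \<Rightarrow> (nat \<Rightarrow> ennreal) \<Rightarrow> real \<Rightarrow> ennreal" where
  "step_fun N v x = v (nat \<lfloor>real N * x\<rfloor>)"

lemma step_fun_index_measurable [measurable]:
  "(\<lambda>x. nat \<lfloor>real N * x\<rfloor>) \<in> measurable I01 (count_space UNIV)"
proof -
  have "(\<lambda>x. nat \<lfloor>real N * x\<rfloor>) \<in> measurable borel (count_space UNIV)" by measurable
  then show ?thesis by (intro measurable_restrict_space1 measurable_completion) simp
qed

lemma step_fun_measurable [measurable]: "step_fun N v \<in> borel_measurable I01"
  unfolding step_fun_def by measurable

lemma step_fun_index_less: "0 < x \<Longrightarrow> x < 1 \<Longrightarrow> 0 < N \<Longrightarrow> nat \<lfloor>real N * x\<rfloor> < N"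
  by (simp add: nat_less_iff floor_less_iff)

lemma step_fun_index_mono: "x \<le> y \<Longrightarrow> nat \<lfloor>real N * x\<rfloor> \<le> nat \<lfloor>real N * y\<rfloor>"
  by (intro nat_mono floor_mono mult_left_mono) auto

lemma emeasure_step_fun_index:
  assumes N: "0 < N" and i: "i < N"
  shows "emeasure I01 {x \<in> space I01. nat \<lfloor>real N * x\<rfloor> = i} = ennreal (1 / real N)"
proof -
  have iff: "nat \<lfloor>real N * x\<rfloor> = i \<longleftrightarrow> real i / real N \<le> x \<and> x < real (Suc i) / real N" if "0 < x" for x
  proof -
    have "0 \<le> \<lfloor>real N * x\<rfloor>" using that by simp
    then have "nat \<lfloor>real N * x\<rfloor> = i \<longleftrightarrow> \<lfloor>real N * x\<rfloor> = int i" by linarith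
    also have "\<dots> \<longleftrightarrow> real i \<le> real N * x \<and> real N * x < real i + 1" by (simp add: floor_eq_iff)
    also have "\<dots> \<longleftrightarrow> real i / real N \<le> x \<and> x < real (Suc i) / real N"
      using N by (simp add: field_simps)
    finally show ?thesis .
  qed
  have le: "real (Suc i) / real N \<le> 1" using N i by simp
  let ?S = "{x \<in> space I01. nat \<lfloor>real N * x\<rfloor> = i}"
  have S: "?S = {x. 0 < x \<and> real i / real N \<le> x \<and> x < real (Suc i) / real N}"
    using iff le by auto
  have "emeasure I01 ?S = emeasure lborel ?S"
    by (rule emeasure_I01_borel) (auto simp: S simp del: of_nat_Suc)
  also have "\<dots> = emeasure lborel {real i / real N..<real (Suc i) / real N}"
  proof (rule emeasure_eq_AE)
    \<comment> \<open>The two sets differ only for \<open>i = 0\<close>, by the point 0, which is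
      outside (0,1).\<close>
    show "AE x in lborel. (x \<in> ?S) = (x \<in> {real i / real N..<real (Suc i) / real N})"
      using AE_lborel_singleton[of "0::real"]
    proof eventually_elim
      case (elim x)
      have "0 \<le> real i / real N" by simp
      then show ?case unfolding S using elim by (auto simp del: of_nat_Suc divide_nonneg_nonneg simp: le_less)
    qed
  qed (auto simp: S simp del: of_nat_Suc)
  also have "\<dots> = ennreal (real (Suc i) / real N - real i / real N)"
    by (rule emeasure_lborel_Ico) (use N in \<open>simp add: divide_right_mono\<close>)
  also have "real (Suc i) / real N - real i / real N = 1 / real N"
    by (simp add: diff_divide_distrib[symmetric])
  finally show ?thesis .
qed

lemma nn_integral_step_fun:
  assumes N: "0 < N"
  shows "(\<integral>\<^sup>+x. g (nat \<lfloor>real N * x\<rfloor>) \<partial>I01) = (\<Sum>i<N. g i * ennreal (1 / real N))"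
proof -
  let ?S = "\<lambda>i. {x \<in> space I01. nat \<lfloor>real N * x\<rfloor> = i}"
  have S [measurable]: "?S i \<in> sets I01" for i by measurable
  have "(\<integral>\<^sup>+x. g (nat \<lfloor>real N * x\<rfloor>) \<partial>I01) = (\<integral>\<^sup>+x. (\<Sum>i<N. g i * indicator (?S i) x) \<partial>I01)"
  proof (rule nn_integral_cong)
    fix x assume x: "x \<in> space I01"
    have "(\<Sum>i<N. g i * indicator (?S i) x) = (\<Sum>i<N. if i = nat \<lfloor>real N * x\<rfloor> then g i else 0)"
      using x by (intro sum.cong) (auto simp: indicator_def)
    also have "\<dots> = g (nat \<lfloor>real N * x\<rfloor>)" using x step_fun_index_less[of x N] N by simp
    finally show "g (nat \<lfloor>real N * x\<rfloor>) = (\<Sum>i<N. g i * indicator (?S i) x)" by simp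
  qed
  also have "\<dots> = (\<Sum>i<N. \<integral>\<^sup>+x. g i * indicator (?S i) x \<partial>I01)"
  proof (rule nn_integral_sum)
    fix i
    have [measurable]: "(\<lambda>x. indicator (?S i) x :: ennreal) \<in> borel_measurable I01"
      by (rule borel_measurable_indicator[OF S])
    show "(\<lambda>x. g i * indicator (?S i) x) \<in> borel_measurable I01" by (rule borel_measurable_times_ennreal) (simp, fact)
  qed
  also have "\<dots> = (\<Sum>i<N. g i * ennreal (1 / real N))"
    using emeasure_step_fun_index[OF N] by (intro sum.cong refl) (subst nn_integral_cmult_indicator[OF S]; simp)
  finally show ?thesis .
qed

lemma nn_integral_step_fun_mult:
  assumes N: "0 < N"
  shows "(\<integral>\<^sup>+x. step_fun N v x * step_fun N w x \<partial>I01) = (\<Sum>i<N. v i * w i * ennreal (1 / real N))"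
  unfolding step_fun_def by (rule nn_integral_step_fun[OF N])

lemma distr_fun_step_fun:
  assumes N: "0 < N"
  shows "distr_fun (step_fun N v) c = (\<Sum>i<N. (if c < v i then 1 else 0) * ennreal (1 / real N))"
proof -
  have "distr_fun (step_fun N v) c = (\<integral>\<^sup>+x. indicator {x \<in> space I01. c < step_fun N v x} x \<partial>I01)"
    unfolding distr_fun_def by (rule nn_integral_indicator[symmetric]) measurable
  also have "\<dots> = (\<integral>\<^sup>+x. (if c < v (nat \<lfloor>real N * x\<rfloor>) then 1 else 0) \<partial>I01)"
    by (intro nn_integral_cong) (auto simp: step_fun_def indicator_def)
  also have "\<dots> = (\<Sum>i<N. (if c < v i then 1 else 0) * ennreal (1 / real N))"
    by (rule nn_integral_step_fun[OF N])
  finally show ?thesis .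
qed

lemma distr_fun_step_fun_perm:
  assumes N: "0 < N" and \<sigma>: "bij_betw \<sigma> {..<N} {..<N}"
  shows "distr_fun (step_fun N (\<lambda>i. v (\<sigma> i))) c = distr_fun (step_fun N v) c"
  unfolding distr_fun_step_fun[OF N] using sum.reindex_bij_betw[OF \<sigma>, of "\<lambda>i. (if c < v i then 1 else 0) * ennreal (1 / real N)"]
  by simp

lemma ri_step_fun_perm:
  assumes "ri_norm \<rho>" "0 < N" "bij_betw \<sigma> {..<N} {..<N}"
  shows "\<rho> (step_fun N (\<lambda>i. v (\<sigma> i))) = \<rho> (step_fun N v)"
  by (rule ri_equi[OF assms(1) step_fun_measurable step_fun_measurable distr_fun_step_fun_perm[OF assms(2,3)]])

lemma ri_step_fun_mono:
  assumes "ri_norm \<rho>" "0 < N" "\<And>i. i < N \<Longrightarrow> v i \<le> w i"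
  shows "\<rho> (step_fun N v) \<le> \<rho> (step_fun N w)"
  by (rule ri_mono[OF assms(1) step_fun_measurable step_fun_measurable])
    (use assms(2) in \<open>simp add: step_fun_def assms(3) step_fun_index_less\<close>)

lemma step_fun_index_div:
  assumes "0 \<le> x" "0 < M"
  shows "nat \<lfloor>real (n * M) * x\<rfloor> div M = nat \<lfloor>real n * x\<rfloor>"
proof -
  have "\<lfloor>real n * x\<rfloor> = \<lfloor>(real (n * M) * x) / real_of_int (int M)\<rfloor>" using assms by simp
  also have "\<dots> = \<lfloor>real (n * M) * x\<rfloor> div int M" by (rule floor_divide_real_eq_div) simp
  finally have "nat \<lfloor>real n * x\<rfloor> = nat (\<lfloor>real (n * M) * x\<rfloor> div int M)" by simp
  also have "\<dots> = nat \<lfloor>real (n * M) * x\<rfloor> div M"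
    using assms by (simp add: nat_div_distrib)
  finally show ?thesis by simp
qed
lemma cyclic_shift_bij:
  fixes M p :: nat
  assumes "0 < M"
  shows "bij_betw (\<lambda>l. (l + p) mod M) {..<M} {..<M}"
  unfolding bij_betw_def
proof
  show inj: "inj_on (\<lambda>l. (l + p) mod M) {..<M}"
  proof (rule inj_onI)
    fix a b assume ab: "a \<in> {..<M}" "b \<in> {..<M}" "(a + p) mod M = (b + p) mod M"
    then have "int M dvd int (a + p) - int (b + p)"
      by (metis mod_eq_dvd_iff zmod_int)
    then have "int M dvd int a - int b" by simp
    then have "int a mod int M = int b mod int M" by (simp add: mod_eq_dvd_iff)
    then show "a = b" using ab by simp
  qed
  show "(\<lambda>l. (l + p) mod M) ` {..<M} = {..<M}"
    by (rule endo_inj_surj[OF _ _ inj]) (use assms in auto)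
qed

text \<open>The indices below \<open>n * M\<close> are split into \<open>n\<close> consecutive
  blocks of length \<open>M\<close>, and each block is rotated by \<open>p\<close>.\<close>

lemma block_shift_bij:
  fixes M n p :: nat
  assumes "0 < M"
  shows "bij_betw (\<lambda>i. (i div M) * M + (i mod M + p) mod M) {..<n * M} {..<n * M}"
  unfolding bij_betw_def
proof
  let ?s = "\<lambda>i. (i div M) * M + (i mod M + p) mod M"
  have d: "?s i div M = i div M" "?s i mod M = (i mod M + p) mod M" for i using assms by auto
  show inj: "inj_on ?s {..<n * M}"
  proof (rule inj_onI)
    fix a b assume "?s a = ?s b"
    then have "a div M = b div M" and m: "(a mod M + p) mod M = (b mod M + p) mod M" using d by metis+
    moreover have "a mod M = b mod M"
      by (rule inj_onD[OF bij_betw_imp_inj_on[OF cyclic_shift_bij[OF assms, of p]] m]) (use assms in auto)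
    ultimately show "a = b" by (metis div_mult_mod_eq)
  qed
  have "?s i < n * M" if "i < n * M" for i
    using that d(1)[of i] assms by (metis div_less_iff_less_mult)
  then show "?s ` {..<n * M} = {..<n * M}"
    by (intro endo_inj_surj[OF _ _ inj]) auto
qed

text \<open>Rotating every block by \<open>p\<close> yields a function equimeasurable with the
  original. The mean of these functions over all \<open>p\<close> takes on each block the mean of
  \<open>w\<close> over that block, so the triangle inequality gives the bound.\<close>

lemma ri_average:
  assumes \<rho>: "ri_norm \<rho>" and n: "0 < n" and M: "0 < M"
  shows "\<rho> (step_fun n (\<lambda>k. ennreal (1 / real M) * (\<Sum>l<M. w (k * M + l)))) \<le> \<rho> (step_fun (n * M) w)"
proof -
  let ?s = "\<lambda>p i. (i div M) * M + (i mod M + p) mod M"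
  let ?F = "\<lambda>p. step_fun (n * M) (\<lambda>i. w (?s p i))"
  have "\<rho> (step_fun n (\<lambda>k. ennreal (1 / real M) * (\<Sum>l<M. w (k * M + l)))) =
      \<rho> (\<lambda>x. ennreal (1 / real M) * (\<Sum>p<M. ?F p x))"
  proof (rule ri_cong[OF \<rho>])
    show "(\<lambda>x. ennreal (1 / real M) * (\<Sum>p<M. ?F p x)) \<in> borel_measurable I01"
      by (intro borel_measurable_times_ennreal borel_measurable_sum step_fun_measurable) simp
    fix x :: real assume x: "0 < x" "x < 1"
    define i where "i = nat \<lfloor>real (n * M) * x\<rfloor>"
    have iM: "nat \<lfloor>real n * x\<rfloor> = i div M" unfolding i_def using step_fun_index_div[of x M n] x M by simp
    have "(\<Sum>p<M. w (?s p i)) = (\<Sum>p<M. w ((i div M) * M + (p + i mod M) mod M))" by (simp add: add.commute)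
    also have "\<dots> = (\<Sum>l<M. w ((i div M) * M + l))"
      using sum.reindex_bij_betw[OF cyclic_shift_bij[OF M, of "i mod M"], of "\<lambda>l. w ((i div M) * M + l)"] .
    finally show "step_fun n (\<lambda>k. ennreal (1 / real M) * (\<Sum>l<M. w (k * M + l))) x =
        ennreal (1 / real M) * (\<Sum>p<M. ?F p x)"
      unfolding step_fun_def iM i_def[symmetric] by simp
  qed measurable
  also have "\<dots> = ennreal (1 / real M) * \<rho> (\<lambda>x. \<Sum>p<M. ?F p x)"
    by (rule ri_scale[OF \<rho>]) (rule borel_measurable_sum, measurable)
  also have "\<dots> \<le> ennreal (1 / real M) * (\<Sum>p<M. \<rho> (?F p))"
    by (intro mult_left_mono ri_sum \<rho>) auto
  also have "\<dots> = ennreal (1 / real M) * (\<Sum>p<M. \<rho> (step_fun (n * M) w))"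
    using ri_step_fun_perm[OF \<rho> _ block_shift_bij[OF M, of _ n], of w] n M by simp
  also have "\<dots> = (ennreal (1 / real M) * of_nat M) * \<rho> (step_fun (n * M) w)" by (simp add: mult.assoc)
  also have "ennreal (1 / real M) * of_nat M = 1"
    using M by (simp add: ennreal_of_nat_eq_real_of_nat ennreal_mult[symmetric])
  finally show ?thesis by simp
qed

text \<open>Sampling at the right end of the cell keeps the step function below a decreasing
  \<open>u\<close>; the cap at \<open>m\<close> makes the values finite, so that real vectors can
  represent them.\<close>

definition dyadic_low :: "nat \<Rightarrow> (real \<Rightarrow> ennreal) \<Rightarrow> nat \<Rightarrow> ennreal" where
  "dyadic_low m u i = min (of_nat m) (u (real (Suc i) / 2 ^ m))"

lemma dyadic_low_finite: "dyadic_low m u i = ennreal (enn2real (dyadic_low m u i))"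
  unfolding dyadic_low_def by (subst ennreal_enn2real) (auto simp: min_less_iff_disj ennreal_of_nat_eq_real_of_nat)

text \<open>Here \<open>d m\<close> is the right end of the dyadic cell of order \<open>m\<close>
  containing \<open>x\<close>. The cells are nested, so these ends decrease towards \<open>x\<close>
  while staying strictly to its right.\<close>

lemma dyadic_low_index_bounds:
  assumes "0 < x"
  defines "d \<equiv> \<lambda>m. real (Suc (nat \<lfloor>real (2 ^ m) * x\<rfloor>)) / 2 ^ m"
  shows "x < d m" "d m \<le> x + 1 / 2 ^ m" "d (Suc m) \<le> d m"
proof -
  have d: "d m = (real_of_int \<lfloor>2 ^ m * x\<rfloor> + 1) / 2 ^ m" for m
    using assms by (simp add: d_def add.commute)
  show "x < d m" unfolding d by (simp add: field_simps) linarith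
  have "real_of_int \<lfloor>2 ^ m * x\<rfloor> \<le> 2 ^ m * x" by simp
  then show "d m \<le> x + 1 / 2 ^ m" unfolding d by (simp add: field_simps)
  have "\<lfloor>2 ^ Suc m * x\<rfloor> < 2 * \<lfloor>2 ^ m * x\<rfloor> + 2"
    unfolding floor_less_iff by simp linarith
  then have "\<lfloor>2 ^ Suc m * x\<rfloor> + 1 \<le> 2 * (\<lfloor>2 ^ m * x\<rfloor> + 1)" by simp
  then have "real_of_int (\<lfloor>2 ^ Suc m * x\<rfloor> + 1) \<le> real_of_int (2 * (\<lfloor>2 ^ m * x\<rfloor> + 1))"
    by (simp only: of_int_le_iff)
  then have "(real_of_int (\<lfloor>2 ^ Suc m * x\<rfloor> + 1)) / 2 ^ Suc m \<le> real_of_int (2 * (\<lfloor>2 ^ m * x\<rfloor> + 1)) / 2 ^ Suc m"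
    by (rule divide_right_mono) simp
  also have "\<dots> = (real_of_int \<lfloor>2 ^ m * x\<rfloor> + 1) / 2 ^ m" by (simp add: field_simps)
  finally show "d (Suc m) \<le> d m" unfolding d by simp
qed

text \<open>All sampling points lie strictly to the right of \<open>x\<close>, so reaching
  \<open>u x\<close> in the supremum is exactly what \<open>right_lsc\<close> provides: if
  \<open>u y > c\<close> for some \<open>y > x\<close>, any cell shorter than \<open>y - x\<close>
  is sampled before \<open>y\<close>.\<close>

lemma step_fun_dyadic_low:
  assumes u: "antimono u" "right_lsc u" and x: "0 < x"
  shows "incseq (\<lambda>m. step_fun (2 ^ m) (dyadic_low m u) x)" "u x = (SUP m. step_fun (2 ^ m) (dyadic_low m u) x)"
    "step_fun (2 ^ m) (dyadic_low m u) x \<le> u x"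
proof -
  let ?d = "\<lambda>m. real (Suc (nat \<lfloor>real (2 ^ m) * x\<rfloor>)) / 2 ^ m"
  have s: "step_fun (2 ^ m) (dyadic_low m u) x = min (of_nat m) (u (?d m))" for m
    unfolding step_fun_def dyadic_low_def by simp
  note d = dyadic_low_index_bounds[OF x]
  show inc: "incseq (\<lambda>m. step_fun (2 ^ m) (dyadic_low m u) x)"
    unfolding s using d(3) antimonoD[OF u(1)]
    by (intro incseq_SucI min.mono) auto
  show le: "step_fun (2 ^ m) (dyadic_low m u) x \<le> u x" for m
    unfolding s using antimonoD[OF u(1) less_imp_le[OF d(1)[of m]]] by (rule min.coboundedI2)
  show "u x = (SUP m. step_fun (2 ^ m) (dyadic_low m u) x)"
  proof (rule antisym)
    show "u x \<le> (SUP m. step_fun (2 ^ m) (dyadic_low m u) x)"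
    proof (rule dense_le)
      fix c assume c: "c < u x"
      then obtain y where y: "x < y" "c < u y" using u(2) x unfolding right_lsc_def by (meson less_imp_le)
      obtain m1 where m1: "1 / 2 ^ m1 < y - x"
        using real_arch_pow_inv[of "y - x" "1/2"] y by (auto simp: power_one_over)
      have "c < top" using c by (rule less_le_trans) simp
      then obtain m2 where m2: "c < of_nat m2" using ennreal_Ex_less_of_nat by auto
      let ?m = "max m1 m2"
      have "(1::real) / 2 ^ ?m \<le> 1 / 2 ^ m1" by (intro divide_left_mono power_increasing) auto
      then have "?d ?m \<le> y" using d(2)[of ?m] m1 by linarith
      then have "c < u (?d ?m)" using y(2) antimonoD[OF u(1)] less_le_trans by blast
      moreover have "c < of_nat ?m" using m2 by (rule less_le_trans) simp
      ultimately have "c < step_fun (2 ^ ?m) (dyadic_low ?m u) x" unfolding s by (rule min_less_iff_conj[THEN iffD2, OF conjI, rotated])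
      then show "c \<le> (SUP m. step_fun (2 ^ m) (dyadic_low m u) x)" by (meson SUP_upper2 UNIV_I less_imp_le)
    qed
  qed (rule SUP_least, rule le)
qed

section \<open>Lorentz--Luxemburg duality for decreasing functions\<close>

definition sublinear :: "((nat \<Rightarrow> real) \<Rightarrow> real) \<Rightarrow> bool" where
  "sublinear p \<longleftrightarrow> (\<forall>v w. p (\<lambda>i. v i + w i) \<le> p v + p w) \<and> (\<forall>c v. 0 < c \<longrightarrow> p (\<lambda>i. c * v i) = c * p v)"

lemma sublinearD:
  assumes "sublinear p"
  shows "p (\<lambda>i. v i + w i) \<le> p v + p w" "0 < c \<Longrightarrow> p (\<lambda>i. c * v i) = c * p v" "p (\<lambda>i. 0) = 0"
    "0 \<le> p v + p (\<lambda>i. - v i)"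
proof -
  show 1: "p (\<lambda>i. v i + w i) \<le> p v + p w" for v w using assms unfolding sublinear_def by blast
  show 2: "0 < c \<Longrightarrow> p (\<lambda>i. c * v i) = c * p v" for c v using assms unfolding sublinear_def by blast
  show 3: "p (\<lambda>i. 0) = 0" using 2[of 2 "\<lambda>i. 0"] by simp
  show "0 \<le> p v + p (\<lambda>i. - v i)" using 1[of v "\<lambda>i. - v i"] 3 by simp
qed

text \<open>Replacing \<open>p\<close> by \<open>v \<mapsto> inf\<^sub>t (p (v + t e) - t p e)\<close> makes it additive in the direction \<open>e\<close>.\<close>
lemma sublinear_minorant_direction:
  assumes p: "sublinear p"
  obtains q where "sublinear q" "\<And>v. q v \<le> p v" "q (\<lambda>i. - e i) \<le> - p e"
proof -
  define F where "F v t = p (\<lambda>i. v i + t * e i) - t * p e" for v t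
  define q where "q v = (INF t\<in>{0..}. F v t)" for v
  \<comment> \<open>Subadditivity bounds the quotients below, uniformly in \<open>t\<close>; without
    this the infimum defining \<open>q\<close> would be meaningless.\<close>
  have lb: "- p (\<lambda>i. - v i) \<le> F v t" if "0 \<le> t" for v t
  proof (cases "t = 0")
    case True
    then show ?thesis using sublinearD(4)[OF p, of v] by (simp add: F_def)
  next
    case False
    have "t * p e = p (\<lambda>i. (v i + t * e i) + (- v i))" using sublinearD(2)[OF p, of t e] that False by simp
    also have "\<dots> \<le> p (\<lambda>i. v i + t * e i) + p (\<lambda>i. - v i)" by (rule sublinearD(1)[OF p])
    finally show ?thesis by (simp add: F_def)
  qed
  have bdd: "bdd_below (F v ` {0..})" for v using lb by (intro bdd_belowI2) auto
  have le: "q v \<le> F v t" if "0 \<le> t" for v t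
    unfolding q_def using bdd that by (intro cINF_lower) auto
  have ge: "a \<le> q v" if "\<And>t. 0 \<le> t \<Longrightarrow> a \<le> F v t" for a v
    unfolding q_def using that by (intro cINF_greatest) auto
  have add: "q (\<lambda>i. v i + w i) \<le> q v + q w" for v w
  proof -
    \<comment> \<open>Parameters add up: \<open>t\<close> for \<open>v\<close> and \<open>s\<close>
      for \<open>w\<close> make \<open>t + s\<close> admissible for the sum.\<close>
    have "q (\<lambda>i. v i + w i) \<le> F v t + F w s" if "0 \<le> t" "0 \<le> s" for t s
    proof -
      have "q (\<lambda>i. v i + w i) \<le> F (\<lambda>i. v i + w i) (t + s)" using that by (intro le) simp
      also have "\<dots> = p (\<lambda>i. (v i + t * e i) + (w i + s * e i)) - (t + s) * p e"
        by (simp add: F_def algebra_simps)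
      also have "\<dots> \<le> F v t + F w s"
        using sublinearD(1)[OF p, of "\<lambda>i. v i + t * e i" "\<lambda>i. w i + s * e i"] by (simp add: F_def algebra_simps)
      finally show ?thesis .
    qed
    then have "q (\<lambda>i. v i + w i) - F w s \<le> q v" if "0 \<le> s" for s
      using that by (intro ge) (simp add: algebra_simps)
    then have "q (\<lambda>i. v i + w i) - q v \<le> q w" by (intro ge) (simp add: algebra_simps)
    then show ?thesis by simp
  qed
  have sc: "q (\<lambda>i. c * v i) \<le> c * q v" if c: "0 < c" for c v
  proof -
    have "q (\<lambda>i. c * v i) / c \<le> F v t" if t: "0 \<le> t" for t
    proof -
      have "q (\<lambda>i. c * v i) \<le> F (\<lambda>i. c * v i) (c * t)" using c t by (intro le) simp
      also have "\<dots> = p (\<lambda>i. c * (v i + t * e i)) - c * t * p e" by (simp add: F_def algebra_simps)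
      also have "\<dots> = c * F v t" using sublinearD(2)[OF p c, of "\<lambda>i. v i + t * e i"] by (simp add: F_def algebra_simps)
      finally show ?thesis using c by (simp add: field_simps)
    qed
    then have "q (\<lambda>i. c * v i) / c \<le> q v" by (rule ge)
    then show ?thesis using c by (simp add: field_simps)
  qed
  have sc': "q (\<lambda>i. c * v i) = c * q v" if c: "0 < c" for c v
  proof (rule antisym[OF sc[OF c]])
    have "q (\<lambda>i. inverse c * (c * v i)) \<le> inverse c * q (\<lambda>i. c * v i)" by (rule sc) (use c in simp)
    moreover have "(\<lambda>i. inverse c * (c * v i)) = v" using c by auto
    ultimately show "c * q v \<le> q (\<lambda>i. c * v i)" using c by (simp add: field_simps)
  qed
  show ?thesis
  proof (rule that[of q])
    show "sublinear q" unfolding sublinear_def using add sc' by blast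
    show "q v \<le> p v" for v using le[of 0 v] by (simp add: F_def)
    show "q (\<lambda>i. - e i) \<le> - p e" using le[of 1 "\<lambda>i. - e i"] sublinearD(3)[OF p] by (simp add: F_def)
  qed
qed

text \<open>The condition on a direction survives every later decrease of the functional, because
  its left side falls and its right side rises. Directions can thus be treated one after
  another.\<close>

lemma sublinear_minorant_directions:
  assumes "sublinear p"
  shows "\<exists>q. sublinear q \<and> (\<forall>v. q v \<le> p v) \<and> (\<forall>e\<in>set es. q (\<lambda>i. - e i) \<le> - q e)"
proof (induction es)
  case Nil
  then show ?case using assms by auto
next
  case (Cons e es)
  then obtain q where q: "sublinear q" "\<And>v. q v \<le> p v" "\<And>e. e \<in> set es \<Longrightarrow> q (\<lambda>i. - e i) \<le> - q e" by auto
  obtain r where r: "sublinear r" "\<And>v. r v \<le> q v" "r (\<lambda>i. - e i) \<le> - q e"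
    using sublinear_minorant_direction[OF q(1)] by metis
  have "r (\<lambda>i. - d i) \<le> - r d" if "d \<in> set (e # es)" for d
  proof (cases "d = e")
    case True
    have "r (\<lambda>i. - e i) \<le> - r e" using r(2)[of e] r(3) by linarith
    then show ?thesis using True by simp
  next
    case False
    then have "d \<in> set es" using that by simp
    then show ?thesis using q(3)[of d] r(2)[of d] r(2)[of "\<lambda>i. - d i"] by linarith
  qed
  moreover have "r v \<le> p v" for v using r(2)[of v] q(2)[of v] by linarith
  ultimately show ?case using r(1) by blast
qed

text \<open>The functional is first lowered so as to be additive along \<open>u\<close>, which
  preserves the value at \<open>u\<close>, and then along the unit vectors \<open>E k\<close>, which
  makes it linear on vectors supported below \<open>N\<close>. The result is a linear minorant of
  \<open>p\<close> touching it at \<open>u\<close>.\<close>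

lemma Hahn_Banach_finite:
  assumes p: "sublinear p"
  obtains W :: "nat \<Rightarrow> real" where "\<And>v. (\<And>i. i \<ge> N \<Longrightarrow> v i = 0) \<Longrightarrow> (\<Sum>i<N. W i * v i) \<le> p v"
    "(\<And>i. i \<ge> N \<Longrightarrow> u i = 0) \<Longrightarrow> p u \<le> (\<Sum>i<N. W i * u i)"
proof -
  define E where "E k = (\<lambda>i. if i = k then 1 else 0 :: real)" for k :: nat
  obtain p1 where p1: "sublinear p1" "\<And>v. p1 v \<le> p v" "p1 (\<lambda>i. - u i) \<le> - p u"
    using sublinear_minorant_direction[OF p] by metis
  obtain q where q: "sublinear q" "\<And>v. q v \<le> p1 v" "\<And>e. e \<in> set (map E [0..<N]) \<Longrightarrow> q (\<lambda>i. - e i) \<le> - q e"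
    using sublinear_minorant_directions[OF p1(1), of "map E [0..<N]"] by blast
  define W where "W k = q (E k)" for k
  \<comment> \<open>Only negative \<open>c\<close> needs the additivity along \<open>E k\<close>;
    the other cases are homogeneity.\<close>
  have E: "q (\<lambda>i. c * E k i) \<le> W k * c" if k: "k < N" for c k
  proof -
    consider "c = 0" | "0 < c" | "c < 0" by linarith
    then show ?thesis
    proof cases
      case 3
      have "q (\<lambda>i. c * E k i) = q (\<lambda>i. (- c) * (- E k i))" by simp
      also have "\<dots> = (- c) * q (\<lambda>i. - E k i)" by (rule sublinearD(2)[OF q(1)]) (use 3 in simp)
      also have "\<dots> \<le> (- c) * (- W k)" unfolding W_def using 3 k q(3)[of "E k"] by (intro mult_left_mono) auto
      finally show ?thesis by (simp add: mult.commute)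
    qed (use sublinearD(2)[OF q(1)] sublinearD(3)[OF q(1)] in \<open>auto simp: W_def\<close>)
  qed
  have part: "q (\<lambda>i. \<Sum>k<n. v k * E k i) \<le> (\<Sum>k<n. W k * v k)" if "n \<le> N" for n v
    using that
  proof (induction n)
    case 0
    then show ?case using sublinearD(3)[OF q(1)] by simp
  next
    case (Suc n)
    have "q (\<lambda>i. \<Sum>k<Suc n. v k * E k i) = q (\<lambda>i. (\<Sum>k<n. v k * E k i) + v n * E n i)" by simp
    also have "\<dots> \<le> q (\<lambda>i. \<Sum>k<n. v k * E k i) + q (\<lambda>i. v n * E n i)" by (rule sublinearD(1)[OF q(1)])
    also have "\<dots> \<le> (\<Sum>k<n. W k * v k) + W n * v n" using Suc E[of n "v n"] by (intro add_mono) auto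
    finally show ?case by simp
  qed
  have rep: "(\<lambda>i. \<Sum>k<N. v k * E k i) = v" if "\<And>i. i \<ge> N \<Longrightarrow> v i = 0" for v
  proof
    fix i
    have "(\<Sum>k<N. v k * E k i) = (\<Sum>k<N. if k = i then v k else 0)" by (intro sum.cong) (auto simp: E_def)
    also have "\<dots> = v i" using that[of i] by (auto simp: not_less)
    finally show "(\<Sum>k<N. v k * E k i) = v i" .
  qed
  have le: "q v \<le> (\<Sum>k<N. W k * v k)" if "\<And>i. i \<ge> N \<Longrightarrow> v i = 0" for v
    using part[of N v] rep[OF that] by simp
  have ge: "(\<Sum>k<N. W k * v k) \<le> q v" if "\<And>i. i \<ge> N \<Longrightarrow> v i = 0" for v
  proof -
    have "q (\<lambda>i. - v i) \<le> (\<Sum>k<N. W k * (- v k))" by (rule le) (simp add: that)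
    then show ?thesis using sublinearD(4)[OF q(1), of v] by (simp add: sum_negf)
  qed
  show ?thesis
  proof (rule that[of W])
    fix v :: "nat \<Rightarrow> real" assume "\<And>i. i \<ge> N \<Longrightarrow> v i = 0"
    then have "(\<Sum>i<N. W i * v i) \<le> q v" by (rule ge)
    then show "(\<Sum>i<N. W i * v i) \<le> p v" using q(2)[of v] p1(2)[of v] by linarith
  next
    assume "\<And>i. i \<ge> N \<Longrightarrow> u i = 0"
    then have "q (\<lambda>i. - u i) \<le> (\<Sum>k<N. W k * (- u k))" "(\<Sum>k<N. W k * u k) \<le> q u" using le[of "\<lambda>i. - u i"] ge[of u] by auto
    moreover have "- q u \<le> q (\<lambda>i. - u i)" using sublinearD(4)[OF q(1), of u] by simp
    moreover have "q (\<lambda>i. - u i) \<le> - p u" using q(2)[of "\<lambda>i. - u i"] p1(3) by linarith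
    moreover have "q u \<le> (\<Sum>k<N. W k * u k)" by (rule le) fact
    ultimately show "p u \<le> (\<Sum>i<N. W i * u i)" by linarith
  qed
qed

lemma sorting_permutation:
  fixes W :: "nat \<Rightarrow> real"
  obtains \<sigma> where "bij_betw \<sigma> {..<N} {..<N}" "\<And>i j. i \<le> j \<Longrightarrow> j < N \<Longrightarrow> W (\<sigma> j) \<le> W (\<sigma> i)"
proof -
  define xs where "xs = sort_key (\<lambda>k. - W k) [0..<N]"
  have len: "length xs = N" by (simp add: xs_def)
  have "bij_betw ((!) xs) {..<length xs} (set xs)" by (rule bij_betw_nth) (auto simp: xs_def)
  then have "bij_betw ((!) xs) {..<N} {..<N}" by (simp add: len) (simp add: xs_def atLeast0LessThan)
  moreover have "W (xs ! j) \<le> W (xs ! i)" if "i \<le> j" "j < N" for i j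
  proof -
    have "sorted (map (\<lambda>k. - W k) xs)" unfolding xs_def by (rule sorted_sort_key)
    then have "map (\<lambda>k. - W k) xs ! i \<le> map (\<lambda>k. - W k) xs ! j"
      using that len by (intro sorted_nth_mono) auto
    then show ?thesis using that len by simp
  qed
  ultimately show ?thesis by (rule that)
qed

lemma ennreal_mult3: "0 \<le> a \<Longrightarrow> 0 \<le> b \<Longrightarrow> 0 \<le> c \<Longrightarrow> ennreal (a * b * c) = ennreal a * ennreal b * ennreal c"
  by (simp add: ennreal_mult)

text \<open>Some dyadic minorant of \<open>u\<close> already has norm above \<open>B\<close>, and on
  its grid of \<open>N\<close> cells a linear functional \<open>W\<close> norms it. Sorting the
  absolute values of \<open>W\<close> gives a decreasing vector \<open>V\<close> that pairs at least
  as well with the decreasing minorant and, by rearrangement invariance, is still dominated by the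
  norm. A general \<open>f\<close> is compared with this grid by averaging its finer dyadic
  minorants over the \<open>N\<close> cells.\<close>

theorem Lorentz_Luxemburg_antimono:
  assumes \<rho>: "ri_norm \<rho>" and u: "antimono u" "right_lsc u" and B: "0 < B" "ennreal B < \<rho> u"
  obtains h where "antimono h"
    "\<And>f. f \<in> borel_measurable I01 \<Longrightarrow> \<rho> f \<le> ennreal B \<Longrightarrow> (\<integral>\<^sup>+x. f x * h x \<partial>I01) \<le> 1"
    "1 < (\<integral>\<^sup>+x. u x * h x \<partial>I01)"
proof -
  have um [measurable]: "u \<in> borel_measurable I01" by (intro borel_measurable_I01 antimono_borel u)
  have "\<rho> u = (SUP m. \<rho> (step_fun (2 ^ m) (dyadic_low m u)))"
    by (intro ri_Sup[OF \<rho>]) (auto intro!: step_fun_dyadic_low u)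
  then obtain m where m: "ennreal B < \<rho> (step_fun (2 ^ m) (dyadic_low m u))" using B by (auto simp: less_SUP_iff)
  define N :: nat where "N = 2 ^ m"
  have N: "0 < N" by (simp add: N_def)
  \<comment> \<open>On step functions with \<open>N\<close> cells the norm is a finite seminorm of
    the vector of values. Coordinates from \<open>N\<close> on have no influence, since on (0,1) the
    index stays below \<open>N\<close>.\<close>
  define p where "p v = enn2real (\<rho> (step_fun N (\<lambda>i. ennreal \<bar>v i\<bar>)))" for v :: "nat \<Rightarrow> real"
  have fin: "\<rho> (step_fun N (\<lambda>i. ennreal \<bar>v i\<bar>)) < top" for v :: "nat \<Rightarrow> real"
  proof -
    have "\<rho> (step_fun N (\<lambda>i. ennreal \<bar>v i\<bar>)) \<le> \<rho> (\<lambda>x. ennreal (\<Sum>i<N. \<bar>v i\<bar>))"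
    proof (intro ri_mono[OF \<rho>] step_fun_measurable)
      fix x :: real assume "0 < x" "x < 1"
      then show "step_fun N (\<lambda>i. ennreal \<bar>v i\<bar>) x \<le> ennreal (\<Sum>i<N. \<bar>v i\<bar>)"
        unfolding step_fun_def using step_fun_index_less[of x N] N
        by (intro ennreal_leI member_le_sum[where f = "\<lambda>i. \<bar>v i\<bar>"]) auto
    qed simp
    also have "\<dots> = ennreal (\<Sum>i<N. \<bar>v i\<bar>) * \<rho> (\<lambda>_. 1)" by (rule ri_const[OF \<rho>]) (simp add: sum_nonneg)
    also have "\<dots> < top" using ri_one[OF \<rho>] by (simp add: ennreal_mult_less_top)
    finally show ?thesis .
  qed
  have ep: "\<rho> (step_fun N (\<lambda>i. ennreal \<bar>v i\<bar>)) = ennreal (p v)" for v :: "nat \<Rightarrow> real"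
    unfolding p_def using fin[of v] by simp
  have p0: "0 \<le> p v" for v unfolding p_def by simp
  have "sublinear p"
    unfolding sublinear_def
  proof (intro conjI allI impI)
    fix v w :: "nat \<Rightarrow> real"
    have "ennreal (p (\<lambda>i. v i + w i)) \<le> \<rho> (\<lambda>x. step_fun N (\<lambda>i. ennreal \<bar>v i\<bar>) x + step_fun N (\<lambda>i. ennreal \<bar>w i\<bar>) x)"
      unfolding ep[symmetric]
    proof (rule ri_mono[OF \<rho>])
      fix x
      show "step_fun N (\<lambda>i. ennreal \<bar>v i + w i\<bar>) x \<le> step_fun N (\<lambda>i. ennreal \<bar>v i\<bar>) x + step_fun N (\<lambda>i. ennreal \<bar>w i\<bar>) x"
        by (auto simp: step_fun_def ennreal_plus[symmetric] simp del: ennreal_plus intro!: ennreal_leI)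
    qed measurable
    also have "\<dots> \<le> ennreal (p v) + ennreal (p w)" unfolding ep[symmetric] by (intro ri_add \<rho>) auto
    finally show "p (\<lambda>i. v i + w i) \<le> p v + p w"
      using p0 by (simp add: ennreal_plus[symmetric] del: ennreal_plus)
  next
    fix c :: real and v :: "nat \<Rightarrow> real" assume c: "0 < c"
    have "ennreal (p (\<lambda>i. c * v i)) = \<rho> (\<lambda>x. ennreal c * step_fun N (\<lambda>i. ennreal \<bar>v i\<bar>) x)"
      unfolding ep[symmetric]
    proof (rule ri_cong[OF \<rho>])
      fix x
      show "step_fun N (\<lambda>i. ennreal \<bar>c * v i\<bar>) x = ennreal c * step_fun N (\<lambda>i. ennreal \<bar>v i\<bar>) x"
        using c by (auto simp: step_fun_def ennreal_mult[symmetric] abs_mult)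
    qed measurable
    also have "\<dots> = ennreal (c * p v)"
      using c p0 by (subst ri_scale[OF \<rho>]) (auto simp: ep ennreal_mult)
    finally show "p (\<lambda>i. c * v i) = c * p v" using p0 c by simp
  qed
  define U where "U i = (if i < N then enn2real (dyadic_low m u i) else 0)" for i
  have U0: "0 \<le> U i" for i by (simp add: U_def)
  have Ulow: "ennreal (U i) = dyadic_low m u i" if "i < N" for i
    using dyadic_low_finite[of m u i] that by (simp add: U_def)
  obtain W where W: "\<And>v. (\<And>i. i \<ge> N \<Longrightarrow> v i = 0) \<Longrightarrow> (\<Sum>i<N. W i * v i) \<le> p v"
      "p U \<le> (\<Sum>i<N. W i * U i)"
    using Hahn_Banach_finite[OF \<open>sublinear p\<close>, of N U] by (auto simp: U_def)
  obtain \<sigma> where \<sigma>: "bij_betw \<sigma> {..<N} {..<N}" "\<And>i j. i \<le> j \<Longrightarrow> j < N \<Longrightarrow> \<bar>W (\<sigma> j)\<bar> \<le> \<bar>W (\<sigma> i)\<bar>"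
    using sorting_permutation[of N "\<lambda>i. \<bar>W i\<bar>"] by metis
  \<comment> \<open>The value 0 from \<open>N\<close> on keeps \<open>V\<close> decreasing on all
    indices, so the step function built from it is decreasing on the whole line.\<close>
  define V where "V i = (if i < N then \<bar>W (\<sigma> i)\<bar> else 0)" for i
  have V0: "0 \<le> V i" for i by (simp add: V_def)
  have Vanti: "V j \<le> V i" if "i \<le> j" for i j using \<sigma>(2)[of i j] that by (auto simp: V_def)
  have stpV: "step_fun N (\<lambda>i. ennreal (c * V i)) y \<le> step_fun N (\<lambda>i. ennreal (c * V i)) x" if "x \<le> y" "0 \<le> c" for x y c
    unfolding step_fun_def using step_fun_index_mono[OF that(1), of N] Vanti that(2) by (intro ennreal_leI mult_left_mono) auto
  \<comment> \<open>The signs of \<open>W\<close> and the inverse permutation are moved onto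
    \<open>v\<close>. The resulting vector \<open>s\<close> satisfies the bound for
    \<open>W\<close>, and neither change increases the norm.\<close>
  have bound: "(\<Sum>i<N. V i * v i) \<le> p v" if v: "\<And>i. 0 \<le> v i" for v
  proof -
    let ?\<tau> = "the_inv_into {..<N} \<sigma>"
    have \<tau>: "bij_betw ?\<tau> {..<N} {..<N}" using \<sigma>(1) by (rule bij_betw_the_inv_into)
    define s where "s k = (if k < N then sgn (W k) * v (?\<tau> k) else 0)" for k
    have "(\<Sum>i<N. V i * v i) = (\<Sum>i<N. \<bar>W (\<sigma> i)\<bar> * v (?\<tau> (\<sigma> i)))"
      using \<sigma>(1) by (intro sum.cong) (auto simp: V_def bij_betw_def the_inv_into_f_f)
    also have "\<dots> = (\<Sum>k<N. \<bar>W k\<bar> * v (?\<tau> k))"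
      using sum.reindex_bij_betw[OF \<sigma>(1), of "\<lambda>k. \<bar>W k\<bar> * v (?\<tau> k)"] by simp
    also have "\<dots> = (\<Sum>k<N. W k * s k)" by (intro sum.cong) (auto simp: s_def abs_sgn)
    also have "\<dots> \<le> p s" by (rule W(1)) (simp add: s_def)
    also have "p s \<le> p (\<lambda>k. v (?\<tau> k))"
    proof -
      have "ennreal (p s) \<le> ennreal (p (\<lambda>k. v (?\<tau> k)))"
        unfolding ep[symmetric] using N v
        by (intro ri_step_fun_mono[OF \<rho>] ennreal_leI) (auto simp: s_def abs_mult abs_sgn_eq)
      then show ?thesis using p0 by simp
    qed
    also have "\<dots> = p v" unfolding p_def using ri_step_fun_perm[OF \<rho> N \<tau>, of "\<lambda>i. ennreal \<bar>v i\<bar>"] by simp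
    finally show ?thesis .
  qed
  \<comment> \<open>The finite rearrangement inequality is read off from Hardy--Littlewood for the
    corresponding step functions.\<close>
  have sumU: "p U \<le> (\<Sum>i<N. V i * U i)"
  proof -
    let ?A = "step_fun N (\<lambda>i. ennreal \<bar>W i\<bar>)" and ?U = "step_fun N (\<lambda>i. ennreal (U i))" and ?V = "step_fun N (\<lambda>i. ennreal (1 * V i))"
    have Ua: "?U y \<le> ?U x" if "0 < x" "x \<le> y" "y < 1" for x y
    proof -
      have "nat \<lfloor>real N * x\<rfloor> < N" "nat \<lfloor>real N * y\<rfloor> < N" using that N by (auto intro!: step_fun_index_less)
      moreover have "dyadic_low m u b \<le> dyadic_low m u a" if "a \<le> b" for a b
        unfolding dyadic_low_def using that by (intro min.mono order_refl antimonoD[OF u(1)] divide_right_mono) auto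
      ultimately show ?thesis
        unfolding step_fun_def using Ulow step_fun_index_mono[OF that(2), of N] by simp
    qed
    have dV: "distr_fun ?A c = distr_fun ?V c" for c
    proof -
      have "distr_fun ?A c = distr_fun (step_fun N (\<lambda>i. ennreal \<bar>W (\<sigma> i)\<bar>)) c"
        using distr_fun_step_fun_perm[OF N \<sigma>(1), of "\<lambda>i. ennreal \<bar>W i\<bar>"] by simp
      also have "\<dots> = distr_fun ?V c" unfolding distr_fun_step_fun[OF N] by (intro sum.cong) (auto simp: V_def)
      finally show ?thesis .
    qed
    have "(\<integral>\<^sup>+x. ?A x * ?U x \<partial>I01) \<le> (\<integral>\<^sup>+x. rearr ?A x * ?U x \<partial>I01)"
      by (rule Hardy_Littlewood_antimono) (auto intro: Ua)
    also have "rearr ?A = rearr ?V" by (rule rearr_cong_distr_fun) (rule dV)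
    also have "(\<integral>\<^sup>+x. rearr ?V x * ?U x \<partial>I01) \<le> (\<integral>\<^sup>+x. ?V x * ?U x \<partial>I01)"
      by (intro nn_integral_mono mult_right_mono rearr_le_antimono stpV) auto
    finally have "(\<Sum>i<N. ennreal (\<bar>W i\<bar> * U i * (1 / real N))) \<le> (\<Sum>i<N. ennreal (V i * U i * (1 / real N)))"
      unfolding nn_integral_step_fun_mult[OF N] using U0 V0 by (simp add: ennreal_mult[symmetric])
    then have "(\<Sum>i<N. \<bar>W i\<bar> * U i * (1 / real N)) \<le> (\<Sum>i<N. V i * U i * (1 / real N))"
      using U0 V0 by (subst (asm) (1 2) sum_ennreal) (auto simp: sum_nonneg)
    then have "(\<Sum>i<N. \<bar>W i\<bar> * U i) \<le> (\<Sum>i<N. V i * U i)"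
      unfolding sum_distrib_right[symmetric] using N by (simp add: divide_le_cancel)
    moreover have "(\<Sum>i<N. W i * U i) \<le> (\<Sum>i<N. \<bar>W i\<bar> * U i)"
      using U0 by (intro sum_mono mult_right_mono) auto
    ultimately show ?thesis using W(2) by linarith
  qed
  \<comment> \<open>The factor \<open>N\<close> cancels the cell length \<open>1 / N\<close> in
    integrals, and \<open>1 / B\<close> normalises the pairing on the ball of radius
    \<open>B\<close>.\<close>
  let ?c = "real N / B"
  let ?h = "step_fun N (\<lambda>i. ennreal (?c * V i))"
  have c0: "0 \<le> ?c" using B by simp
  show ?thesis
  proof (rule that[of ?h])
    show "antimono ?h" unfolding antimono_def using stpV c0 by blast
  next
    have "ennreal B < ennreal (p U)"
    proof -
      have "\<rho> (step_fun (2 ^ m) (dyadic_low m u)) \<le> \<rho> (step_fun N (\<lambda>i. ennreal \<bar>U i\<bar>))"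
        unfolding N_def[symmetric] using N Ulow U0 by (intro ri_step_fun_mono[OF \<rho>]) auto
      then show ?thesis using m ep by (metis less_le_trans)
    qed
    then have BU: "B < p U" using B by (simp add: ennreal_less_iff)
    have "1 < (\<Sum>i<N. V i * U i) / B" using BU sumU B by simp
    also have "\<dots> = (\<Sum>i<N. U i * (?c * V i) * (1 / real N))"
      using N by (simp add: sum_divide_distrib field_simps)
    finally have g1: "1 < (\<Sum>i<N. U i * (?c * V i) * (1 / real N))" .
    have "1 < ennreal (\<Sum>i<N. U i * (?c * V i) * (1 / real N))"
      by (rule ennreal_lessI[of _ 1, unfolded ennreal_1, OF less_trans[OF zero_less_one g1] g1])
    also have "\<dots> = (\<Sum>i<N. ennreal (U i) * ennreal (?c * V i) * ennreal (1 / real N))"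
      by (subst sum_ennreal[symmetric]) (intro sum.cong refl ennreal_mult3 mult_nonneg_nonneg U0 V0 c0; simp)+
    also have "\<dots> = (\<integral>\<^sup>+x. step_fun N (\<lambda>i. ennreal (U i)) x * ?h x \<partial>I01)"
      by (rule nn_integral_step_fun_mult[OF N, symmetric])
    also have "\<dots> \<le> (\<integral>\<^sup>+x. u x * ?h x \<partial>I01)"
    proof (intro nn_integral_mono mult_right_mono)
      fix x assume x: "x \<in> space I01"
      have "step_fun N (\<lambda>i. ennreal (U i)) x = step_fun (2 ^ m) (dyadic_low m u) x"
        unfolding N_def[symmetric] unfolding step_fun_def by (rule Ulow) (use x N in \<open>auto intro: step_fun_index_less\<close>)
      also have "\<dots> \<le> u x" by (rule step_fun_dyadic_low(3)) (use u x in auto)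
      finally show "step_fun N (\<lambda>i. ennreal (U i)) x \<le> u x" .
    qed simp
    finally show "1 < (\<integral>\<^sup>+x. u x * ?h x \<partial>I01)" .
  next
    fix f assume f [measurable]: "f \<in> borel_measurable I01" and fB: "\<rho> f \<le> ennreal B"
    have "(\<integral>\<^sup>+x. f x * ?h x \<partial>I01) \<le> (\<integral>\<^sup>+x. rearr f x * ?h x \<partial>I01)"
      by (rule Hardy_Littlewood_antimono[OF f step_fun_measurable stpV[OF _ c0]])
    also have "\<dots> = (\<integral>\<^sup>+x. (SUP n. step_fun (2 ^ n) (dyadic_low n (rearr f)) x * ?h x) \<partial>I01)"
    proof (intro nn_integral_cong)
      fix x assume "x \<in> space I01"
      then have "rearr f x = (SUP n. step_fun (2 ^ n) (dyadic_low n (rearr f)) x)"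
        by (intro step_fun_dyadic_low(2) antimono_rearr right_lsc_rearr f) auto
      then show "rearr f x * ?h x = (SUP n. step_fun (2 ^ n) (dyadic_low n (rearr f)) x * ?h x)"
        by (simp add: SUP_mult_right_ennreal)
    qed
    also have "\<dots> = (SUP n. \<integral>\<^sup>+x. step_fun (2 ^ n) (dyadic_low n (rearr f)) x * ?h x \<partial>I01)"
    proof (rule nn_integral_monotone_convergence_SUP_AE)
      have inc: "incseq (\<lambda>n. step_fun (2 ^ n) (dyadic_low n (rearr f)) x)" if "x \<in> space I01" for x
        using that by (intro step_fun_dyadic_low(1) antimono_rearr right_lsc_rearr f) auto
      show "AE x in I01. step_fun (2 ^ n) (dyadic_low n (rearr f)) x * ?h x \<le> step_fun (2 ^ Suc n) (dyadic_low (Suc n) (rearr f)) x * ?h x" for n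
        by (intro AE_I2 mult_right_mono incseq_SucD[OF inc]) auto
    qed measurable
    also have "\<dots> \<le> 1"
    proof (rule SUP_least)
      fix n
      \<comment> \<open>Taking order at least \<open>m\<close> makes the grid a refinement of the
        one carrying \<open>?h\<close>, with \<open>M\<close> fine cells in each coarse one.\<close>
      let ?n = "max n m" and ?g = "\<lambda>n. step_fun (2 ^ n) (dyadic_low n (rearr f))"
      define M :: nat where "M = 2 ^ (?n - m)"
      have M: "0 < M" by (simp add: M_def)
      have NM: "2 ^ ?n = N * M" unfolding N_def M_def by (simp add: power_add[symmetric])
      define w where "w i = enn2real (dyadic_low ?n (rearr f) i)" for i
      have w0: "0 \<le> w i" for i by (simp add: w_def)
      have w: "dyadic_low ?n (rearr f) = (\<lambda>i. ennreal (w i))" unfolding w_def using dyadic_low_finite by blast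
      \<comment> \<open>Since \<open>?h\<close> is constant on coarse cells, only the block means of
        \<open>w\<close> enter the integral; \<open>ri_average\<close> bounds the norm of these
        means.\<close>
      define a where "a k = (1 / real M) * (\<Sum>l<M. w (k * M + l))" for k
      have a0: "0 \<le> a k" for k using w0 by (simp add: a_def sum_nonneg)
      have "(\<integral>\<^sup>+x. ?g n x * ?h x \<partial>I01) \<le> (\<integral>\<^sup>+x. ?g ?n x * ?h x \<partial>I01)"
      proof (intro nn_integral_mono mult_right_mono)
        fix x assume "x \<in> space I01"
        then have "incseq (\<lambda>n. ?g n x)" by (intro step_fun_dyadic_low(1) antimono_rearr right_lsc_rearr f) auto
        then show "?g n x \<le> ?g ?n x" by (rule incseqD) simp
      qed simp
      also have "\<dots> = (\<integral>\<^sup>+x. (\<lambda>i. ennreal (w i) * ennreal (?c * V (i div M))) (nat \<lfloor>real (N * M) * x\<rfloor>) \<partial>I01)"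
      proof (intro nn_integral_cong)
        fix x assume "x \<in> space I01"
        then have "nat \<lfloor>real (N * M) * x\<rfloor> div M = nat \<lfloor>real N * x\<rfloor>" by (intro step_fun_index_div M) simp
        then show "?g ?n x * ?h x = (\<lambda>i. ennreal (w i) * ennreal (?c * V (i div M))) (nat \<lfloor>real (N * M) * x\<rfloor>)"
          unfolding NM w step_fun_def by simp
      qed
      also have "\<dots> = (\<Sum>i<N * M. ennreal (w i) * ennreal (?c * V (i div M)) * ennreal (1 / real (N * M)))"
        by (rule nn_integral_step_fun) (use N M in simp)
      also have "\<dots> = ennreal (\<Sum>i<N * M. w i * (?c * V (i div M)) * (1 / real (N * M)))"
        by (subst sum_ennreal[symmetric]) (intro sum.cong refl ennreal_mult3[symmetric] mult_nonneg_nonneg w0 V0 c0; simp)+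
      also have "(\<Sum>i<N * M. w i * (?c * V (i div M)) * (1 / real (N * M))) = (\<Sum>k<N. V k * a k) / B"
      proof -
        have "(\<Sum>i<N * M. w i * (?c * V (i div M)) * (1 / real (N * M))) =
            (\<Sum>k<N. \<Sum>i\<in>{k * M..<k * M + M}. w i * (?c * V (i div M)) * (1 / real (N * M)))"
          by (rule sum.nat_group[symmetric])
        also have "\<dots> = (\<Sum>k<N. V k * a k / B)"
        proof (intro sum.cong refl)
          fix k
          have "(\<Sum>i\<in>{k * M..<k * M + M}. w i * (?c * V (i div M)) * (1 / real (N * M))) =
              (\<Sum>l<M. w (k * M + l) * (?c * V ((k * M + l) div M)) * (1 / real (N * M)))"
            by (rule sum.reindex_bij_witness[of _ "\<lambda>l. k * M + l" "\<lambda>i. i - k * M"]) auto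
          also have "\<dots> = (\<Sum>l<M. w (k * M + l) * (?c * V k) * (1 / real (N * M)))"
            using M by (intro sum.cong) auto
          also have "\<dots> = V k * a k / B"
            unfolding sum_distrib_right[symmetric] a_def using N M B by (simp add: field_simps)
          finally show "(\<Sum>i\<in>{k * M..<k * M + M}. w i * (?c * V (i div M)) * (1 / real (N * M))) = V k * a k / B" .
        qed
        finally show ?thesis by (simp add: sum_divide_distrib)
      qed
      also have "ennreal ((\<Sum>k<N. V k * a k) / B) \<le> ennreal (p a / B)"
        using bound[of a] a0 B by (intro ennreal_leI divide_right_mono) auto
      also have "\<dots> \<le> 1"
      proof -
        have "ennreal (p a) = \<rho> (step_fun N (\<lambda>k. ennreal (1 / real M) * (\<Sum>l<M. ennreal (w (k * M + l)))))"
          unfolding ep[symmetric] using a0 w0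
          by (simp add: a_def ennreal_mult[symmetric] sum_nonneg sum_ennreal)
        also have "\<dots> \<le> \<rho> (step_fun (N * M) (\<lambda>i. ennreal (w i)))" by (rule ri_average[OF \<rho> N M])
        also have "\<dots> = \<rho> (?g ?n)" unfolding NM w ..
        also have "\<dots> \<le> \<rho> (rearr f)"
          by (intro ri_mono[OF \<rho>] step_fun_dyadic_low(3) antimono_rearr right_lsc_rearr f) auto
        also have "\<dots> = \<rho> f" by (rule ri_rearr[OF \<rho> f])
        also note fB
        finally show ?thesis using p0 B by (simp add: ennreal_le_1)
      qed
      finally show "(\<integral>\<^sup>+x. ?g n x * ?h x \<partial>I01) \<le> 1" .
    qed
    finally show "(\<integral>\<^sup>+x. f x * ?h x \<partial>I01) \<le> 1" .
  qed
qed

section \<open>The operators\<close>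

lemma nn_integral_I01_pos:
  assumes g: "g \<in> borel_measurable I01" and ts: "0 \<le> t" "t < s" "s \<le> 1"
    and pos: "\<And>r. t < r \<Longrightarrow> r < s \<Longrightarrow> 0 < g r"
  shows "0 < (\<integral>\<^sup>+r. g r \<partial>I01)"
proof (rule ccontr)
  assume "\<not> ?thesis"
  then have "emeasure I01 {x \<in> space I01. g x \<noteq> 0} = 0"
    using nn_integral_0_iff[OF g] by (simp add: zero_less_iff_neq_zero)
  moreover have "emeasure I01 {t<..<s} \<le> emeasure I01 {x \<in> space I01. g x \<noteq> 0}"
  proof (rule emeasure_mono)
    show "{t<..<s} \<subseteq> {x \<in> space I01. g x \<noteq> 0}" using pos ts by (force simp: zero_less_iff_neq_zero)
    show "{x \<in> space I01. g x \<noteq> 0} \<in> sets I01" using g by measurable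
  qed
  ultimately show False using ts by (simp add: emeasure_I01_interval)
qed

lemma tendsto_power_ennreal:
  fixes f :: "'a \<Rightarrow> ennreal"
  assumes "(f \<longlongrightarrow> l) F"
  shows "((\<lambda>x. f x ^ n) \<longlongrightarrow> l ^ n) F"
proof (induction n)
  case (Suc n)
  have "((\<lambda>x. f x * f x ^ n) \<longlongrightarrow> l * l ^ n) F"
  proof (cases "n = 0")
    case False
    \<comment> \<open>Multiplication in the extended half-line is discontinuous only at zero times
      infinity, and for \<open>n \<noteq> 0\<close> the factors \<open>l\<close> and
      \<open>l ^ n\<close> vanish or are infinite together.\<close>
    then have "l ^ n = 0 \<longleftrightarrow> l = 0" "l ^ n = top \<longleftrightarrow> l = top" 
      by (auto simp: power_eq_top_ennreal)
    then show ?thesis by (intro tendsto_mult_ennreal assms Suc) auto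
  qed (use assms in simp)
  then show ?case by simp
qed simp

text \<open>The constant \<open>c\<close> will be the infimum of \<open>J t / t\<close>. The bound
  \<open>J_ge\<close> confines the singularity of \<open>1 / J\<close> to the origin.\<close>

locale hardy_kernel =
  fixes J :: "real \<Rightarrow> real" and j :: nat and c :: real
  assumes J_meas: "J \<in> borel_measurable (lebesgue_on {0<..1})"
    and J_pos: "\<And>t. 0 < t \<Longrightarrow> t \<le> 1 \<Longrightarrow> 0 < J t"
    and c_pos: "0 < c"
    and J_ge: "\<And>t. 0 < t \<Longrightarrow> t \<le> 1 \<Longrightarrow> c * t \<le> J t"
begin

definition w :: "real \<Rightarrow> ennreal" where "w r = ennreal (1 / J r)"

lemma w_measurable [measurable]: "w \<in> borel_measurable I01"
proof -
  have "J \<in> borel_measurable I01"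
    using J_meas by (rule measurable_restrict_mono) auto
  then show ?thesis unfolding w_def by measurable
qed

lemma w_pos: "0 < t \<Longrightarrow> t < 1 \<Longrightarrow> 0 < w t"
  using J_pos[of t] by (simp add: w_def)

lemma w_le: assumes "0 < a" "a \<le> t" "t < 1" shows "w t \<le> ennreal (1 / (c * a))"
proof -
  have "c * a \<le> c * t" using assms c_pos by simp
  also have "\<dots> \<le> J t" using assms J_ge[of t] by simp
  finally show ?thesis unfolding w_def using assms c_pos J_pos[of t] by (intro ennreal_leI divide_left_mono) auto
qed

lemma IJ_eq:
  assumes "0 \<le> t" "s \<le> 1"
  shows "IJ J t s = (\<integral>\<^sup>+r. (if t < r \<and> r < s then w r else 0) \<partial>I01)"
  unfolding IJ_def nn_integral_I01 w_def
  using assms by (intro nn_integral_cong) (auto simp: indicator_def)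

lemma IJ_measurable [measurable]:
  assumes [measurable]: "f \<in> borel_measurable M" "g \<in> borel_measurable M"
    and f: "\<And>x. x \<in> space M \<Longrightarrow> 0 \<le> f x" and g: "\<And>x. x \<in> space M \<Longrightarrow> g x \<le> 1"
  shows "(\<lambda>x. IJ J (f x) (g x)) \<in> borel_measurable M"
proof -
  interpret I: sigma_finite_measure I01 by (rule sigma_finite_I01)
  have "(\<lambda>x. \<integral>\<^sup>+r. (if f x < r \<and> r < g x then w r else 0) \<partial>I01) \<in> borel_measurable M" by measurable
  then show ?thesis by (rule measurable_cong[THEN iffD1, rotated]) (simp add: IJ_eq f g)
qed

lemma IJ_mono: "t' \<le> t \<Longrightarrow> s \<le> s' \<Longrightarrow> IJ J t s \<le> IJ J t' s'"
  unfolding IJ_def by (intro nn_integral_mono) (auto simp: indicator_def)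

lemma IJ_le:
  assumes "0 < a" "a \<le> t" "s \<le> 1"
  shows "IJ J t s \<le> ennreal (1 / (c * a))"
proof -
  have "IJ J t s \<le> (\<integral>\<^sup>+r. ennreal (1 / (c * a)) \<partial>I01)"
    unfolding IJ_eq[OF less_imp_le[OF less_le_trans[OF assms(1,2)]] assms(3)]
    using assms by (intro nn_integral_mono) (auto intro!: w_le)
  also have "\<dots> = ennreal (1 / (c * a))" using emeasure_I01_interval[of 0 1] by simp
  finally show ?thesis .
qed

lemma IJ_pos: "0 \<le> t \<Longrightarrow> t < s \<Longrightarrow> s \<le> 1 \<Longrightarrow> 0 < IJ J t s"
  by (simp add: IJ_eq) (rule nn_integral_I01_pos[of _ t s], measurable, auto intro!: w_pos)

text \<open>The intervals (t,b) and (b',s) overlap, so every point of (t,s) lies in one of them and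
  the bound holds pointwise under the integral.\<close>

lemma IJ_split:
  assumes "0 \<le> t" "s \<le> 1" "b' < b" "0 \<le> b'" "b \<le> 1"
  shows "IJ J t s \<le> IJ J t b + IJ J b' s"
proof -
  have "IJ J t s \<le> (\<integral>\<^sup>+r. (if t < r \<and> r < b then w r else 0) + (if b' < r \<and> r < s then w r else 0) \<partial>I01)"
    using assms by (simp add: IJ_eq) (intro nn_integral_mono, auto)
  also have "\<dots> = IJ J t b + IJ J b' s"
    using assms by (subst nn_integral_add) (auto simp: IJ_eq)
  finally show ?thesis .
qed

lemma IJ_SUP:
  assumes t: "0 \<le> t" "s \<le> 1" and T: "decseq T" "\<And>n. t < T n" "T \<longlonglongrightarrow> t"
  shows "(SUP n. IJ J (T n) s) = IJ J t s"
proof -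
  have T0: "0 \<le> T n" for n using T(2)[of n] t by simp
  let ?g = "\<lambda>n r. if T n < r \<and> r < s then w r else 0"
  have inc: "incseq ?g"
    using T(1) by (auto simp: incseq_def decseq_def le_fun_def dest: le_less_trans)
  have "(SUP n. IJ J (T n) s) = (SUP n. \<integral>\<^sup>+r. ?g n r \<partial>I01)" using T0 t by (simp add: IJ_eq)
  also have "\<dots> = (\<integral>\<^sup>+r. (SUP n. ?g n r) \<partial>I01)"
    by (rule nn_integral_monotone_convergence_SUP[symmetric, OF inc]) measurable
  also have "\<dots> = (\<integral>\<^sup>+r. (if t < r \<and> r < s then w r else 0) \<partial>I01)"
  proof (intro nn_integral_cong)
    fix r
    show "(SUP n. ?g n r) = (if t < r \<and> r < s then w r else 0)"
    proof (cases "t < r \<and> r < s")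
      case True
      then have "\<forall>\<^sub>F n in sequentially. T n < r" using T(3) by (auto intro: order_tendstoD)
      then obtain n where "T n < r" by (auto simp: eventually_sequentially)
      then have "w r \<le> (SUP n. ?g n r)" using True by (intro SUP_upper2[of n]) auto
      moreover have "(SUP n. ?g n r) \<le> w r" by (intro SUP_least) auto
      ultimately show ?thesis using True by auto
    next
      case False
      have "?g n r = 0" for n using False T(2)[of n] by (auto dest: less_trans)
      then show ?thesis using False by auto
    qed
  qed
  finally show ?thesis using t by (simp add: IJ_eq)
qed

lemma HJ_eq:
  assumes "0 \<le> t"
  shows "HJ J j f t = ennreal (1 / fact (j - 1)) *
    (\<integral>\<^sup>+s. (if t < s then f s * w s * IJ J t s ^ (j - 1) else 0) \<partial>I01)"
  unfolding HJ_def nn_integral_I01 w_def using assms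
  by (intro arg_cong[where f = "\<lambda>z. ennreal (1 / fact (j - 1)) * z"] nn_integral_cong) (auto simp: indicator_def)

lemma RJ_eq:
  assumes "0 < t" "t < 1"
  shows "RJ J j f t = ennreal (1 / fact (j - 1)) * w t *
    (\<integral>\<^sup>+s. (if s < t then IJ J s t ^ (j - 1) * f s else 0) \<partial>I01)"
proof -
  have "ennreal (1 / (fact (j - 1) * J t)) = ennreal (1 / fact (j - 1)) * w t"
    unfolding w_def using J_pos[of t] assms by (subst ennreal_mult[symmetric]) auto
  moreover have "(\<integral>\<^sup>+ s. indicator {0<..<t} s * IJ J s t ^ (j - 1) * f s \<partial>lborel) =
      (\<integral>\<^sup>+s. (if s < t then IJ J s t ^ (j - 1) * f s else 0) \<partial>I01)"
    unfolding nn_integral_I01 using assms by (intro nn_integral_cong) (auto simp: indicator_def)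
  ultimately show ?thesis unfolding RJ_def by simp
qed

lemma HJ_antimono: "antimono (HJ J j f)"
  unfolding antimono_def HJ_def
  by (intro allI impI mult_left_mono nn_integral_mono)
     (auto simp: indicator_def intro!: mult_left_mono power_mono IJ_mono)

lemma HJ_measurable [measurable]: "HJ J j f \<in> borel_measurable I01"
  by (intro borel_measurable_I01 antimono_borel HJ_antimono)

lemma HJ_ge_1: "1 \<le> t \<Longrightarrow> HJ J j f t = 0"
  unfolding HJ_def by simp

lemma RJ_measurable [measurable]: "RJ J j f \<in> borel_measurable I01"
proof -
  have "(\<lambda>t. \<integral>\<^sup>+ s. indicator {0<..<t} s * IJ J s t ^ (j - 1) * f s \<partial>lborel) \<in> borel_measurable borel"
    by (rule mono_borel, unfold mono_def, intro allI impI nn_integral_mono)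
       (auto simp: indicator_def intro!: mult_right_mono power_mono IJ_mono)
  note [measurable] = borel_measurable_I01[OF this]
  have "(\<lambda>t. ennreal (1 / fact (j - 1)) * w t * (\<integral>\<^sup>+ s. indicator {0<..<t} s * IJ J s t ^ (j - 1) * f s \<partial>lborel))
      \<in> borel_measurable I01" by measurable
  moreover have "RJ J j f t = ennreal (1 / fact (j - 1)) * w t *
      (\<integral>\<^sup>+ s. indicator {0<..<t} s * IJ J s t ^ (j - 1) * f s \<partial>lborel)" if "t \<in> space I01" for t
    unfolding RJ_def w_def using J_pos[of t] that by (subst ennreal_mult[symmetric]) auto
  ultimately show ?thesis by (subst measurable_cong) auto
qed

lemma RJ_mono:
  assumes "0 < t" "t < 1" "\<And>s. 0 < s \<Longrightarrow> s < 1 \<Longrightarrow> f s \<le> g s"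
  shows "RJ J j f t \<le> RJ J j g t"
  unfolding RJ_eq[OF assms(1,2)] using assms(3)
  by (intro mult_left_mono nn_integral_mono) (auto intro!: mult_left_mono)

lemma HJ_integrand_measurable:
  assumes t: "0 \<le> t" and f [measurable]: "f \<in> borel_measurable I01"
  shows "(\<lambda>s. if t < s then f s * w s * IJ J t s ^ (j - 1) else 0) \<in> borel_measurable I01"
proof -
  have [measurable]: "(\<lambda>s. IJ J t s) \<in> borel_measurable I01" by (rule IJ_measurable) (auto simp: t)
  show ?thesis by measurable
qed

lemma HJ_mono:
  assumes "0 \<le> t" "AE s in I01. f s \<le> g s"
  shows "HJ J j f t \<le> HJ J j g t"
  unfolding HJ_eq[OF assms(1)] using assms(2)
  by (intro mult_left_mono nn_integral_mono_AE) (auto intro!: mult_right_mono)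

lemma HJ_cong_AE:
  assumes "0 \<le> t" "AE s in I01. f s = g s"
  shows "HJ J j f t = HJ J j g t"
  using assms by (intro antisym HJ_mono) auto

lemma HJ_scale:
  assumes t: "0 \<le> t" and f: "f \<in> borel_measurable I01"
  shows "HJ J j (\<lambda>x. a * f x) t = a * HJ J j f t"
proof -
  have "(\<integral>\<^sup>+s. (if t < s then a * f s * w s * IJ J t s ^ (j - 1) else 0) \<partial>I01) =
    (\<integral>\<^sup>+s. a * (if t < s then f s * w s * IJ J t s ^ (j - 1) else 0) \<partial>I01)"
    by (intro nn_integral_cong) (auto simp: mult.assoc)
  also have "\<dots> = a * (\<integral>\<^sup>+s. (if t < s then f s * w s * IJ J t s ^ (j - 1) else 0) \<partial>I01)"
    by (rule nn_integral_cmult[OF HJ_integrand_measurable[OF t f]])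
  finally show ?thesis unfolding HJ_eq[OF t] by (simp add: mult.left_commute)
qed

lemma HJ_add:
  assumes t: "0 \<le> t" and f: "f \<in> borel_measurable I01" and g: "g \<in> borel_measurable I01"
  shows "HJ J j (\<lambda>x. f x + g x) t = HJ J j f t + HJ J j g t"
proof -
  have "(\<integral>\<^sup>+s. (if t < s then (f s + g s) * w s * IJ J t s ^ (j - 1) else 0) \<partial>I01) =
    (\<integral>\<^sup>+s. (if t < s then f s * w s * IJ J t s ^ (j - 1) else 0) +
      (if t < s then g s * w s * IJ J t s ^ (j - 1) else 0) \<partial>I01)"
    by (intro nn_integral_cong) (auto simp: distrib_right)
  also have "\<dots> = (\<integral>\<^sup>+s. (if t < s then f s * w s * IJ J t s ^ (j - 1) else 0) \<partial>I01) +
      (\<integral>\<^sup>+s. (if t < s then g s * w s * IJ J t s ^ (j - 1) else 0) \<partial>I01)"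
    by (rule nn_integral_add[OF HJ_integrand_measurable[OF t f] HJ_integrand_measurable[OF t g]])
  finally show ?thesis unfolding HJ_eq[OF t] by (simp add: distrib_left)
qed

lemma inv_fact_le_1: "ennreal (1 / fact (j - 1)) \<le> 1"
  by (simp add: ennreal_le_1 fact_ge_1 divide_le_eq)

text \<open>Beyond \<open>a\<close> the density \<open>w\<close> and the \<open>j - 1\<close>
  factors \<open>IJ\<close> are each at most \<open>1 / (c * a)\<close>; what remains is the L1 norm
  of \<open>f\<close>.\<close>

lemma HJ_bound:
  assumes a: "0 < a" "a \<le> t" and f [measurable]: "f \<in> borel_measurable I01"
  shows "HJ J j f t \<le> ennreal (1 / (c * a)) ^ Suc (j - 1) * (\<integral>\<^sup>+x. f x \<partial>I01)"
proof -
  let ?D = "ennreal (1 / (c * a))"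
  have "HJ J j f t \<le> 1 * (\<integral>\<^sup>+s. (if t < s then f s * w s * IJ J t s ^ (j - 1) else 0) \<partial>I01)"
    unfolding HJ_eq[OF less_imp_le[OF less_le_trans[OF a]]] by (intro mult_right_mono inv_fact_le_1) simp
  also have "\<dots> \<le> (\<integral>\<^sup>+s. ?D ^ Suc (j - 1) * f s \<partial>I01)"
    unfolding mult_1
  proof (intro nn_integral_mono)
    fix s assume s: "s \<in> space I01"
    show "(if t < s then f s * w s * IJ J t s ^ (j - 1) else 0) \<le> ?D ^ Suc (j - 1) * f s"
    proof (cases "t < s")
      case True
      have "f s * w s * IJ J t s ^ (j - 1) \<le> f s * ?D * ?D ^ (j - 1)"
        using a s True by (intro mult_mono mult_left_mono power_mono w_le IJ_le) auto
      then show ?thesis using True by (simp add: mult_ac)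
    qed simp
  qed
  also have "\<dots> = ?D ^ Suc (j - 1) * (\<integral>\<^sup>+x. f x \<partial>I01)" by (rule nn_integral_cmult) measurable
  finally show ?thesis .
qed

text \<open>Tonelli's theorem on the triangle \<open>t < s\<close>, with the kernel written
  symmetrically as \<open>?K\<close>.\<close>

lemma HJ_duality:
  assumes f [measurable]: "f \<in> borel_measurable I01" and g [measurable]: "g \<in> borel_measurable I01"
  shows "(\<integral>\<^sup>+t. g t * HJ J j f t \<partial>I01) = (\<integral>\<^sup>+s. f s * RJ J j g s \<partial>I01)"
proof -
  interpret I: sigma_finite_measure I01 by (rule sigma_finite_I01)
  interpret P: pair_sigma_finite I01 I01 ..
  let ?k = "ennreal (1 / fact (j - 1))"
  let ?K = "\<lambda>t s. if t < s then ?k * g t * (f s * w s * IJ J t s ^ (j - 1)) else 0"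
  have [measurable]: "(\<lambda>z. IJ J (fst z) (snd z)) \<in> borel_measurable (I01 \<Otimes>\<^sub>M I01)"
    by (rule IJ_measurable) (auto simp: space_pair_measure)
  have K: "case_prod ?K \<in> borel_measurable (I01 \<Otimes>\<^sub>M I01)"
    unfolding case_prod_beta by measurable
  have "(\<integral>\<^sup>+t. g t * HJ J j f t \<partial>I01) = (\<integral>\<^sup>+t. (\<integral>\<^sup>+s. ?K t s \<partial>I01) \<partial>I01)"
  proof (intro nn_integral_cong)
    fix t assume t: "t \<in> space I01"
    have "(\<integral>\<^sup>+s. ?K t s \<partial>I01) = (\<integral>\<^sup>+s. ?k * g t * (if t < s then f s * w s * IJ J t s ^ (j - 1) else 0) \<partial>I01)"
      by (intro nn_integral_cong) auto
    also have "\<dots> = ?k * g t * (\<integral>\<^sup>+s. (if t < s then f s * w s * IJ J t s ^ (j - 1) else 0) \<partial>I01)"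
      using t by (intro nn_integral_cmult HJ_integrand_measurable f) auto
    finally show "g t * HJ J j f t = (\<integral>\<^sup>+s. ?K t s \<partial>I01)"
      using t by (subst HJ_eq) (auto simp: mult_ac)
  qed
  also have "\<dots> = (\<integral>\<^sup>+s. (\<integral>\<^sup>+t. ?K t s \<partial>I01) \<partial>I01)"
    by (rule P.Fubini'[OF K, symmetric])
  also have "\<dots> = (\<integral>\<^sup>+s. f s * RJ J j g s \<partial>I01)"
  proof (intro nn_integral_cong)
    fix s assume s: "s \<in> space I01"
    have [measurable]: "(\<lambda>t. IJ J t s) \<in> borel_measurable I01" by (rule IJ_measurable) (use s in auto)
    have "(\<integral>\<^sup>+t. ?K t s \<partial>I01) = (\<integral>\<^sup>+t. ?k * w s * f s * (if t < s then IJ J t s ^ (j - 1) * g t else 0) \<partial>I01)"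
      by (intro nn_integral_cong) (auto simp: mult_ac)
    also have "\<dots> = ?k * w s * f s * (\<integral>\<^sup>+t. (if t < s then IJ J t s ^ (j - 1) * g t else 0) \<partial>I01)"
      by (rule nn_integral_cmult) measurable
    finally show "(\<integral>\<^sup>+t. ?K t s \<partial>I01) = f s * RJ J j g s"
      using s by (subst RJ_eq) (auto simp: mult_ac)
  qed
  finally show ?thesis .
qed

text \<open>As \<open>T n\<close> decreases to \<open>t\<close>, both the domain of integration and
  the kernel increase, so monotone convergence recovers the value at \<open>t\<close> as a supremum
  of values to its right.\<close>

lemma HJ_right_lsc:
  assumes f [measurable]: "f \<in> borel_measurable I01"
  shows "right_lsc (HJ J j f)"
  unfolding right_lsc_def
proof (intro allI impI)
  fix t :: real and b assume t: "0 \<le> t" and b: "b < HJ J j f t"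
  define T where "T n = t + 1 / real (Suc n)" for n
  have T1: "decseq T" unfolding decseq_def T_def by (auto intro!: frac_le)
  have T2: "t < T n" for n by (simp add: T_def)
  have "(\<lambda>n. t + 1 / real (Suc n)) \<longlonglongrightarrow> t + 0"
    by (intro tendsto_add tendsto_const LIMSEQ_Suc lim_const_over_n)
  then have T3: "T \<longlonglongrightarrow> t" unfolding T_def by simp
  have T0: "0 \<le> T n" for n using T2[of n] t by simp
  let ?g = "\<lambda>n s. if T n < s then f s * w s * IJ J (T n) s ^ (j - 1) else 0"
  have dT: "T n \<le> T m" if "m \<le> n" for m n using T1 that by (simp add: decseq_def)
  have inc: "incseq ?g"
    unfolding incseq_def le_fun_def
    using dT by (auto intro!: mult_left_mono power_mono IJ_mono dest: le_less_trans)
  have "HJ J j f t = ennreal (1 / fact (j - 1)) * (\<integral>\<^sup>+s. (SUP n. ?g n s) \<partial>I01)"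
    unfolding HJ_eq[OF t]
  proof (intro arg_cong[where f = "\<lambda>z. ennreal (1 / fact (j - 1)) * z"] nn_integral_cong)
    fix s assume s: "s \<in> space I01"
    show "(if t < s then f s * w s * IJ J t s ^ (j - 1) else 0) = (SUP n. ?g n s)"
    proof (cases "t < s")
      case True
      then have "\<forall>\<^sub>F n in sequentially. T n < s" using T3 by (auto intro: order_tendstoD)
      then obtain n0 where n0: "T n0 < s" by (auto simp: eventually_sequentially)
      have incI: "incseq (\<lambda>n. IJ J (T n) s)" unfolding incseq_def using dT by (auto intro!: IJ_mono)
      have "(\<lambda>n. IJ J (T n) s) \<longlonglongrightarrow> IJ J t s"
        using LIMSEQ_SUP[OF incI] IJ_SUP[OF t _ T1 T2 T3, of s] s by simp
      then have "(\<lambda>n. IJ J (T n) s ^ (j - 1)) \<longlonglongrightarrow> IJ J t s ^ (j - 1)" by (rule tendsto_power_ennreal)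
      moreover have incp: "incseq (\<lambda>n. IJ J (T n) s ^ (j - 1))"
        using incI unfolding incseq_def by (auto intro!: power_mono)
      ultimately have "IJ J t s ^ (j - 1) = (SUP n. IJ J (T n) s ^ (j - 1))"
        using LIMSEQ_SUP[OF incp] LIMSEQ_unique by blast
      then have "f s * w s * IJ J t s ^ (j - 1) = (SUP n. f s * w s * IJ J (T n) s ^ (j - 1))"
        by (simp add: SUP_mult_left_ennreal)
      also have "\<dots> = (SUP n. ?g n s)"
      \<comment> \<open>The term \<open>?g n s\<close> is 0 until \<open>T n < s\<close>, so indices
        are first raised to at least \<open>n0\<close>.\<close>
      proof (rule SUP_eq)
        fix n
        have "f s * w s * IJ J (T n) s ^ (j - 1) \<le> f s * w s * IJ J (T (max n n0)) s ^ (j - 1)"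
          by (intro mult_left_mono incseqD[OF incp]) auto
        also have "\<dots> = ?g (max n n0) s" using dT[of n0 "max n n0"] n0 by auto
        finally show "\<exists>i\<in>UNIV. f s * w s * IJ J (T n) s ^ (j - 1) \<le> ?g i s" by blast
      next
        fix n show "\<exists>i\<in>UNIV. ?g n s \<le> f s * w s * IJ J (T i) s ^ (j - 1)" by (intro bexI[of _ n]) auto
      qed
      finally show ?thesis using True by simp
    next
      case False
      have "?g n s = 0" for n using False T2[of n] by auto
      then show ?thesis using False by simp
    qed
  qed
  also have "\<dots> = ennreal (1 / fact (j - 1)) * (SUP n. \<integral>\<^sup>+s. ?g n s \<partial>I01)"
    using T0 by (subst nn_integral_monotone_convergence_SUP[OF inc]) (auto intro!: HJ_integrand_measurable)
  also have "\<dots> = (SUP n. HJ J j f (T n))"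
    using T0 by (simp add: SUP_mult_left_ennreal HJ_eq)
  finally have "b < (SUP n. HJ J j f (T n))" using b by simp
  then show "\<exists>y>t. b < HJ J j f y" using T2 by (auto simp: less_SUP_iff)
qed

lemma HJ_const_pos:
  assumes "0 \<le> t" "t < 1"
  shows "0 < HJ J j (\<lambda>_. 1) t"
proof -
  have "0 < (\<integral>\<^sup>+s. (if t < s then 1 * w s * IJ J t s ^ (j - 1) else 0) \<partial>I01)"
    using assms by (intro nn_integral_I01_pos[OF HJ_integrand_measurable, of _ _ t 1])
      (auto simp: ennreal_zero_less_mult_iff zero_less_iff_neq_zero[of "_ ^ _"] intro!: w_pos dest: IJ_pos[of t])
  then show ?thesis unfolding HJ_eq[OF assms(1)] by (simp add: ennreal_zero_less_mult_iff)
qed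

end

section \<open>Vanishing fundamental function and dominated convergence\<close>

lemma ennreal_tendsto_0I:
  fixes x :: "'a \<Rightarrow> ennreal"
  assumes "\<And>e::real. 0 < e \<Longrightarrow> \<forall>\<^sub>F n in F. x n \<le> ennreal e"
  shows "(x \<longlongrightarrow> 0) F"
proof (rule order_tendstoI)
  fix a :: ennreal assume "0 < a"
  then obtain b where b: "0 < b" "b < a" using dense by blast
  then have "b < top" using less_le_trans top_greatest by blast
  then obtain e where "b = ennreal e" "0 < e" using b(1) by (cases b) auto
  then show "\<forall>\<^sub>F n in F. x n < a" using assms[of e] b(2) by (auto elim: eventually_mono)
qed simp

lemma ennreal_le_epsilon0:
  fixes x :: ennreal
  assumes "\<And>e::real. 0 < e \<Longrightarrow> x \<le> ennreal e"
  shows "x = 0"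
  using assms ennreal_le_epsilon[of 0 x] by (simp add: le_zero_eq)

text \<open>The norm of the indicator of (0,a), as a function of \<open>a\<close>, is the
  fundamental function. It is increasing, so one small value for each \<open>e\<close> says that its
  limit at 0 is 0.\<close>

definition vanishing_fundamental :: "((real \<Rightarrow> ennreal) \<Rightarrow> ennreal) \<Rightarrow> bool" where
  "vanishing_fundamental \<rho> \<longleftrightarrow>
    (\<forall>e>0. \<exists>a. 0 < a \<and> a < 1 \<and> \<rho> (\<lambda>x. indicator {0<..<a} x) \<le> ennreal e)"

lemma indicator_I01_measurable [measurable]: "S \<in> sets borel \<Longrightarrow> (\<lambda>x. indicator S x :: ennreal) \<in> borel_measurable I01"
  by (intro borel_measurable_I01 borel_measurable_indicator)

lemma distr_fun_indicator:
  assumes "E \<subseteq> space I01"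
  shows "distr_fun (\<lambda>x. indicator E x) c = (if c < 1 then emeasure I01 E else 0)"
proof -
  have "{x \<in> space I01. c < indicator E x} = (if c < 1 then E else {})"
    using assms by (auto simp: indicator_def split: if_splits)
  then show ?thesis unfolding distr_fun_def by auto
qed

lemma ri_indicator_le:
  assumes \<rho>: "ri_norm \<rho>" and E: "E \<in> sets I01" "emeasure I01 E \<le> ennreal a"
  shows "\<rho> (\<lambda>x. indicator E x) \<le> \<rho> (\<lambda>x. indicator {0<..<a} x)"
proof -
  interpret finite_measure I01 by (rule finite_measure_I01)
  define m where "m = measure I01 E"
  have m: "emeasure I01 E = ennreal m" "0 \<le> m" "m \<le> 1"
    using emeasure_I01_le_1[of E] by (auto simp: m_def emeasure_eq_measure)
  have ma: "m \<le> max 0 a" using E(2) m by (auto simp: ennreal_le_iff2)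
  have "\<rho> (\<lambda>x. indicator E x) = \<rho> (\<lambda>x. indicator {0<..<m} x)"
  proof (rule ri_equi[OF \<rho>])
    show "distr_fun (\<lambda>x. indicator E x) c = distr_fun (\<lambda>x. indicator {0<..<m} x) c" for c
      using m sets.sets_into_space[OF E(1)] by (subst (1 2) distr_fun_indicator) (auto simp: emeasure_I01_interval)
    show "(\<lambda>x. indicator E x :: ennreal) \<in> borel_measurable I01" by (rule borel_measurable_indicator[OF E(1)])
  qed measurable
  also have "\<dots> \<le> \<rho> (\<lambda>x. indicator {0<..<a} x)"
    using ma by (intro ri_mono[OF \<rho>]) (auto simp: indicator_def)
  finally show ?thesis .
qed

text \<open>As in Egorov's theorem: the set \<open>E n\<close>, where some later \<open>u k\<close>
  exceeds \<open>\<delta>\<close>, has measure tending to 0. On it \<open>u m\<close> is at most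
  \<open>K'\<close>, and the indicator has small norm; off it \<open>u m\<close> is at most
  \<open>\<delta>\<close>.\<close>

lemma ri_dominated_convergence:
  assumes \<rho>: "ri_norm \<rho>" and v: "vanishing_fundamental \<rho>"
    and u [measurable]: "\<And>n. u n \<in> borel_measurable I01"
    and K: "\<And>n x. u n x \<le> ennreal K" and lim: "AE x in I01. (\<lambda>n. u n x) \<longlonglongrightarrow> 0"
  shows "(\<lambda>n. \<rho> (u n)) \<longlonglongrightarrow> 0"
proof (rule ennreal_tendsto_0I)
  fix e :: real assume e: "0 < e"
  interpret finite_measure I01 by (rule finite_measure_I01)
  define r where "r = enn2real (\<rho> (\<lambda>_. 1))"
  have r: "\<rho> (\<lambda>_. 1) = ennreal r" "0 \<le> r" using ri_one[OF \<rho>] by (auto simp: r_def)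
  define K' where "K' = max K 1"
  \<comment> \<open>This makes the norm of the constant \<open>\<delta>\<close> at most
    \<open>e / 2\<close>; the added 1 keeps the denominator positive.\<close>
  define \<delta> where "\<delta> = e / (2 * (r + 1))"
  have \<delta>: "0 < \<delta>" using e r by (simp add: \<delta>_def)
  have "\<delta> * r \<le> e / 2" using r e by (simp add: \<delta>_def field_simps)
  have K': "0 < K'" by (simp add: K'_def)
  obtain a where a: "0 < a" "a < 1" "\<rho> (\<lambda>x. indicator {0<..<a} x) \<le> ennreal (e / (2 * K'))"
    using v e K' unfolding vanishing_fundamental_def by (metis divide_pos_pos mult_pos_pos zero_less_numeral)
  define E where "E n = {x \<in> space I01. \<exists>k\<in>{n..}. ennreal \<delta> < u k x}" for n :: nat
  have E [measurable]: "E n \<in> sets I01" for n unfolding E_def by measurable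
  have dec: "decseq E" unfolding decseq_def E_def by auto
  have "emeasure I01 (\<Inter>n. E n) = 0"
  proof -
    have "AE x in I01. x \<notin> (\<Inter>n. E n)"
      using lim
    proof eventually_elim
      case (elim x)
      have "\<forall>\<^sub>F n in sequentially. u n x < ennreal \<delta>" using elim \<delta> by (auto intro: order_tendstoD)
      then obtain n where "\<And>k. k \<ge> n \<Longrightarrow> u k x < ennreal \<delta>" by (auto simp: eventually_sequentially)
      then have "x \<notin> E n" by (auto simp: E_def not_less less_imp_le)
      then show ?case by blast
    qed
    moreover have "(\<Inter>n. E n) \<in> sets I01" by measurable
    ultimately show ?thesis by (simp only: AE_iff_null_sets[symmetric] null_setsD1)
  qed
  then have "(INF n. emeasure I01 (E n)) = 0"
    using INF_emeasure_decseq[of E I01] dec by (simp add: image_subset_iff)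
  then have "(INF n. emeasure I01 (E n)) < ennreal a" using a by simp
  then obtain n where n: "emeasure I01 (E n) < ennreal a" by (auto simp: INF_less_iff)
  have "\<rho> (u m) \<le> ennreal e" if "n \<le> m" for m
  proof -
    have [measurable]: "(\<lambda>x. indicator (E n) x :: ennreal) \<in> borel_measurable I01"
      by (rule borel_measurable_indicator[OF E])
    have "\<rho> (u m) \<le> \<rho> (\<lambda>x. ennreal \<delta> + ennreal K' * indicator (E n) x)"
    proof (rule ri_mono[OF \<rho>])
      fix x :: real assume x: "0 < x" "x < 1"
      show "u m x \<le> ennreal \<delta> + ennreal K' * indicator (E n) x"
      proof (cases "x \<in> E n")
        case True
        have "u m x \<le> ennreal K'" using K[of m x] by (rule order_trans) (simp add: K'_def ennreal_leI)
        then show ?thesis using True by (simp add: add_increasing)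
      next
        case False
        then show ?thesis using x that by (auto simp: E_def not_less)
      qed
    qed measurable
    also have "\<dots> \<le> \<rho> (\<lambda>_. ennreal \<delta>) + \<rho> (\<lambda>x. ennreal K' * indicator (E n) x)"
      by (intro ri_add[OF \<rho>]) measurable
    also have "\<rho> (\<lambda>_. ennreal \<delta>) = ennreal (\<delta> * r)"
      using ri_const[OF \<rho>, of \<delta>] \<delta> r by (simp add: ennreal_mult)
    also have "\<rho> (\<lambda>x. ennreal K' * indicator (E n) x) = ennreal K' * \<rho> (\<lambda>x. indicator (E n) x)"
      using K' by (intro ri_scale[OF \<rho>]) auto
    also have "\<dots> \<le> ennreal K' * ennreal (e / (2 * K'))"
      using order_trans[OF ri_indicator_le[OF \<rho> E less_imp_le[OF n]] a(3)] by (intro mult_left_mono) auto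
    also have "\<dots> = ennreal (e / 2)" using K' e by (simp add: ennreal_mult[symmetric])
    also have "ennreal (\<delta> * r) + ennreal (e / 2) = ennreal (\<delta> * r + e / 2)"
      using \<delta> r e by (intro ennreal_plus[symmetric]) auto
    also have "\<dots> \<le> ennreal e" using \<open>\<delta> * r \<le> e / 2\<close> by (intro ennreal_leI) simp
    finally show ?thesis by (simp add: add_left_mono)
  qed
  then show "\<forall>\<^sub>F n in sequentially. \<rho> (u n) \<le> ennreal e" by (auto simp: eventually_sequentially)
qed

text \<open>Bounded functions always belong to the space, so inequality supplies an essentially
  unbounded \<open>f\<close> of finite norm. By a Chebyshev estimate the indicator of the set where
  \<open>\<bar>f\<bar> > C\<close> has norm at most that of \<open>f\<close> divided by
  \<open>C\<close>, and this set has positive measure.\<close>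

lemma vanishing_fundamental_if_neq_Linf:
  assumes \<rho>: "ri_norm \<rho>" and ne: "ri_space \<rho> \<noteq> Linf_space"
  shows "vanishing_fundamental \<rho>"
proof -
  interpret finite_measure I01 by (rule finite_measure_I01)
  have "Linf_space \<subseteq> ri_space \<rho>"
  proof
    fix f assume "f \<in> Linf_space"
    then obtain C where f [measurable]: "f \<in> borel_measurable I01" and C: "AE x in I01. \<bar>f x\<bar> \<le> C"
      by (auto simp: Linf_space_def)
    have "\<rho> (\<lambda>x. ennreal \<bar>f x\<bar>) \<le> \<rho> (\<lambda>_. ennreal (max C 0))"
      using C by (intro ri_mono_AE[OF \<rho>]) (auto elim!: eventually_mono intro: ennreal_leI)
    also have "\<dots> < top"
      using ri_const[OF \<rho>, of "max C 0"] ri_one[OF \<rho>] by (simp add: ennreal_mult_less_top)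
    finally show "f \<in> ri_space \<rho>" by (simp add: ri_space_def)
  qed
  then obtain f where f [measurable]: "f \<in> borel_measurable I01" and fin: "\<rho> (\<lambda>x. ennreal \<bar>f x\<bar>) < top"
    and unb: "\<And>C. \<not> (AE x in I01. \<bar>f x\<bar> \<le> C)"
    using ne by (auto simp: ri_space_def Linf_space_def)
  define q where "q = enn2real (\<rho> (\<lambda>x. ennreal \<bar>f x\<bar>))"
  have q: "\<rho> (\<lambda>x. ennreal \<bar>f x\<bar>) = ennreal q" "0 \<le> q" using fin by (auto simp: q_def)
  show ?thesis
    unfolding vanishing_fundamental_def
  proof (intro allI impI)
    fix e :: real assume e: "0 < e"
    \<comment> \<open>Chosen so that \<open>q / C \<le> e\<close>; the added 1 keeps
      \<open>C\<close> positive when \<open>q = 0\<close>.\<close>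
    define C where "C = (q + 1) / e"
    have C: "0 < C" using q e by (simp add: C_def)
    define E where "E = {x \<in> space I01. C < \<bar>f x\<bar>}"
    have E [measurable]: "E \<in> sets I01" unfolding E_def by measurable
    have "emeasure I01 E \<noteq> 0"
    proof
      assume "emeasure I01 E = 0"
      then have "AE x in I01. x \<notin> E" by (intro AE_not_in) (auto simp: null_sets_def)
      then have "AE x in I01. \<bar>f x\<bar> \<le> C" by (rule AE_mp) (auto simp: E_def not_less intro!: AE_I2)
      then show False using unb by blast
    qed
    then have m: "0 < measure I01 E" by (simp add: emeasure_eq_measure zero_less_measure_iff)
    define a where "a = measure I01 E / 2"
    have "measure I01 E \<le> 1" using emeasure_I01_le_1[of E] by (simp add: emeasure_eq_measure)
    then have a: "0 < a" "a < 1" "a \<le> measure I01 E" using m by (auto simp: a_def)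
    have EI: "(\<lambda>x. indicator E x :: ennreal) \<in> borel_measurable I01" by (rule borel_measurable_indicator[OF E])
    have "\<rho> (\<lambda>x. indicator {0<..<a} x) \<le> \<rho> (\<lambda>x. indicator {0<..<measure I01 E} x)"
      using a by (intro ri_mono[OF \<rho>]) (auto simp: indicator_def)
    also have "\<dots> = \<rho> (\<lambda>x. indicator E x)"
    proof (rule ri_equi[OF \<rho>])
      show "distr_fun (\<lambda>x. indicator {0<..<measure I01 E} x) c = distr_fun (\<lambda>x. indicator E x) c" for c
        using \<open>measure I01 E \<le> 1\<close> m sets.sets_into_space[OF E]
        by (subst (1 2) distr_fun_indicator) (auto simp: emeasure_I01_interval emeasure_eq_measure[of E] simp del: emeasure_eq_measure)
    qed (use EI in measurable)
    also have "\<dots> \<le> \<rho> (\<lambda>x. ennreal (1 / C) * ennreal \<bar>f x\<bar>)"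
    proof (rule ri_mono[OF \<rho> EI])
      fix x :: real
      show "indicator E x \<le> ennreal (1 / C) * ennreal \<bar>f x\<bar>"
        using C by (cases "x \<in> E") (auto simp: E_def ennreal_mult[symmetric] field_simps ennreal_1[symmetric] simp del: ennreal_1 intro!: ennreal_leI)
    qed measurable
    also have "\<dots> = ennreal (1 / C * q)" using C q by (subst ri_scale[OF \<rho>]) (auto simp: ennreal_mult[symmetric])
    also have "\<dots> \<le> ennreal e" using q e C by (intro ennreal_leI) (simp add: C_def field_simps)
    finally show "\<exists>a. 0 < a \<and> a < 1 \<and> \<rho> (\<lambda>x. indicator {0<..<a} x) \<le> ennreal e" using a by blast
  qed
qed

lemma SUP_min_of_nat: "(SUP n. min (of_nat n) z) = (z::ennreal)"
proof (rule antisym)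
  show "z \<le> (SUP n. min (of_nat n) z)"
  proof (rule dense_le)
    fix y assume y: "y < z"
    then have "y < top" using less_le_trans top_greatest by blast
    then obtain n where "y < of_nat n" using ennreal_Ex_less_of_nat by blast
    then have "y \<le> min (of_nat n) z" using y by (simp add: less_imp_le)
    then show "y \<le> (SUP n. min (of_nat n) z)" by (rule SUP_upper2[OF UNIV_I])
  qed
qed (auto intro!: SUP_least)

section \<open>Uniform smallness near the origin\<close>

definition unit_ball :: "((real \<Rightarrow> ennreal) \<Rightarrow> ennreal) \<Rightarrow> (real \<Rightarrow> real) set" where
  "unit_ball \<rho> = {f. f \<in> borel_measurable I01 \<and> \<rho> (\<lambda>x. ennreal \<bar>f x\<bar>) \<le> 1}"

context hardy_kernel
begin

definition tail :: "((real \<Rightarrow> ennreal) \<Rightarrow> ennreal) \<Rightarrow> ((real \<Rightarrow> ennreal) \<Rightarrow> ennreal) \<Rightarrow> real \<Rightarrow> ennreal" where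
  "tail \<rho>X \<rho>Y a = (SUP f \<in> unit_ball \<rho>X. \<rho>Y (\<lambda>t. indicator {0<..<a} t * HJ J j (\<lambda>x. ennreal \<bar>f x\<bar>) t))"

definition rearr_tail :: "((real \<Rightarrow> ennreal) \<Rightarrow> ennreal) \<Rightarrow> ((real \<Rightarrow> ennreal) \<Rightarrow> ennreal) \<Rightarrow> real \<Rightarrow> ennreal" where
  "rearr_tail \<rho>X \<rho>Y a = (SUP f \<in> unit_ball (XrJ_norm \<rho>X J j). \<rho>Y (\<lambda>t. indicator {0<..<a} t * rearr (\<lambda>x. ennreal \<bar>f x\<bar>) t))"

text \<open>The statement admits any \<open>v\<close> below \<open>H f\<close> so that it covers the
  finite truncations of \<open>H f\<close> directly.\<close>

lemma XrJ_norm_HJ_le: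
  assumes f [measurable]: "f \<in> borel_measurable I01" and f1: "\<rho> f \<le> 1"
    and v: "\<And>x. 0 < x \<Longrightarrow> x < 1 \<Longrightarrow> v x \<le> HJ J j f x"
  shows "XrJ_norm \<rho> J j v \<le> 1"
  unfolding XrJ_norm_def
proof (rule SUP_least)
  fix h assume "h \<in> {h \<in> borel_measurable I01. assoc_norm \<rho> (RJ J j (rearr h)) \<le> 1}"
  then have h [measurable]: "h \<in> borel_measurable I01" and h1: "assoc_norm \<rho> (RJ J j (rearr h)) \<le> 1" by auto
  have "(\<integral>\<^sup>+x. h x * v x \<partial>I01) \<le> (\<integral>\<^sup>+x. h x * HJ J j f x \<partial>I01)"
    using v by (intro nn_integral_mono mult_left_mono) auto
  also have "\<dots> \<le> (\<integral>\<^sup>+x. rearr h x * HJ J j f x \<partial>I01)"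
    by (rule Hardy_Littlewood_antimono) (auto intro: antimonoD[OF HJ_antimono])
  also have "\<dots> = (\<integral>\<^sup>+x. f x * RJ J j (rearr h) x \<partial>I01)" by (rule HJ_duality) measurable
  also have "\<dots> \<le> assoc_norm \<rho> (RJ J j (rearr h))"
    unfolding assoc_norm_def by (rule SUP_upper) (use f f1 in simp)
  also note h1
  finally show "(\<integral>\<^sup>+x. h x * v x \<partial>I01) \<le> 1" .
qed

text \<open>The unit ball contains real functions only, whereas \<open>H f\<close> may take the
  value infinity. Its truncations at \<open>n\<close> are finite, increase to \<open>H f\<close>,
  and lie below their own rearrangements because they are decreasing and right continuous.\<close>

lemma tail_le_rearr_tail:
  assumes Y: "ri_norm \<rho>Y"
  shows "tail \<rho>X \<rho>Y a \<le> rearr_tail \<rho>X \<rho>Y a"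
  unfolding tail_def
proof (rule SUP_least)
  fix f assume "f \<in> unit_ball \<rho>X"
  then have f [measurable]: "f \<in> borel_measurable I01" and f1: "\<rho>X (\<lambda>x. ennreal \<bar>f x\<bar>) \<le> 1"
    by (auto simp: unit_ball_def)
  let ?H = "HJ J j (\<lambda>x. ennreal \<bar>f x\<bar>)"
  have fe [measurable]: "(\<lambda>x. ennreal \<bar>f x\<bar>) \<in> borel_measurable I01" by measurable
  let ?V = "\<lambda>n t. min (of_nat n) (?H t)"
  have "\<rho>Y (\<lambda>t. indicator {0<..<a} t * ?H t) = (SUP n. \<rho>Y (\<lambda>t. indicator {0<..<a} t * ?V n t))"
  proof (rule ri_Sup[OF Y])
    show "incseq (\<lambda>n. indicator {0<..<a} x * ?V n x)" for x
      unfolding incseq_def by (auto intro!: mult_left_mono min.mono)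
    show "indicator {0<..<a} x * ?H x = (SUP n. indicator {0<..<a} x * ?V n x)" for x
      by (simp only: SUP_mult_left_ennreal[symmetric] SUP_min_of_nat)
  qed measurable
  also have "\<dots> \<le> rearr_tail \<rho>X \<rho>Y a"
  proof (rule SUP_least)
    fix n
    define v where "v t = enn2real (?V n t)" for t
    have v [measurable]: "v \<in> borel_measurable I01" unfolding v_def by measurable
    have "?V n t < top" for t by (rule le_less_trans[OF min.cobounded1]) (simp add: ennreal_of_nat_eq_real_of_nat)
    then have ve: "ennreal \<bar>v t\<bar> = ?V n t" for t unfolding v_def by simp
    have "XrJ_norm \<rho>X J j (\<lambda>x. ennreal \<bar>v x\<bar>) \<le> 1"
      by (rule XrJ_norm_HJ_le[where f = "\<lambda>x. ennreal \<bar>f x\<bar>"]) (use f1 in \<open>auto simp: ve\<close>)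
    then have vb: "v \<in> unit_ball (XrJ_norm \<rho>X J j)" by (simp add: unit_ball_def)
    have "?V n t \<le> rearr (?V n) t" if t: "0 < t" "t < 1" for t
    proof (rule le_rearr_antimono[OF _ _ t])
      show "?V n y \<le> ?V n x" if "x \<le> y" for x y
        using that by (intro min.mono order_refl antimonoD[OF HJ_antimono])
      fix b assume b: "b < ?V n t"
      then obtain y where y: "t < y" "b < ?H y"
        using HJ_right_lsc[OF fe] t unfolding right_lsc_def by (meson less_imp_le min_less_iff_conj)
      then have "y < 1" using HJ_ge_1[of y] by (cases "y < 1") (auto simp: not_less)
      then show "\<exists>y>t. y < 1 \<and> b < ?V n y" using y b by (intro exI[of _ y]) auto
    qed measurable
    then have "\<rho>Y (\<lambda>t. indicator {0<..<a} t * ?V n t) \<le> \<rho>Y (\<lambda>t. indicator {0<..<a} t * rearr (?V n) t)"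
      by (intro ri_mono[OF Y] mult_left_mono) (auto, measurable)
    also have "\<dots> = \<rho>Y (\<lambda>t. indicator {0<..<a} t * rearr (\<lambda>x. ennreal \<bar>v x\<bar>) t)" by (simp add: ve)
    also have "\<dots> \<le> rearr_tail \<rho>X \<rho>Y a" unfolding rearr_tail_def by (rule SUP_upper[OF vb])
    finally show "\<rho>Y (\<lambda>t. indicator {0<..<a} t * ?V n t) \<le> rearr_tail \<rho>X \<rho>Y a" .
  qed
  finally show "\<rho>Y (\<lambda>t. indicator {0<..<a} t * ?H t) \<le> rearr_tail \<rho>X \<rho>Y a" .
qed

text \<open>The associate norm tests against extended-valued functions, \<open>tail\<close> against
  real ones. Finite norm forces finite L1 norm, so \<open>\<phi>\<close> is finite almost everywhere
  and may be replaced by a real function.\<close>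

lemma HJ_tail_le_of_ennreal:
  assumes X: "ri_norm \<rho>X" and Y: "ri_norm \<rho>Y" and \<phi> [measurable]: "\<phi> \<in> borel_measurable I01" and \<phi>1: "\<rho>X \<phi> \<le> 1"
  shows "\<rho>Y (\<lambda>t. indicator {0<..<a} t * HJ J j \<phi> t) \<le> tail \<rho>X \<rho>Y a"
proof -
  obtain C where C: "0 < C" "\<And>f. f \<in> borel_measurable I01 \<Longrightarrow> (\<integral>\<^sup>+x. f x \<partial>I01) \<le> ennreal C * \<rho>X f"
    using ri_L1[OF X] by blast
  have "(\<integral>\<^sup>+x. \<phi> x \<partial>I01) \<le> ennreal C * \<rho>X \<phi>" by (rule C) measurable
  also have "\<dots> \<le> ennreal C * 1" by (intro mult_left_mono \<phi>1) simp
  also have "\<dots> < top" by simp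
  finally have "AE x in I01. \<phi> x \<noteq> \<infinity>" by (intro nn_integral_PInf_AE) auto
  then have AE: "AE x in I01. \<phi> x = ennreal \<bar>enn2real (\<phi> x)\<bar>"
    by eventually_elim (simp add: less_top)
  let ?f = "\<lambda>x. enn2real (\<phi> x)"
  have "\<rho>X (\<lambda>x. ennreal \<bar>?f x\<bar>) = \<rho>X \<phi>" using AE by (intro ri_cong_AE[OF X]) (auto elim: eventually_mono)
  then have "?f \<in> unit_ball \<rho>X" using \<phi>1 by (simp add: unit_ball_def)
  then have "\<rho>Y (\<lambda>t. indicator {0<..<a} t * HJ J j (\<lambda>x. ennreal \<bar>?f x\<bar>) t) \<le> tail \<rho>X \<rho>Y a"
    unfolding tail_def by (rule SUP_upper)
  moreover have "\<rho>Y (\<lambda>t. indicator {0<..<a} t * HJ J j \<phi> t) =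
      \<rho>Y (\<lambda>t. indicator {0<..<a} t * HJ J j (\<lambda>x. ennreal \<bar>?f x\<bar>) t)"
    using HJ_cong_AE[OF _ AE] by (intro ri_cong[OF Y]) auto
  ultimately show ?thesis by simp
qed

lemma rearr_tail_le_tail:
  assumes X: "ri_norm \<rho>X" and Y: "ri_norm \<rho>Y"
  shows "rearr_tail \<rho>X \<rho>Y a \<le> tail \<rho>X \<rho>Y a"
  unfolding rearr_tail_def
proof (rule SUP_least, rule ccontr)
  fix f assume "f \<in> unit_ball (XrJ_norm \<rho>X J j)"
  then have f [measurable]: "f \<in> borel_measurable I01" and f1: "XrJ_norm \<rho>X J j (\<lambda>x. ennreal \<bar>f x\<bar>) \<le> 1"
    by (auto simp: unit_ball_def)
  let ?f = "\<lambda>x. ennreal \<bar>f x\<bar>"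
  have fe [measurable]: "?f \<in> borel_measurable I01" by measurable
  assume "\<not> \<rho>Y (\<lambda>t. indicator {0<..<a} t * rearr ?f t) \<le> tail \<rho>X \<rho>Y a"
  then obtain b where b: "tail \<rho>X \<rho>Y a < b" "b < \<rho>Y (\<lambda>t. indicator {0<..<a} t * rearr ?f t)"
    using dense by (auto simp: not_le)
  have "b < top" using b(2) less_le_trans top_greatest by blast
  then obtain B where B: "b = ennreal B" "0 \<le> B" by (cases b) auto
  have "0 < b" using b(1) le_less_trans zero_le by blast
  then have B0: "0 < B" using B by simp
  \<comment> \<open>Cutting with \<open>{..<a}\<close> instead of (0,a) changes nothing on (0,1) but
    keeps the function decreasing on the whole line; the same holds for \<open>k\<close>
    below.\<close>
  define u where "u t = indicator {..<a} t * rearr ?f t" for t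
  have u1: "antimono u"
    unfolding antimono_def u_def using antimonoD[OF antimono_rearr, of _ _ ?f]
    by (auto simp: indicator_def)
  have u2: "right_lsc u"
    unfolding right_lsc_def
  proof (intro allI impI)
    fix x d assume x: "0 \<le> x" "d < u x"
    then have "x < a" "d < rearr ?f x" by (cases "x < a"; simp add: u_def)+
    then obtain y where y: "x < y" "d < rearr ?f y" using right_lsc_rearr[OF fe] x unfolding right_lsc_def by blast
    obtain z where z: "x < z" "z < a" "z \<le> y" using \<open>x < a\<close> y(1) by (metis dense min.cobounded2 min_less_iff_conj less_imp_le order.strict_trans2)
    then have "d < rearr ?f z" using y(2) antimonoD[OF antimono_rearr z(3), of ?f] by simp
    then show "\<exists>y>x. d < u y" using z by (intro exI[of _ z]) (auto simp: u_def)
  qed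
  have um [measurable]: "u \<in> borel_measurable I01" by (intro borel_measurable_I01 antimono_borel u1)
  have "\<rho>Y u = \<rho>Y (\<lambda>t. indicator {0<..<a} t * rearr ?f t)"
    by (intro ri_cong[OF Y]) (auto simp: u_def indicator_def)
  then have Bu: "ennreal B < \<rho>Y u" using b B by simp
  obtain h where h: "antimono h"
    "\<And>g. g \<in> borel_measurable I01 \<Longrightarrow> \<rho>Y g \<le> ennreal B \<Longrightarrow> (\<integral>\<^sup>+x. g x * h x \<partial>I01) \<le> 1"
    "1 < (\<integral>\<^sup>+x. u x * h x \<partial>I01)"
    by (rule Lorentz_Luxemburg_antimono[OF Y u1 u2 B0 Bu]) (rule that, assumption+)
  define k where "k t = indicator {..<a} t * h t" for t
  have k: "antimono k"
    unfolding antimono_def k_def using antimonoD[OF h(1)] by (auto simp: indicator_def)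
  have km [measurable]: "k \<in> borel_measurable I01" by (intro borel_measurable_I01 antimono_borel k)
  obtain k' where k' [measurable]: "k' \<in> borel_measurable I01" and dk: "\<And>c. distr_fun k' c = distr_fun k c"
    and le: "(\<integral>\<^sup>+x. rearr ?f x * k x \<partial>I01) \<le> (\<integral>\<^sup>+x. ?f x * k' x \<partial>I01)"
    by (rule resonance[OF fe k]) (rule that, assumption+)
  have "assoc_norm \<rho>X (RJ J j (rearr k')) \<le> 1"
    unfolding assoc_norm_def
  proof (rule SUP_least)
    fix \<phi> assume "\<phi> \<in> {h \<in> borel_measurable I01. \<rho>X h \<le> 1}"
    then have \<phi> [measurable]: "\<phi> \<in> borel_measurable I01" and \<phi>1: "\<rho>X \<phi> \<le> 1" by auto
    have "rearr k' = rearr k" by (rule rearr_cong_distr_fun) (rule dk)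
    then have "rearr k' s \<le> k s" if "0 < s" "s < 1" for s
      using rearr_le_antimono[of k s] antimonoD[OF k] that by simp
    then have "(\<integral>\<^sup>+x. \<phi> x * RJ J j (rearr k') x \<partial>I01) \<le> (\<integral>\<^sup>+x. \<phi> x * RJ J j k x \<partial>I01)"
      by (intro nn_integral_mono mult_left_mono RJ_mono) auto
    also have "\<dots> = (\<integral>\<^sup>+x. k x * HJ J j \<phi> x \<partial>I01)" by (rule HJ_duality[symmetric]) measurable
    \<comment> \<open>The cut-off moves from \<open>k\<close> to \<open>H \<phi>\<close>, whose
      restriction has \<open>Y\<close> norm at most the tail and so at most \<open>B\<close>, the
      radius on which \<open>h\<close> is normalised.\<close>
    also have "\<dots> = (\<integral>\<^sup>+x. (indicator {0<..<a} x * HJ J j \<phi> x) * h x \<partial>I01)"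
      by (intro nn_integral_cong) (auto simp: k_def indicator_def mult_ac)
    also have "\<dots> \<le> 1"
    proof (rule h(2))
      have "\<rho>Y (\<lambda>x. indicator {0<..<a} x * HJ J j \<phi> x) \<le> tail \<rho>X \<rho>Y a"
        by (rule HJ_tail_le_of_ennreal[OF X Y \<phi> \<phi>1])
      then show "\<rho>Y (\<lambda>x. indicator {0<..<a} x * HJ J j \<phi> x) \<le> ennreal B" using b(1) B by simp
    qed measurable
    finally show "(\<integral>\<^sup>+x. \<phi> x * RJ J j (rearr k') x \<partial>I01) \<le> 1" .
  qed
  then have "(\<integral>\<^sup>+x. k' x * ?f x \<partial>I01) \<le> XrJ_norm \<rho>X J j ?f"
    unfolding XrJ_norm_def by (intro SUP_upper) (use k' in simp)
  also note f1
  finally have "(\<integral>\<^sup>+x. ?f x * k' x \<partial>I01) \<le> 1" by (simp add: mult.commute)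
  moreover have "(\<integral>\<^sup>+x. u x * h x \<partial>I01) = (\<integral>\<^sup>+x. rearr ?f x * k x \<partial>I01)"
    by (intro nn_integral_cong) (auto simp: u_def k_def mult_ac)
  ultimately show False using h(3) le by simp
qed

lemma rearr_tail_eq_tail: "ri_norm \<rho>X \<Longrightarrow> ri_norm \<rho>Y \<Longrightarrow> rearr_tail \<rho>X \<rho>Y a = tail \<rho>X \<rho>Y a"
  by (intro antisym rearr_tail_le_tail tail_le_rearr_tail)

lemma tail_mono: "ri_norm \<rho>Y \<Longrightarrow> a \<le> b \<Longrightarrow> tail \<rho>X \<rho>Y a \<le> tail \<rho>X \<rho>Y b"
  unfolding tail_def by (intro SUP_mono', rule ri_mono) (auto simp: indicator_def)

lemma tail_tendsto_0_iff:
  assumes Y: "ri_norm \<rho>Y"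
  shows "(tail \<rho>X \<rho>Y \<longlongrightarrow> 0) (at_right 0) \<longleftrightarrow> (\<forall>e>0. \<exists>a. 0 < a \<and> a < 1 \<and> tail \<rho>X \<rho>Y a \<le> ennreal e)"
proof safe
  fix e :: real assume lim: "(tail \<rho>X \<rho>Y \<longlongrightarrow> 0) (at_right 0)" and e: "0 < e"
  have "\<forall>\<^sub>F a in at_right 0. tail \<rho>X \<rho>Y a < ennreal e" using lim e by (auto intro: order_tendstoD)
  then obtain b where b: "0 < b" "\<And>a. 0 < a \<Longrightarrow> a < b \<Longrightarrow> tail \<rho>X \<rho>Y a < ennreal e"
    by (auto simp: eventually_at_right_field)
  let ?a = "min (b / 2) (1 / 2)"
  have "tail \<rho>X \<rho>Y ?a < ennreal e" using b by (intro b(2)) auto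
  then show "\<exists>a. 0 < a \<and> a < 1 \<and> tail \<rho>X \<rho>Y a \<le> ennreal e"
    using b(1) by (intro exI[of _ ?a]) auto
next
  assume *: "\<forall>e>0. \<exists>a. 0 < a \<and> a < 1 \<and> tail \<rho>X \<rho>Y a \<le> ennreal e"
  show "(tail \<rho>X \<rho>Y \<longlongrightarrow> 0) (at_right 0)"
  proof (rule ennreal_tendsto_0I)
    fix e :: real assume "0 < e"
    then obtain a where a: "0 < a" "tail \<rho>X \<rho>Y a \<le> ennreal e" using * by blast
    then have "\<forall>b>0. b < a \<longrightarrow> tail \<rho>X \<rho>Y b \<le> ennreal e"
      using tail_mono[OF Y] by (meson less_imp_le order_trans)
    then show "\<forall>\<^sub>F b in at_right 0. tail \<rho>X \<rho>Y b \<le> ennreal e"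
      using a(1) by (auto simp: eventually_at_right_field)
  qed
qed

end

section \<open>Smallness near the origin implies compactness\<close>

text \<open>The map sending \<open>z\<close> to \<open>1 / (1 + z)\<close> is an order-reversing
  bijection of the extended half-line onto [0,1]. It turns the decreasing, possibly infinite
  \<open>H f\<close> into an increasing bounded function, as Helly's theorem requires.\<close>

definition squash :: "ennreal \<Rightarrow> real" where
  "squash z = enn2real (inverse (1 + z))"

lemma squash_real: "0 \<le> y \<Longrightarrow> squash (ennreal y) = 1 / (1 + y)"
proof -
  assume y: "0 \<le> y"
  have "1 + ennreal y = ennreal (1 + y)" using y by (subst ennreal_plus) auto
  then have "inverse (1 + ennreal y) = ennreal (1 / (1 + y))"
    using y inverse_ennreal[of "1 + y"] by (simp add: inverse_eq_divide del: ennreal_plus)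
  then show ?thesis using y by (simp add: squash_def)
qed

lemma squash_top: "squash top = 0"
  by (simp add: squash_def)

lemma squash_bounds: "0 \<le> squash z" "squash z \<le> 1"
  by (cases z; simp add: squash_real squash_top)+

lemma squash_antimono: "z \<le> z' \<Longrightarrow> squash z' \<le> squash z"
  by (cases z; cases z') (auto simp: squash_real squash_top top_unique intro!: divide_left_mono)

lemma tendsto_squash:
  assumes "(f \<longlongrightarrow> l) F"
  shows "((\<lambda>x. squash (f x)) \<longlongrightarrow> squash l) F"
proof -
  have c: "continuous_on UNIV (\<lambda>z::ennreal. inverse (1 + z))"
    by (intro continuous_intros continuous_on_add_ennreal)
  have "((\<lambda>x. inverse (1 + f x)) \<longlongrightarrow> inverse (1 + l)) F"
    using continuous_on_tendsto_compose[OF c assms] by simp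
  moreover have "inverse (1 + l) = ennreal (squash l)" unfolding squash_def by (simp add: less_top[symmetric])
  ultimately show ?thesis unfolding squash_def[of "f _"] by (intro tendsto_enn2real) (simp_all add: squash_bounds)
qed

context hardy_kernel
begin

lemma HJ_finite:
  assumes X: "ri_norm \<rho>" and f [measurable]: "f \<in> borel_measurable I01" and fin: "\<rho> f < top" and t: "0 < t"
  shows "HJ J j f t < top"
proof -
  obtain C where C: "0 < C" "\<And>f. f \<in> borel_measurable I01 \<Longrightarrow> (\<integral>\<^sup>+x. f x \<partial>I01) \<le> ennreal C * \<rho> f"
    using ri_L1[OF X] by blast
  have "HJ J j f t \<le> ennreal (1 / (c * t)) ^ Suc (j - 1) * (\<integral>\<^sup>+x. f x \<partial>I01)"
    by (rule HJ_bound[OF t order_refl f])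
  also have "\<dots> \<le> ennreal (1 / (c * t)) ^ Suc (j - 1) * (ennreal C * \<rho> f)"
    by (intro mult_left_mono C) auto
  also have "\<dots> < top" using fin by (auto simp: ennreal_mult_less_top power_less_top_ennreal)
  finally show ?thesis .
qed

text \<open>Helly's theorem concerns functions on the whole line; \<open>max 0 x\<close> extends
  \<open>H f\<close> to negative arguments by its value at 0.\<close>

lemma HJ_right_continuous:
  assumes f: "f \<in> borel_measurable I01"
  shows "continuous (at_right x) (\<lambda>x. squash (HJ J j f (max 0 x)))"
proof -
  let ?\<Phi> = "\<lambda>x. HJ J j f (max 0 x)"
  have mono: "?\<Phi> y \<le> ?\<Phi> x" if "x \<le> y" for x y using that by (intro antimonoD[OF HJ_antimono]) auto
  have "(?\<Phi> \<longlongrightarrow> ?\<Phi> x) (at_right x)"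
  proof (rule order_tendstoI)
    fix b assume b: "b < ?\<Phi> x"
    have "\<exists>y>x. b < ?\<Phi> y"
    proof (cases "x < 0")
      case True
      then show ?thesis using b by (intro exI[of _ "x / 2"]) auto
    next
      case False
      then have "max 0 x = x" by simp
      then obtain y where "x < y" "b < HJ J j f y"
        using HJ_right_lsc[OF f] b False unfolding right_lsc_def by (metis not_less)
      then show ?thesis using False by (intro exI[of _ y]) (auto simp: max_def)
    qed
    then obtain y where y: "x < y" "b < ?\<Phi> y" by blast
    have "b < ?\<Phi> z" if "z < y" for z using y(2) mono[of z y] that by (meson less_imp_le less_le_trans)
    then show "\<forall>\<^sub>F z in at_right x. b < ?\<Phi> z" using y(1) unfolding eventually_at_right_field by blast
  next
    fix b assume b: "?\<Phi> x < b"
    have "?\<Phi> z < b" if "x < z" for z using b mono[of x z] that by (meson less_imp_le le_less_trans)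
    then show "\<forall>\<^sub>F z in at_right x. ?\<Phi> z < b"
      unfolding eventually_at_right_field by (intro exI[of _ "x + 1"]) auto
  qed
  then show ?thesis unfolding continuous_within by (rule tendsto_squash)
qed

lemma vanishing_fundamental_of_tail:
  assumes X: "ri_norm \<rho>X" and Y: "ri_norm \<rho>Y"
    and small: "\<And>e. 0 < e \<Longrightarrow> \<exists>a. 0 < a \<and> a < 1 \<and> tail \<rho>X \<rho>Y a \<le> ennreal e"
  shows "vanishing_fundamental \<rho>Y"
  unfolding vanishing_fundamental_def
proof (intro allI impI)
  fix e :: real assume e: "0 < e"
  define r where "r = enn2real (\<rho>X (\<lambda>_. 1))"
  have r: "\<rho>X (\<lambda>_. 1) = ennreal r" "0 < r"
    using ri_one[OF X] ri_one_pos[OF X] by (auto simp: r_def enn2real_positive_iff)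
  let ?f = "\<lambda>_::real. ennreal (1 / r)"
  have f1: "\<rho>X ?f \<le> 1" using ri_const[OF X, of "1 / r"] r by (simp add: ennreal_mult[symmetric])
  \<comment> \<open>The constant \<open>?f\<close> lies in the unit ball and its image is
    decreasing, so that image is at least \<open>\<kappa>\<close> on (0,1/2]. The tail thus
    dominates \<open>\<kappa>\<close> times the fundamental function.\<close>
  define \<kappa> where "\<kappa> = HJ J j ?f (1 / 2)"
  have "\<kappa> = ennreal (1 / r) * HJ J j (\<lambda>_. 1) (1 / 2)"
    unfolding \<kappa>_def using HJ_scale[of "1/2" "\<lambda>_. 1" "ennreal (1 / r)"] by simp
  then have \<kappa>0: "0 < \<kappa>" using HJ_const_pos[of "1/2"] r by (simp add: ennreal_zero_less_mult_iff)
  have "\<kappa> < top" unfolding \<kappa>_def using f1 by (intro HJ_finite[OF X]) (auto intro: le_less_trans)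
  then obtain k where k: "\<kappa> = ennreal k" "0 < k" using \<kappa>0 by (cases \<kappa>) auto
  obtain a where a: "0 < a" "a < 1" "tail \<rho>X \<rho>Y a \<le> ennreal (k * e)" using small[of "k * e"] e k by auto
  define a' where "a' = min a (1 / 2)"
  have "ennreal k * \<rho>Y (\<lambda>x. indicator {0<..<a'} x) = \<rho>Y (\<lambda>x. ennreal k * indicator {0<..<a'} x)"
    using k by (intro ri_scale[OF Y, symmetric]) auto
  also have "\<dots> \<le> \<rho>Y (\<lambda>x. indicator {0<..<a} x * HJ J j ?f x)"
  proof (rule ri_mono[OF Y])
    fix x :: real assume x: "0 < x" "x < 1"
    show "ennreal k * indicator {0<..<a'} x \<le> indicator {0<..<a} x * HJ J j ?f x"
    proof (cases "x < a'")
      case True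
      then have "x < a" "x \<le> 1 / 2" by (auto simp: a'_def)
      then have "\<kappa> \<le> HJ J j ?f x" unfolding \<kappa>_def by (intro antimonoD[OF HJ_antimono])
      then show ?thesis using x True \<open>x < a\<close> k by simp
    qed simp
  qed measurable
  also have "\<dots> \<le> ennreal (k * e)"
    using HJ_tail_le_of_ennreal[OF X Y _ f1] a(3) by (auto intro: order_trans)
  also have "\<dots> = ennreal k * ennreal e" using k e by (intro ennreal_mult) auto
  finally have "\<rho>Y (\<lambda>x. indicator {0<..<a'} x) \<le> ennreal e"
    using k by (subst (asm) ennreal_mult_le_mult_iff) auto
  then show "\<exists>a. 0 < a \<and> a < 1 \<and> \<rho>Y (\<lambda>x. indicator {0<..<a} x) \<le> ennreal e"
    using a by (intro exI[of _ a']) (auto simp: a'_def)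
qed

lemma HJ_tail_scaled:
  assumes X: "ri_norm \<rho>X" and Y: "ri_norm \<rho>Y" and C: "0 < C"
    and f [measurable]: "f \<in> borel_measurable I01" and fC: "\<rho>X f \<le> ennreal C"
  shows "\<rho>Y (\<lambda>t. indicator {0<..<a} t * HJ J j f t) \<le> ennreal C * tail \<rho>X \<rho>Y a"
proof -
  let ?g = "\<lambda>x. ennreal (1 / C) * f x"
  have "\<rho>X ?g = ennreal (1 / C) * \<rho>X f" using C by (intro ri_scale[OF X]) auto
  also have "\<dots> \<le> ennreal (1 / C) * ennreal C" by (intro mult_left_mono fC) simp
  also have "\<dots> = 1" using C by (simp add: ennreal_mult[symmetric])
  finally have g1: "\<rho>X ?g \<le> 1" .
  have "\<rho>Y (\<lambda>t. indicator {0<..<a} t * HJ J j f t) = \<rho>Y (\<lambda>t. ennreal C * (indicator {0<..<a} t * HJ J j ?g t))"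
  proof (rule ri_cong[OF Y])
    fix t :: real assume t: "0 < t"
    have "ennreal C * (ennreal (1 / C) * HJ J j f t) = HJ J j f t"
      using C by (simp add: mult.assoc[symmetric] ennreal_mult[symmetric])
    then show "indicator {0<..<a} t * HJ J j f t = ennreal C * (indicator {0<..<a} t * HJ J j ?g t)"
      using t by (simp add: HJ_scale indicator_def)
  qed measurable
  also have "\<dots> = ennreal C * \<rho>Y (\<lambda>t. indicator {0<..<a} t * HJ J j ?g t)"
    using C by (intro ri_scale[OF Y]) auto
  also have "\<dots> \<le> ennreal C * tail \<rho>X \<rho>Y a"
    by (intro mult_left_mono HJ_tail_le_of_ennreal[OF X Y _ g1]) auto
  finally show ?thesis .
qed

lemma HJ_bounded_away:
  assumes X: "ri_norm \<rho>" and a: "0 < a"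
  obtains K where "0 \<le> K" "\<And>f t. f \<in> borel_measurable I01 \<Longrightarrow> \<rho> f \<le> ennreal C \<Longrightarrow> a \<le> t \<Longrightarrow> HJ J j f t \<le> ennreal K"
proof -
  obtain L where L: "0 < L" "\<And>f. f \<in> borel_measurable I01 \<Longrightarrow> (\<integral>\<^sup>+x. f x \<partial>I01) \<le> ennreal L * \<rho> f"
    using ri_L1[OF X] by blast
  let ?K = "ennreal (1 / (c * a)) ^ Suc (j - 1) * (ennreal L * ennreal C)"
  have "?K < top" by (auto simp: ennreal_mult_less_top power_less_top_ennreal)
  then have K: "ennreal (enn2real ?K) = ?K" by simp
  show ?thesis
  proof (rule that[of "enn2real ?K"])
    fix f :: "real \<Rightarrow> ennreal" and t
    assume f [measurable]: "f \<in> borel_measurable I01" and fC: "\<rho> f \<le> ennreal C" and t: "a \<le> t"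
    have "HJ J j f t \<le> ennreal (1 / (c * a)) ^ Suc (j - 1) * (\<integral>\<^sup>+x. f x \<partial>I01)"
      by (rule HJ_bound[OF a t f])
    also have "\<dots> \<le> ennreal (1 / (c * a)) ^ Suc (j - 1) * (ennreal L * \<rho> f)"
      by (intro mult_left_mono L) auto
    also have "\<dots> \<le> ?K" by (intro mult_left_mono fC) auto
    finally show "HJ J j f t \<le> ennreal (enn2real ?K)" unfolding K .
  qed simp
qed

lemma HJ_bounded_operator:
  assumes X: "ri_norm \<rho>X" and Y: "ri_norm \<rho>Y"
    and small: "\<And>e. 0 < e \<Longrightarrow> \<exists>a. 0 < a \<and> a < 1 \<and> tail \<rho>X \<rho>Y a \<le> ennreal e"
  shows "\<exists>B<top. \<forall>f\<in>borel_measurable I01. \<rho>X f \<le> ennreal C \<longrightarrow> \<rho>Y (HJ J j f) \<le> B"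
proof -
  define C' where "C' = max C 1"
  have C': "0 < C'" "ennreal C \<le> ennreal C'" by (auto simp: C'_def intro: ennreal_leI)
  obtain a where a: "0 < a" "a < 1" "tail \<rho>X \<rho>Y a \<le> ennreal 1" using small[of 1] by auto
  obtain K where K: "0 \<le> K" "\<And>f t. f \<in> borel_measurable I01 \<Longrightarrow> \<rho>X f \<le> ennreal C \<Longrightarrow> a \<le> t \<Longrightarrow> HJ J j f t \<le> ennreal K"
    using HJ_bounded_away[OF X a(1)] by metis
  let ?B = "ennreal C' * ennreal 1 + ennreal K * \<rho>Y (\<lambda>_. 1)"
  have "?B < top" using ri_one[OF Y] by (auto simp: ennreal_mult_less_top)
  moreover have "\<rho>Y (HJ J j f) \<le> ?B" if f [measurable]: "f \<in> borel_measurable I01" and fC: "\<rho>X f \<le> ennreal C" for f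
  proof -
    have "\<rho>Y (HJ J j f) \<le> \<rho>Y (\<lambda>t. indicator {0<..<a} t * HJ J j f t + ennreal K)"
    proof (rule ri_mono[OF Y])
      fix t :: real assume "0 < t" "t < 1"
      then show "HJ J j f t \<le> indicator {0<..<a} t * HJ J j f t + ennreal K"
        using K(2)[OF f fC, of t] by (cases "t < a") auto
    qed measurable
    also have "\<dots> \<le> \<rho>Y (\<lambda>t. indicator {0<..<a} t * HJ J j f t) + \<rho>Y (\<lambda>_. ennreal K)"
      by (intro ri_add[OF Y]) measurable
    also have "\<dots> \<le> ?B"
      unfolding ri_const[OF Y K(1)]
    proof (rule add_right_mono)
      have "\<rho>Y (\<lambda>t. indicator {0<..<a} t * HJ J j f t) \<le> ennreal C' * tail \<rho>X \<rho>Y a"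
        by (rule HJ_tail_scaled[OF X Y C'(1) f order_trans[OF fC C'(2)]])
      also have "\<dots> \<le> ennreal C' * ennreal 1" by (intro mult_left_mono a) auto
      finally show "\<rho>Y (\<lambda>t. indicator {0<..<a} t * HJ J j f t) \<le> ennreal C' * ennreal 1" .
    qed
    finally show ?thesis .
  qed
  ultimately show ?thesis by blast
qed

lemma HJ_selection:
  assumes X: "ri_norm \<rho>X" and F [measurable]: "\<And>n. F n \<in> borel_measurable I01" and C: "\<And>n. \<rho>X (F n) \<le> ennreal C"
  obtains s g where "strict_mono (s :: nat \<Rightarrow> nat)" "g \<in> borel_measurable I01" "\<And>x. 0 \<le> g x"
    "AE x in I01. (\<lambda>n. enn2real (HJ J j (F (s n)) x)) \<longlonglongrightarrow> g x"
proof -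
  let ?G = "\<lambda>n x. squash (HJ J j (F n) (max 0 x))"
  have mono: "mono (?G n)" for n
    unfolding mono_def by (intro allI impI squash_antimono antimonoD[OF HJ_antimono]) auto
  have bdd: "\<bar>?G n x\<bar> \<le> 1" for n x using squash_bounds by simp
  obtain s G where s: "strict_mono s" "mono G" "\<And>x. isCont G x \<Longrightarrow> (\<lambda>n. ?G (s n) x) \<longlonglongrightarrow> G x"
    using Helly_selection[of ?G 1, OF HJ_right_continuous[OF F] mono bdd] by metis
  \<comment> \<open>This inverts \<open>squash\<close>; the default 0 keeps \<open>g\<close>
    nonnegative where \<open>G\<close> leaves (0,1].\<close>
  define g where "g x = (if G x > 0 \<and> G x \<le> 1 then 1 / G x - 1 else 0)" for x
  have [measurable]: "G \<in> borel_measurable I01" by (intro borel_measurable_I01 borel_measurable_mono s)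
  have gm: "g \<in> borel_measurable I01" unfolding g_def by measurable
  have g0: "0 \<le> g x" for x unfolding g_def by simp
  have "{x. \<not> isCont G x} \<in> null_sets lborel"
    by (intro countable_imp_null_set_lborel mono_ctble_discont s)
  then have "AE x in lborel. x \<notin> {x. \<not> isCont G x}" by (rule AE_not_in)
  then have "AE x in lebesgue. x \<notin> {x. \<not> isCont G x}" by (rule AE_completion)
  then have "AE x in I01. isCont G x" by (subst AE_restrict_space_iff) (auto elim: eventually_mono)
  then have "AE x in I01. (\<lambda>n. enn2real (HJ J j (F (s n)) x)) \<longlonglongrightarrow> g x"
    using AE_space
  proof eventually_elim
    case (elim x)
    then have x: "0 < x" "x < 1" by auto
    obtain K where K: "0 \<le> K" "\<And>f t. f \<in> borel_measurable I01 \<Longrightarrow> \<rho>X f \<le> ennreal C \<Longrightarrow> x \<le> t \<Longrightarrow> HJ J j f t \<le> ennreal K"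
      using HJ_bounded_away[OF X x(1)] by metis
    define y where "y n = enn2real (HJ J j (F (s n)) x)" for n
    have HK: "HJ J j (F (s n)) x \<le> ennreal K" for n by (rule K(2)[OF F C order_refl])
    have y: "HJ J j (F (s n)) x = ennreal (y n)" "0 \<le> y n" "y n \<le> K" for n
      unfolding y_def using K(1) HK[of n] le_less_trans[OF HK[of n] ennreal_less_top] by (auto intro: enn2real_leI)
    have lim: "(\<lambda>n. 1 / (1 + y n)) \<longlonglongrightarrow> G x"
      using s(3)[OF elim(1)] x y by (simp add: squash_real)
    \<comment> \<open>The uniform bound \<open>K\<close> on the images at \<open>x\<close> keeps the
      limit away from 0, where inverting \<open>squash\<close> would be discontinuous.\<close>
    have "1 / (1 + K) \<le> G x"
      by (rule LIMSEQ_le_const[OF lim]) (use y K in \<open>auto intro!: exI[of _ 0] divide_left_mono mult_pos_pos add_pos_nonneg\<close>)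
    moreover have "0 < 1 / (1 + K)" using K by simp
    ultimately have G0: "0 < G x" by linarith
    have "G x \<le> 1" by (rule LIMSEQ_le_const2[OF lim]) (use y(2) in \<open>simp add: divide_le_eq add_pos_nonneg\<close>)
    have "(\<lambda>n. 1 / (1 / (1 + y n)) - 1) \<longlonglongrightarrow> 1 / G x - 1"
      by (intro tendsto_intros lim) (use G0 in simp)
    moreover have "1 / (1 / (1 + y n)) - 1 = y n" for n using y(2)[of n] by simp
    ultimately show ?case using G0 \<open>G x \<le> 1\<close> by (simp add: g_def y_def)
  qed
  then show ?thesis using that s(1) gm g0 by blast
qed

theorem HJ_compact_of_tail:
  assumes X: "ri_norm \<rho>X" and Y: "ri_norm \<rho>Y"
    and small: "\<And>e. 0 < e \<Longrightarrow> \<exists>a. 0 < a \<and> a < 1 \<and> tail \<rho>X \<rho>Y a \<le> ennreal e"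
  shows "HJ_compact J j \<rho>X \<rho>Y"
  unfolding HJ_compact_def
proof (intro conjI ballI allI impI)
  fix f assume "f \<in> ri_space \<rho>X"
  then have [measurable]: "f \<in> borel_measurable I01" and fin: "\<rho>X (\<lambda>x. ennreal \<bar>f x\<bar>) < top" by (auto simp: ri_space_def)
  let ?C = "enn2real (\<rho>X (\<lambda>x. ennreal \<bar>f x\<bar>))"
  have "\<rho>X (\<lambda>x. ennreal \<bar>f x\<bar>) \<le> ennreal ?C" using fin by simp
  moreover obtain B where B: "B < top" "\<forall>f\<in>borel_measurable I01. \<rho>X f \<le> ennreal ?C \<longrightarrow> \<rho>Y (HJ J j f) \<le> B"
    using HJ_bounded_operator[OF X Y small, of ?C] by blast
  moreover have "(\<lambda>x. ennreal \<bar>f x\<bar>) \<in> borel_measurable I01" by measurable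
  ultimately show "\<rho>Y (HJ J j (\<lambda>x. ennreal \<bar>f x\<bar>)) < \<infinity>" by (auto intro: le_less_trans)
  show "HJ J j (\<lambda>x. ennreal \<bar>f x\<bar>) \<in> borel_measurable I01" by measurable
next
  fix F :: "nat \<Rightarrow> real \<Rightarrow> real" and C :: real
  assume *: "\<forall>n. F n \<in> borel_measurable I01 \<and> \<rho>X (\<lambda>x. ennreal \<bar>F n x\<bar>) \<le> ennreal C"
  then have F [measurable]: "\<And>n. F n \<in> borel_measurable I01" by blast
  let ?F = "\<lambda>n x. ennreal \<bar>F n x\<bar>"
  have Fe [measurable]: "?F n \<in> borel_measurable I01" for n by measurable
  have FC: "\<rho>X (?F n) \<le> ennreal C" for n using * by blast
  obtain s g where s: "strict_mono (s :: nat \<Rightarrow> nat)" and g [measurable]: "g \<in> borel_measurable I01" and g0: "\<And>x. 0 \<le> g x"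
    and lim: "AE x in I01. (\<lambda>n. enn2real (HJ J j (?F (s n)) x)) \<longlonglongrightarrow> g x"
    by (rule HJ_selection[OF X Fe FC]) (rule that, assumption+)
  define y where "y n x = enn2real (HJ J j (?F (s n)) x)" for n x
  have ym [measurable]: "y n \<in> borel_measurable I01" for n unfolding y_def by measurable
  have y0: "0 \<le> y n x" for n x by (simp add: y_def)
  have fin: "\<rho>X (?F n) < top" for n using FC by (rule le_less_trans) simp
  have ye: "HJ J j (?F (s n)) x = ennreal (y n x)" if "0 < x" for n x
    unfolding y_def using HJ_finite[OF X Fe fin that] by simp
  have lim': "AE x in I01. (\<lambda>n. y n x) \<longlonglongrightarrow> g x" using lim by (simp add: y_def)
  have yY: "\<rho>Y (\<lambda>x. ennreal (y n x)) = \<rho>Y (HJ J j (?F (s n)))" for n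
    by (rule ri_cong[OF Y]) (auto simp: ye)
  obtain B where B: "B < top" "\<forall>f\<in>borel_measurable I01. \<rho>X f \<le> ennreal C \<longrightarrow> \<rho>Y (HJ J j f) \<le> B"
    using HJ_bounded_operator[OF X Y small, of C] by blast
  have "\<rho>Y (\<lambda>x. ennreal (g x)) \<le> B"
  proof (rule ri_Fatou[OF Y, where F = "\<lambda>n x. ennreal (y n x)"])
    show "AE x in I01. (\<lambda>n. ennreal (y n x)) \<longlonglongrightarrow> ennreal (g x)"
      using lim' by eventually_elim (rule tendsto_ennrealI)
    show "\<rho>Y (\<lambda>x. ennreal (y n x)) \<le> B" for n using B(2) Fe FC yY by auto
  qed measurable
  then have gY: "g \<in> ri_space \<rho>Y" using B(1) g0 by (auto simp: ri_space_def intro: le_less_trans)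
  have vf: "vanishing_fundamental \<rho>Y" by (rule vanishing_fundamental_of_tail[OF X Y small])
  have "(\<lambda>n. \<rho>Y (\<lambda>t. ennreal \<bar>y n t - g t\<bar>)) \<longlonglongrightarrow> 0"
  proof (rule ennreal_tendsto_0I)
    fix e :: real assume e: "0 < e"
    define C' where "C' = max C 1"
    have C': "0 < C'" "ennreal C \<le> ennreal C'" by (auto simp: C'_def intro: ennreal_leI)
    \<comment> \<open>Three contributions: the approximants near the origin, their limit near the
      origin, and the difference beyond \<open>a\<close>.\<close>
    define e' where "e' = e / 3"
    have e': "0 < e'" using e by (simp add: e'_def)
    obtain a where a: "0 < a" "a < 1" "tail \<rho>X \<rho>Y a \<le> ennreal (e' / C')"
      using small[of "e' / C'"] e' C' by auto
    have head: "\<rho>Y (\<lambda>t. indicator {0<..<a} t * ennreal (y n t)) \<le> ennreal e'" for n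
    proof -
      have "\<rho>Y (\<lambda>t. indicator {0<..<a} t * ennreal (y n t)) = \<rho>Y (\<lambda>t. indicator {0<..<a} t * HJ J j (?F (s n)) t)"
        by (rule ri_cong[OF Y]) (auto simp: ye)
      also have "\<dots> \<le> ennreal C' * tail \<rho>X \<rho>Y a"
        using order_trans[OF FC C'(2)] by (intro HJ_tail_scaled[OF X Y C'(1)]) auto
      also have "\<dots> \<le> ennreal C' * ennreal (e' / C')" by (intro mult_left_mono a) auto
      also have "\<dots> = ennreal e'" using C' e' by (simp add: ennreal_mult[symmetric])
      finally show ?thesis .
    qed
    have headg: "\<rho>Y (\<lambda>t. indicator {0<..<a} t * ennreal (g t)) \<le> ennreal e'"
    proof (rule ri_Fatou[OF Y _ _ _ head])
      show "AE x in I01. (\<lambda>n. indicator {0<..<a} x * ennreal (y n x)) \<longlonglongrightarrow> indicator {0<..<a} x * ennreal (g x)"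
        using lim'
      proof eventually_elim
        case (elim x)
        then have "(\<lambda>n. ennreal (y n x)) \<longlonglongrightarrow> ennreal (g x)" by (rule tendsto_ennrealI)
        then show ?case by (auto simp: indicator_def)
      qed
    qed measurable
    obtain K where K: "0 \<le> K" "\<And>f t. f \<in> borel_measurable I01 \<Longrightarrow> \<rho>X f \<le> ennreal C \<Longrightarrow> a \<le> t \<Longrightarrow> HJ J j f t \<le> ennreal K"
      by (rule HJ_bounded_away[OF X a(1)]) (rule that, assumption+)
    \<comment> \<open>Dominated convergence was proved for a bound at every point, while
      \<open>g\<close> is known to be at most \<open>K\<close> only almost everywhere beyond
      \<open>a\<close>. The minimum enforces the bound and changes the difference only on a null
      set.\<close>
    let ?u = "\<lambda>n t. indicator {a..} t * ennreal (min K \<bar>y n t - g t\<bar>)"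
    have "(\<lambda>n. \<rho>Y (?u n)) \<longlonglongrightarrow> 0"
    proof (rule ri_dominated_convergence[OF Y vf])
      show "?u n x \<le> ennreal K" for n x by (auto simp: indicator_def intro: ennreal_leI)
      show "AE x in I01. (\<lambda>n. ?u n x) \<longlonglongrightarrow> 0"
        using lim'
      proof eventually_elim
        case (elim x)
        have "(\<lambda>n. min K \<bar>y n x - g x\<bar>) \<longlonglongrightarrow> min K \<bar>g x - g x\<bar>" by (intro tendsto_intros elim)
        then have "(\<lambda>n. ennreal (min K \<bar>y n x - g x\<bar>)) \<longlonglongrightarrow> ennreal (min K \<bar>g x - g x\<bar>)" by (rule tendsto_ennrealI)
        then show ?case using K(1) by (auto simp: indicator_def)
      qed
    qed measurable
    then have "\<forall>\<^sub>F n in sequentially. \<rho>Y (?u n) < ennreal e'" using e' by (auto intro: order_tendstoD)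
    then show "\<forall>\<^sub>F n in sequentially. \<rho>Y (\<lambda>t. ennreal \<bar>y n t - g t\<bar>) \<le> ennreal e"
    proof eventually_elim
      case (elim n)
      let ?i = "indicator {0<..<a} :: real \<Rightarrow> ennreal"
      have "\<rho>Y (\<lambda>t. ennreal \<bar>y n t - g t\<bar>) \<le> \<rho>Y (\<lambda>t. (?i t * ennreal (y n t) + ?i t * ennreal (g t)) + ?u n t)"
      proof (rule ri_mono_AE[OF Y])
        show "AE t in I01. ennreal \<bar>y n t - g t\<bar> \<le> (?i t * ennreal (y n t) + ?i t * ennreal (g t)) + ?u n t"
          using lim' AE_space
        proof eventually_elim
          case (elim t)
          then have t: "0 < t" by simp
          show ?case
          proof (cases "t < a")
            case True
            have "ennreal \<bar>y n t - g t\<bar> \<le> ennreal (y n t + g t)" using y0[of n t] g0[of t] by (intro ennreal_leI) linarith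
            then show ?thesis using True t y0 g0 by simp
          next
            case False
            have yK: "y k t \<le> K" for k
              using K(2)[OF Fe FC, of t "s k"] False ye[OF t, of k] K(1) by simp
            moreover have "g t \<le> K" by (rule LIMSEQ_le_const2[OF elim(1)]) (use yK in auto)
            ultimately have "\<bar>y n t - g t\<bar> \<le> K" using y0[of n t] g0[of t] yK[of n] by linarith
            then show ?thesis using False by (simp add: min_absorb2)
          qed
        qed
      qed measurable
      also have "\<dots> \<le> \<rho>Y (\<lambda>t. ?i t * ennreal (y n t) + ?i t * ennreal (g t)) + \<rho>Y (?u n)"
        by (rule ri_add[OF Y]) measurable
      also have "\<dots> \<le> (\<rho>Y (\<lambda>t. ?i t * ennreal (y n t)) + \<rho>Y (\<lambda>t. ?i t * ennreal (g t))) + \<rho>Y (?u n)"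
        by (intro add_right_mono ri_add[OF Y]) measurable
      also have "\<dots> \<le> (ennreal e' + ennreal e') + ennreal e'"
        using elim by (intro add_mono head headg) simp
      also have "\<dots> = ennreal e" using e' by (simp add: ennreal_plus[symmetric] e'_def del: ennreal_plus)
      finally show ?case .
    qed
  qed
  then show "\<exists>r g. strict_mono r \<and> g \<in> ri_space \<rho>Y \<and>
      (\<lambda>n. \<rho>Y (\<lambda>t. ennreal \<bar>enn2real (HJ J j (\<lambda>x. ennreal \<bar>F (r n) x\<bar>) t) - g t\<bar>)) \<longlonglongrightarrow> 0"
    using s gY unfolding y_def by blast
qed

end

section \<open>Compactness implies smallness near the origin\<close>

context hardy_kernel
begin

text \<open>Integrating only over \<open>s\<close> between \<open>b'\<close> and \<open>b\<close>
  suffices: there the kernel factor is at least \<open>IJ J t b'\<close>, and the remaining weight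
  integrates to \<open>IJ J b' b\<close>.\<close>

lemma HJ_indicator_ge:
  assumes t: "0 \<le> t" "t \<le> b'" "b' < b" "b \<le> 1"
  shows "ennreal (1 / fact (j - 1)) * (IJ J t b' ^ (j - 1) * IJ J b' b) \<le> HJ J j (\<lambda>s. indicator {0<..<b} s) t"
  unfolding HJ_eq[OF t(1)]
proof (rule mult_left_mono)
  have "IJ J t b' ^ (j - 1) * IJ J b' b = IJ J t b' ^ (j - 1) * (\<integral>\<^sup>+s. (if b' < s \<and> s < b then w s else 0) \<partial>I01)"
    using t by (simp add: IJ_eq)
  also have "\<dots> = (\<integral>\<^sup>+s. IJ J t b' ^ (j - 1) * (if b' < s \<and> s < b then w s else 0) \<partial>I01)"
    by (rule nn_integral_cmult[symmetric]) measurable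
  also have "\<dots> \<le> (\<integral>\<^sup>+s. (if t < s then indicator {0<..<b} s * w s * IJ J t s ^ (j - 1) else 0) \<partial>I01)"
  proof (rule nn_integral_mono)
    fix s assume s: "s \<in> space I01"
    show "IJ J t b' ^ (j - 1) * (if b' < s \<and> s < b then w s else 0) \<le>
        (if t < s then indicator {0<..<b} s * w s * IJ J t s ^ (j - 1) else 0)"
    proof (cases "b' < s \<and> s < b")
      case True
      then have "IJ J t b' ^ (j - 1) * w s \<le> IJ J t s ^ (j - 1) * w s"
        by (intro mult_right_mono power_mono IJ_mono) auto
      then show ?thesis using True s t by (simp add: mult.commute)
    next
      case False
      then show ?thesis by (auto simp del: not_less)
    qed
  qed
  finally show "IJ J t b' ^ (j - 1) * IJ J b' b \<le>
    (\<integral>\<^sup>+s. (if t < s then indicator {0<..<b} s * w s * IJ J t s ^ (j - 1) else 0) \<partial>I01)" .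
qed simp

text \<open>The integral of \<open>1 / J\<close> over (b/2,1) is finite, so the divergence sits at
  the origin.\<close>

lemma IJ_infinite:
  assumes inf: "IJ J 0 1 = top" and b: "0 < b" "b \<le> 1"
  shows "IJ J 0 b = top"
proof -
  have "top \<le> IJ J 0 b + IJ J (b / 2) 1" using IJ_split[of 0 1 "b / 2" b] b inf by simp
  moreover have "IJ J (b / 2) 1 < top" using IJ_le[of "b / 2" "b / 2" 1] b by (auto intro: le_less_trans)
  ultimately show ?thesis by (auto simp: top_unique ennreal_add_eq_top)
qed

lemma IJ_large:
  assumes inf: "IJ J 0 1 = top" and b: "0 < b" "b \<le> 1" and L: "L < top"
  obtains a where "0 < a" "a < b" "L \<le> IJ J a b"
proof -
  define T where "T n = 1 / real (Suc n)" for n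
  have "T \<longlonglongrightarrow> 0" unfolding T_def by (intro LIMSEQ_Suc lim_const_over_n)
  moreover have "decseq T" unfolding decseq_def T_def by (auto intro!: frac_le)
  moreover have T0: "0 < T n" for n by (simp add: T_def)
  ultimately have "(SUP n. IJ J (T n) b) = IJ J 0 b" using b by (intro IJ_SUP) auto
  then have "L < (SUP n. IJ J (T n) b)" unfolding IJ_infinite[OF inf b] using L by (simp only:)
  then obtain n where n: "L < IJ J (T n) b" by (auto simp: less_SUP_iff)
  have "T n < b"
  proof (rule ccontr)
    assume "\<not> T n < b"
    then have "{T n<..<b} = {}" by auto
    then have "IJ J (T n) b = 0" unfolding IJ_def by simp
    then show False using n by simp
  qed
  then show ?thesis using that[of "T n"] T0 n by (simp add: less_imp_le)
qed

lemma vanishing_fundamental_of_compact: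
  assumes X: "ri_norm \<rho>X" and Y: "ri_norm \<rho>Y" and cpt: "HJ_compact J j \<rho>X \<rho>Y"
    and alt: "ri_space \<rho>Y \<noteq> Linf_space \<or> IJ J 0 1 = top"
  shows "vanishing_fundamental \<rho>Y"
proof (cases "ri_space \<rho>Y = Linf_space")
  case False
  then show ?thesis by (rule vanishing_fundamental_if_neq_Linf[OF Y])
next
  case True
  then have inf: "IJ J 0 1 = top" using alt by blast
  have "(\<lambda>_. 1) \<in> ri_space \<rho>X" using ri_one[OF X] by (simp add: ri_space_def)
  then have fin: "\<rho>Y (HJ J j (\<lambda>_. 1)) < top"
    using cpt unfolding HJ_compact_def by fastforce
  have fin1: "HJ J j (\<lambda>_. 1) t < top" if "0 < t" for t
    using ri_one[OF X] that by (intro HJ_finite[OF X]) auto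
  let ?y = "\<lambda>t. enn2real (HJ J j (\<lambda>_. 1) t)"
  have "\<rho>Y (\<lambda>t. ennreal \<bar>?y t\<bar>) = \<rho>Y (HJ J j (\<lambda>_. 1))"
    using fin1 by (intro ri_cong[OF Y]) auto
  then have "?y \<in> ri_space \<rho>Y" using fin by (simp add: ri_space_def)
  then obtain C where C: "AE t in I01. \<bar>?y t\<bar> \<le> C" using True by (auto simp: Linf_space_def)
  define C' where "C' = max C 0 + 1"
  \<comment> \<open>The interval (b,1) supplies the size, with the factorial cancelling the constant
    in \<open>HJ\<close>. The next choice makes \<open>IJ J t b\<close> at least 1 for
    \<open>t < a\<close>, so its power cannot spoil the bound.\<close>
  obtain b where b: "0 < b" "b < 1" "ennreal (fact (j - 1) * C') \<le> IJ J b 1"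
    using IJ_large[OF inf, of 1 "ennreal (fact (j - 1) * C')"] by auto
  obtain a where a: "0 < a" "a < b" "1 \<le> IJ J a b"
    using IJ_large[OF inf, of b 1] b by auto
  have big: "C < ?y t" if t: "0 < t" "t < a" for t
  proof -
    have I: "1 \<le> IJ J t b" using a(3) IJ_mono[of t a b b] t by (auto intro: order_trans)
    have "ennreal C' = ennreal (1 / fact (j - 1)) * (1 * ennreal (fact (j - 1) * C'))"
      by (simp add: ennreal_mult[symmetric] C'_def)
    also have "\<dots> \<le> ennreal (1 / fact (j - 1)) * (IJ J t b ^ (j - 1) * IJ J b 1)"
      using I b by (intro mult_left_mono mult_mono one_le_power) auto
    also have "\<dots> \<le> HJ J j (\<lambda>s. indicator {0<..<1} s) t"
      using t a b by (intro HJ_indicator_ge) auto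
    also have "\<dots> \<le> HJ J j (\<lambda>_. 1) t"
      using t by (intro HJ_mono AE_I2) (auto simp: indicator_def)
    finally have "ennreal C' \<le> ennreal (?y t)" using fin1[OF t(1)] by simp
    then have "C' \<le> ?y t" by (rule ennreal_le_iff[THEN iffD1, rotated]) simp
    then show ?thesis by (simp add: C'_def)
  qed
  have AEa: "AE t in I01. \<not> t < a"
    using C AE_space by eventually_elim (use big in force)
  have ma: "{x \<in> space I01. \<not> \<not> x < a} \<in> sets I01" by measurable
  have "emeasure I01 {x \<in> space I01. \<not> \<not> x < a} = 0" by (rule AE_iff_measurable[OF ma refl, THEN iffD1, OF AEa])
  moreover have "{x \<in> space I01. \<not> \<not> x < a} = {0<..<a}" using a b by auto
  ultimately show ?thesis using a b by (simp add: emeasure_I01_interval)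
qed

lemma HJ_concentrated_small:
  assumes X: "ri_norm \<rho>X" and Y: "ri_norm \<rho>Y" and cpt: "HJ_compact J j \<rho>X \<rho>Y" and e: "0 < e"
  obtains b where "0 < b" "b < 1"
    "\<And>f. f \<in> unit_ball \<rho>X \<Longrightarrow> \<rho>Y (HJ J j (\<lambda>x. indicator {0<..<b} x * ennreal \<bar>f x\<bar>)) \<le> ennreal e"
proof (rule ccontr)
  assume neg: "\<not> thesis"
  \<comment> \<open>Any sequence in (0,1) tending to 0 would do; the added 2 keeps
    \<open>b 0\<close> below 1.\<close>
  define b where "b n = 1 / (real n + 2)" for n :: nat
  have b: "0 < b n" "b n < 1" for n by (auto simp: b_def)
  have "\<exists>f \<in> unit_ball \<rho>X. ennreal e < \<rho>Y (HJ J j (\<lambda>x. indicator {0<..<b n} x * ennreal \<bar>f x\<bar>))" for n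
    using neg that b by (meson not_le)
  then obtain f where f: "\<And>n. f n \<in> unit_ball \<rho>X"
    "\<And>n. ennreal e < \<rho>Y (HJ J j (\<lambda>x. indicator {0<..<b n} x * ennreal \<bar>f n x\<bar>))" by metis
  have fm [measurable]: "f n \<in> borel_measurable I01" and f1: "\<rho>X (\<lambda>x. ennreal \<bar>f n x\<bar>) \<le> 1" for n
    using f(1)[of n] by (auto simp: unit_ball_def)
  define F where "F n x = indicator {0<..<b n} x * f n x" for n x
  have [measurable]: "(\<lambda>x. indicator {0<..<b n} x :: real) \<in> borel_measurable I01" for n
    by (intro borel_measurable_I01) measurable
  have Fm [measurable]: "F n \<in> borel_measurable I01" for n unfolding F_def by measurable
  have Fe: "(\<lambda>x. ennreal \<bar>F n x\<bar>) = (\<lambda>x. indicator {0<..<b n} x * ennreal \<bar>f n x\<bar>)" for n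
    by (auto simp: F_def indicator_def)
  have F1: "\<rho>X (\<lambda>x. ennreal \<bar>F n x\<bar>) \<le> ennreal 1" for n
  proof -
    have "\<rho>X (\<lambda>x. ennreal \<bar>F n x\<bar>) \<le> \<rho>X (\<lambda>x. ennreal \<bar>f n x\<bar>)"
      by (intro ri_mono[OF X]) (auto simp: F_def indicator_def)
    then show ?thesis using f1[of n] by simp
  qed
  obtain r g where r: "strict_mono r" and g: "g \<in> ri_space \<rho>Y" and
    lim: "(\<lambda>n. \<rho>Y (\<lambda>t. ennreal \<bar>enn2real (HJ J j (\<lambda>x. ennreal \<bar>F (r n) x\<bar>) t) - g t\<bar>)) \<longlonglongrightarrow> 0"
    using cpt Fm F1 unfolding HJ_compact_def by blast
  have gm [measurable]: "g \<in> borel_measurable I01" using g by (simp add: ri_space_def)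
  define y where "y n t = enn2real (HJ J j (\<lambda>x. ennreal \<bar>F (r n) x\<bar>) t)" for n t
  have ym [measurable]: "y n \<in> borel_measurable I01" for n unfolding y_def by measurable
  have ylim: "(\<lambda>n. \<rho>Y (\<lambda>t. ennreal \<bar>y n t - g t\<bar>)) \<longlonglongrightarrow> 0" using lim by (simp add: y_def)
  have zero: "HJ J j (\<lambda>x. ennreal \<bar>F n x\<bar>) t = 0" if "b n \<le> t" for n t
  proof -
    have "0 \<le> t" using that b(1)[of n] by simp
    have "(\<integral>\<^sup>+s. (if t < s then ennreal \<bar>F n s\<bar> * w s * IJ J t s ^ (j - 1) else 0) \<partial>I01) = (\<integral>\<^sup>+s. 0 \<partial>I01)"
      using that by (intro nn_integral_cong) (auto simp: F_def indicator_def)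
    then show ?thesis by (simp add: HJ_eq[OF \<open>0 \<le> t\<close>])
  qed
  \<comment> \<open>At a fixed \<open>t\<close> the images vanish from some index on, so the
    differences there converge to \<open>\<bar>g t\<bar>\<close>; the Fatou property then bounds the
    norm of \<open>g\<close> by every \<open>\<epsilon>\<close>.\<close>
  have "\<rho>Y (\<lambda>t. ennreal \<bar>g t\<bar>) = 0"
  proof (rule ennreal_le_epsilon0)
    fix \<epsilon> :: real assume "0 < \<epsilon>"
    then have "\<forall>\<^sub>F n in sequentially. \<rho>Y (\<lambda>t. ennreal \<bar>y n t - g t\<bar>) < ennreal \<epsilon>"
      using ylim by (auto intro: order_tendstoD)
    then obtain n0 where n0: "\<And>n. n \<ge> n0 \<Longrightarrow> \<rho>Y (\<lambda>t. ennreal \<bar>y n t - g t\<bar>) < ennreal \<epsilon>"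
      by (auto simp: eventually_sequentially)
    show "\<rho>Y (\<lambda>t. ennreal \<bar>g t\<bar>) \<le> ennreal \<epsilon>"
    proof (rule ri_Fatou[OF Y, where F = "\<lambda>n t. ennreal \<bar>y (n + n0) t - g t\<bar>"])
      show "\<rho>Y (\<lambda>t. ennreal \<bar>y (n + n0) t - g t\<bar>) \<le> ennreal \<epsilon>" for n using n0[of "n + n0"] by simp
      show "AE t in I01. (\<lambda>n. ennreal \<bar>y (n + n0) t - g t\<bar>) \<longlonglongrightarrow> ennreal \<bar>g t\<bar>"
      proof (rule AE_I2)
        fix t assume "t \<in> space I01"
        then have t: "0 < t" by simp
        then obtain N :: nat where N: "1 / t < real N" using reals_Archimedean2 by blast
        have "y (n + n0) t = 0" if "N \<le> n" for n
        proof -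
          have "n + n0 \<le> r (n + n0)" using r by (rule seq_suble)
          then have "real N \<le> real (r (n + n0)) + 2" using that by simp
          then have "1 / t < real (r (n + n0)) + 2" using N by linarith
          then have "b (r (n + n0)) \<le> t" using t by (simp add: b_def field_simps)
          then show ?thesis by (simp add: y_def zero)
        qed
        then have "\<forall>\<^sub>F n in sequentially. ennreal \<bar>y (n + n0) t - g t\<bar> = ennreal \<bar>g t\<bar>"
          unfolding eventually_sequentially by (intro exI[of _ N]) simp
        then show "(\<lambda>n. ennreal \<bar>y (n + n0) t - g t\<bar>) \<longlonglongrightarrow> ennreal \<bar>g t\<bar>" by (rule tendsto_eventually)
      qed
    qed measurable
  qed
  then have "AE t in I01. ennreal \<bar>g t\<bar> = 0" using ri_zero_iff[OF Y, of "\<lambda>t. ennreal \<bar>g t\<bar>"] by simp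
  then have g0: "AE t in I01. g t = 0" by eventually_elim simp
  have "\<rho>Y (\<lambda>t. ennreal \<bar>y n t - g t\<bar>) = \<rho>Y (HJ J j (\<lambda>x. ennreal \<bar>F (r n) x\<bar>))" for n
  proof (rule ri_cong_AE[OF Y])
    show "AE t in I01. ennreal \<bar>y n t - g t\<bar> = HJ J j (\<lambda>x. ennreal \<bar>F (r n) x\<bar>) t"
      using g0 AE_space
    proof eventually_elim
      case (elim t)
      have "HJ J j (\<lambda>x. ennreal \<bar>F (r n) x\<bar>) t < top"
        using elim F1[of "r n"] by (intro HJ_finite[OF X]) (auto intro: le_less_trans)
      then show ?case using elim by (simp add: y_def)
    qed
  qed measurable
  then have "ennreal e < \<rho>Y (\<lambda>t. ennreal \<bar>y n t - g t\<bar>)" for n using f(2)[of "r n"] by (simp add: Fe)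
  moreover have "\<forall>\<^sub>F n in sequentially. \<rho>Y (\<lambda>t. ennreal \<bar>y n t - g t\<bar>) < ennreal e"
    using ylim e by (auto intro: order_tendstoD)
  ultimately show False by (auto simp: eventually_sequentially dest: less_asym)
qed

lemma IJ_power_small:
  assumes X: "ri_norm \<rho>X" and Y: "ri_norm \<rho>Y" and cpt: "HJ_compact J j \<rho>X \<rho>Y"
    and vf: "vanishing_fundamental \<rho>Y" and e: "0 < e"
  obtains a where "0 < a" "a < 1" "\<rho>Y (\<lambda>t. indicator {0<..<a} t * IJ J t 1 ^ (j - 1)) \<le> ennreal e"
proof (cases "IJ J 0 1 = top")
  case False
  define L where "L = IJ J 0 1 ^ (j - 1)"
  have "L < top" using False by (simp add: L_def power_less_top_ennreal less_top)
  then obtain l where l: "L = ennreal l" "0 \<le> l" by (cases L) auto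
  obtain a where a: "0 < a" "a < 1" "\<rho>Y (\<lambda>x. indicator {0<..<a} x) \<le> ennreal (e / (l + 1))"
    using vf e l unfolding vanishing_fundamental_def by (metis add_nonneg_pos divide_pos_pos zero_less_one)
  have [measurable]: "(\<lambda>t. IJ J t 1) \<in> borel_measurable I01" by (rule IJ_measurable) auto
  have "\<rho>Y (\<lambda>t. indicator {0<..<a} t * IJ J t 1 ^ (j - 1)) \<le> \<rho>Y (\<lambda>t. ennreal l * indicator {0<..<a} t)"
  proof (rule ri_mono[OF Y])
    fix t :: real assume "0 < t"
    then have "IJ J t 1 ^ (j - 1) \<le> ennreal l" unfolding l(1)[symmetric] L_def by (intro power_mono IJ_mono) auto
    then show "indicator {0<..<a} t * IJ J t 1 ^ (j - 1) \<le> ennreal l * indicator {0<..<a} t"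
      by (auto simp: indicator_def)
  qed measurable
  also have "\<dots> = ennreal l * \<rho>Y (\<lambda>t. indicator {0<..<a} t)" using l by (intro ri_scale[OF Y]) auto
  also have "\<dots> \<le> ennreal l * ennreal (e / (l + 1))" by (intro mult_left_mono a) auto
  also have "\<dots> = ennreal (l * (e / (l + 1)))" using l e by (intro ennreal_mult[symmetric]) auto
  also have "\<dots> \<le> ennreal e" using l e by (intro ennreal_leI) (simp add: field_simps)
  finally show ?thesis using that a by blast
next
  case True
  define r where "r = enn2real (\<rho>X (\<lambda>_. 1))"
  have r: "\<rho>X (\<lambda>_. 1) = ennreal r" "0 < r"
    using ri_one[OF X] ri_one_pos[OF X] by (auto simp: r_def enn2real_positive_iff)
  let ?f = "\<lambda>_::real. 1 / r"
  have f1: "?f \<in> unit_ball \<rho>X"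
    using ri_const[OF X, of "1 / r"] r by (simp add: unit_ball_def ennreal_mult[symmetric])
  \<comment> \<open>The factors undo, in turn, the normalisation \<open>1 / r\<close> of
    \<open>?f\<close>, the doubling of \<open>IJ J t b'\<close> raised to the power
    \<open>j - 1\<close>, and the factorial in \<open>HJ\<close>.\<close>
  define M where "M = r * (2 ^ (j - 1) * fact (j - 1))"
  have M: "0 < M" using r by (simp add: M_def)
  obtain b where b: "0 < b" "b < 1"
    "\<And>f. f \<in> unit_ball \<rho>X \<Longrightarrow> \<rho>Y (HJ J j (\<lambda>x. indicator {0<..<b} x * ennreal \<bar>f x\<bar>)) \<le> ennreal (e / M)"
    by (rule HJ_concentrated_small[OF X Y cpt divide_pos_pos[OF e M]]) (rule that, assumption+)
  obtain b' where b': "0 < b'" "b' < b" "1 \<le> IJ J b' b"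
    using IJ_large[OF True, of b 1] b by auto
  have "IJ J (b' / 2) 1 < top" using IJ_le[of "b' / 2" "b' / 2" 1] b' by (auto intro: le_less_trans)
  \<comment> \<open>For \<open>t < a\<close> the mass of \<open>1 / J\<close> on (t,b') exceeds its
    mass on (b'/2,1), so \<open>IJ J t 1\<close> is at most twice \<open>IJ J t b'\<close>, which
    the image of a function living on (0,b) can dominate.\<close>
  then obtain a where a: "0 < a" "a < b'" "IJ J (b' / 2) 1 \<le> IJ J a b'"
    using IJ_large[OF True, of b' "IJ J (b' / 2) 1"] b b' by auto
  let ?H = "HJ J j (\<lambda>x. indicator {0<..<b} x * ennreal \<bar>?f x\<bar>)"
  have [measurable]: "(\<lambda>t. IJ J t 1) \<in> borel_measurable I01" by (rule IJ_measurable) auto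
  have "\<rho>Y (\<lambda>t. indicator {0<..<a} t * IJ J t 1 ^ (j - 1)) \<le> \<rho>Y (\<lambda>t. ennreal M * ?H t)"
  proof (rule ri_mono[OF Y])
    fix t :: real assume t: "0 < t" "t < 1"
    show "indicator {0<..<a} t * IJ J t 1 ^ (j - 1) \<le> ennreal M * ?H t"
    proof (cases "t < a")
      case True
      have "IJ J t 1 \<le> IJ J t b' + IJ J (b' / 2) 1" using t b b' by (intro IJ_split) auto
      also have "IJ J (b' / 2) 1 \<le> IJ J t b'" using a(3) IJ_mono[of t a b' b'] True by (auto intro: order_trans)
      finally have "IJ J t 1 \<le> 2 * IJ J t b'" by (simp add: mult_2 add_left_mono)
      then have "IJ J t 1 ^ (j - 1) \<le> (2 * IJ J t b') ^ (j - 1)" by (intro power_mono) auto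
      also have "\<dots> = 2 ^ (j - 1) * (IJ J t b' ^ (j - 1) * 1)" by (simp add: power_mult_distrib)
      also have "\<dots> \<le> 2 ^ (j - 1) * (IJ J t b' ^ (j - 1) * IJ J b' b)" by (intro mult_left_mono b') auto
      also have "\<dots> = ennreal (2 ^ (j - 1) * fact (j - 1)) * (ennreal (1 / fact (j - 1)) * (IJ J t b' ^ (j - 1) * IJ J b' b))"
      proof -
        have "ennreal (2 ^ (j - 1) * fact (j - 1)) * ennreal (1 / fact (j - 1)) = 2 ^ (j - 1)"
          by (simp add: ennreal_mult[symmetric] ennreal_power[symmetric])
        then show ?thesis by (simp only: mult.assoc[symmetric])
      qed
      also have "\<dots> \<le> ennreal (2 ^ (j - 1) * fact (j - 1)) * HJ J j (\<lambda>s. indicator {0<..<b} s) t"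
        using t True a b b' by (intro mult_left_mono HJ_indicator_ge) auto
      also have "HJ J j (\<lambda>s. indicator {0<..<b} s) t = ennreal r * ?H t"
      proof -
        have "?H t = HJ J j (\<lambda>x. ennreal (1 / r) * indicator {0<..<b} x) t" using r by (simp add: mult.commute)
        also have "\<dots> = ennreal (1 / r) * HJ J j (\<lambda>x. indicator {0<..<b} x) t" using t by (intro HJ_scale) auto
        finally show ?thesis using r by (simp add: mult.assoc[symmetric] ennreal_mult[symmetric])
      qed
      also have "ennreal (2 ^ (j - 1) * fact (j - 1)) * (ennreal r * ?H t) = ennreal M * ?H t"
      proof -
        have "ennreal M = ennreal (2 ^ (j - 1) * fact (j - 1)) * ennreal r"
          unfolding M_def using r by (subst ennreal_mult) (auto simp: mult.commute)
        then show ?thesis by (simp only: mult.assoc)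
      qed
      finally show ?thesis using True t by simp
    qed simp
  qed measurable
  also have "\<dots> = ennreal M * \<rho>Y ?H" using M by (intro ri_scale[OF Y]) auto
  also have "\<dots> \<le> ennreal M * ennreal (e / M)" by (intro mult_left_mono b(3)[OF f1]) auto
  also have "\<dots> = ennreal e" using M e by (simp add: ennreal_mult[symmetric])
  finally show ?thesis using that a b b' by auto
qed

text \<open>On the support [b,1) the density is at most \<open>1 / (c * b)\<close>, while extending
  \<open>IJ J t s\<close> to \<open>IJ J t 1\<close> makes the kernel independent of
  \<open>s\<close>. All dependence on \<open>f\<close> is then in its L1 norm.\<close>

lemma HJ_away_le:
  assumes b: "0 < b" and t: "0 < t" and f [measurable]: "f \<in> borel_measurable I01"
  shows "HJ J j (\<lambda>x. indicator {b..} x * f x) t \<le> (ennreal (1 / (c * b)) * (\<integral>\<^sup>+x. f x \<partial>I01)) * IJ J t 1 ^ (j - 1)"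
proof -
  let ?D = "ennreal (1 / (c * b)) * IJ J t 1 ^ (j - 1)"
  have "HJ J j (\<lambda>x. indicator {b..} x * f x) t \<le>
      1 * (\<integral>\<^sup>+s. (if t < s then indicator {b..} s * f s * w s * IJ J t s ^ (j - 1) else 0) \<partial>I01)"
    unfolding HJ_eq[OF less_imp_le[OF t]] by (intro mult_right_mono inv_fact_le_1) simp
  also have "\<dots> \<le> (\<integral>\<^sup>+s. ?D * f s \<partial>I01)"
    unfolding mult_1
  proof (rule nn_integral_mono)
    fix s assume s: "s \<in> space I01"
    show "(if t < s then indicator {b..} s * f s * w s * IJ J t s ^ (j - 1) else 0) \<le> ?D * f s"
    proof (cases "t < s \<and> b \<le> s")
      case True
      have "f s * w s * IJ J t s ^ (j - 1) \<le> f s * ennreal (1 / (c * b)) * IJ J t 1 ^ (j - 1)"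
        using True s b by (intro mult_mono mult_left_mono power_mono w_le IJ_mono) auto
      then show ?thesis using True by (simp add: mult_ac)
    qed (auto simp: indicator_def)
  qed
  also have "\<dots> = ?D * (\<integral>\<^sup>+x. f x \<partial>I01)" by (rule nn_integral_cmult) measurable
  finally show ?thesis by (simp add: mult_ac)
qed

theorem tail_of_HJ_compact:
  assumes X: "ri_norm \<rho>X" and Y: "ri_norm \<rho>Y" and cpt: "HJ_compact J j \<rho>X \<rho>Y"
    and alt: "ri_space \<rho>Y \<noteq> Linf_space \<or> IJ J 0 1 = top" and e: "0 < e"
  shows "\<exists>a. 0 < a \<and> a < 1 \<and> tail \<rho>X \<rho>Y a \<le> ennreal e"
proof -
  have vf: "vanishing_fundamental \<rho>Y" by (rule vanishing_fundamental_of_compact[OF X Y cpt alt])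
  have e2: "0 < e / 2" using e by simp
  obtain L where L: "0 < L" "\<And>f. f \<in> borel_measurable I01 \<Longrightarrow> (\<integral>\<^sup>+x. f x \<partial>I01) \<le> ennreal L * \<rho>X f"
    using ri_L1[OF X] by blast
  obtain b where b: "0 < b" "b < 1"
    "\<And>f. f \<in> unit_ball \<rho>X \<Longrightarrow> \<rho>Y (HJ J j (\<lambda>x. indicator {0<..<b} x * ennreal \<bar>f x\<bar>)) \<le> ennreal (e / 2)"
    by (rule HJ_concentrated_small[OF X Y cpt e2]) (rule that, assumption+)
  \<comment> \<open>The bound \<open>1 / (c * b)\<close> on the density times the bound
    \<open>L\<close> on the L1 norms over the unit ball of \<open>X\<close>.\<close>
  define D where "D = 1 / (c * b) * L"
  have D: "0 < D" using c_pos b L by (simp add: D_def)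
  obtain a where a: "0 < a" "a < 1" "\<rho>Y (\<lambda>t. indicator {0<..<a} t * IJ J t 1 ^ (j - 1)) \<le> ennreal (e / 2 / D)"
    by (rule IJ_power_small[OF X Y cpt vf divide_pos_pos[OF e2 D]]) (rule that, assumption+)
  have [measurable]: "(\<lambda>t. IJ J t 1) \<in> borel_measurable I01" by (rule IJ_measurable) auto
  have "tail \<rho>X \<rho>Y a \<le> ennreal e"
    unfolding tail_def
  proof (rule SUP_least)
    fix f assume fb: "f \<in> unit_ball \<rho>X"
    then have [measurable]: "f \<in> borel_measurable I01" and f1: "\<rho>X (\<lambda>x. ennreal \<bar>f x\<bar>) \<le> 1"
      by (auto simp: unit_ball_def)
    let ?f = "\<lambda>x. ennreal \<bar>f x\<bar>"
    let ?H1 = "HJ J j (\<lambda>x. indicator {0<..<b} x * ?f x)" and ?H2 = "HJ J j (\<lambda>x. indicator {b..} x * ?f x)"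
    have int: "(\<integral>\<^sup>+x. ?f x \<partial>I01) \<le> ennreal L"
    proof -
      have "(\<integral>\<^sup>+x. ?f x \<partial>I01) \<le> ennreal L * \<rho>X ?f" by (rule L) measurable
      also have "\<dots> \<le> ennreal L * 1" by (intro mult_left_mono f1) simp
      finally show ?thesis by simp
    qed
    have "\<rho>Y (\<lambda>t. indicator {0<..<a} t * HJ J j ?f t) \<le>
        \<rho>Y (\<lambda>t. ?H1 t + ennreal D * (indicator {0<..<a} t * IJ J t 1 ^ (j - 1)))"
    proof (rule ri_mono[OF Y])
      fix t :: real assume t: "0 < t" "t < 1"
      have "HJ J j ?f t = HJ J j (\<lambda>x. indicator {0<..<b} x * ?f x + indicator {b..} x * ?f x) t"
        using t by (intro HJ_cong_AE AE_I2) (auto simp: indicator_def)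
      also have "\<dots> = ?H1 t + ?H2 t" using t by (intro HJ_add) auto
      also have "?H2 t \<le> (ennreal (1 / (c * b)) * (\<integral>\<^sup>+x. ?f x \<partial>I01)) * IJ J t 1 ^ (j - 1)"
        by (rule HJ_away_le[OF b(1) t(1)]) measurable
      also have "\<dots> \<le> (ennreal (1 / (c * b)) * ennreal L) * IJ J t 1 ^ (j - 1)"
        by (intro mult_right_mono mult_left_mono int) auto
      also have "\<dots> = ennreal D * IJ J t 1 ^ (j - 1)"
        unfolding D_def using L c_pos b by (subst ennreal_mult) auto
      finally have "HJ J j ?f t \<le> ?H1 t + ennreal D * IJ J t 1 ^ (j - 1)" by (simp add: add_left_mono)
      then show "indicator {0<..<a} t * HJ J j ?f t \<le> ?H1 t + ennreal D * (indicator {0<..<a} t * IJ J t 1 ^ (j - 1))"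
        by (auto simp: indicator_def)
    qed measurable
    also have "\<dots> \<le> \<rho>Y ?H1 + \<rho>Y (\<lambda>t. ennreal D * (indicator {0<..<a} t * IJ J t 1 ^ (j - 1)))"
      by (rule ri_add[OF Y]) measurable
    also have "\<rho>Y (\<lambda>t. ennreal D * (indicator {0<..<a} t * IJ J t 1 ^ (j - 1))) =
        ennreal D * \<rho>Y (\<lambda>t. indicator {0<..<a} t * IJ J t 1 ^ (j - 1))"
      using D by (intro ri_scale[OF Y]) auto
    also have "\<rho>Y ?H1 + \<dots> \<le> ennreal (e / 2) + ennreal D * ennreal (e / 2 / D)"
      by (intro add_mono b(3)[OF fb] mult_left_mono a) auto
    also have "\<dots> = ennreal e"
    proof -
      have "ennreal D * ennreal (e / 2 / D) = ennreal (e / 2)" using D e by (simp add: ennreal_mult[symmetric])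
      then show ?thesis using e by (simp add: ennreal_plus[symmetric] del: ennreal_plus)
    qed
    finally show "\<rho>Y (\<lambda>t. indicator {0<..<a} t * HJ J j ?f t) \<le> ennreal e" .
  qed
  then show ?thesis using a by blast
qed

end

theorem theorem4p2:
  fixes J :: "real \<Rightarrow> real" and j :: nat
    and \<rho>X \<rho>Y :: "(real \<Rightarrow> ennreal) \<Rightarrow> ennreal"
  assumes J_meas: "J \<in> borel_measurable (lebesgue_on {0<..1})"
    and J_pos: "\<forall>t \<in> {0<..1}. J t > 0"
    and J_inf: "(INF t \<in> {0<..1}. J t / t) > 0"
    and j_pos: "j \<ge> 1"
    and X: "ri_norm \<rho>X" and Y: "ri_norm \<rho>Y"
    and alt: "ri_space \<rho>Y \<noteq> Linf_space \<or>
              (\<integral>\<^sup>+ r. indicator {0<..<1} r * ennreal (1 / J r) \<partial>lborel) = \<infinity>"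
  shows "(HJ_compact J j \<rho>X \<rho>Y \<longleftrightarrow>
            ((\<lambda>a. SUP f \<in> {f. f \<in> borel_measurable I01 \<and> \<rho>X (\<lambda>x. ennreal \<bar>f x\<bar>) \<le> 1}.
                \<rho>Y (\<lambda>t. indicator {0<..<a} t * HJ J j (\<lambda>x. ennreal \<bar>f x\<bar>) t)) \<longlongrightarrow> 0)
              (at_right 0)) \<and>
         (HJ_compact J j \<rho>X \<rho>Y \<longleftrightarrow> almost_compact (XrJ_norm \<rho>X J j) \<rho>Y)"
proof -
  define c where "c = (INF t \<in> {0<..1}. J t / t)"
  have "bdd_below ((\<lambda>t. J t / t) ` {0<..1})"
    using J_pos by (intro bdd_belowI2[of _ 0]) (auto intro!: divide_nonneg_pos less_imp_le)
  then have c_le: "c \<le> J t / t" if "0 < t" "t \<le> 1" for t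
    unfolding c_def using that by (intro cINF_lower) auto
  interpret hardy_kernel J j c
  proof
    show "c * t \<le> J t" if "0 < t" "t \<le> 1" for t using c_le[OF that] that by (simp add: field_simps)
  qed (use J_meas J_pos J_inf in \<open>auto simp: c_def\<close>)
  have tail: "tail \<rho>X \<rho>Y = (\<lambda>a. SUP f \<in> {f. f \<in> borel_measurable I01 \<and> \<rho>X (\<lambda>x. ennreal \<bar>f x\<bar>) \<le> 1}.
      \<rho>Y (\<lambda>t. indicator {0<..<a} t * HJ J j (\<lambda>x. ennreal \<bar>f x\<bar>) t))"
    unfolding tail_def unit_ball_def ..
  have "almost_compact (XrJ_norm \<rho>X J j) \<rho>Y \<longleftrightarrow> (rearr_tail \<rho>X \<rho>Y \<longlongrightarrow> 0) (at_right 0)"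
    unfolding almost_compact_def rearr_tail_def unit_ball_def ..
  also have "rearr_tail \<rho>X \<rho>Y = tail \<rho>X \<rho>Y" using rearr_tail_eq_tail[OF X Y] by blast
  finally have iii: "almost_compact (XrJ_norm \<rho>X J j) \<rho>Y \<longleftrightarrow> (tail \<rho>X \<rho>Y \<longlongrightarrow> 0) (at_right 0)" .
  have "ri_space \<rho>Y \<noteq> Linf_space \<or> IJ J 0 1 = top" using alt by (simp add: IJ_def)
  then have "HJ_compact J j \<rho>X \<rho>Y \<longleftrightarrow> (tail \<rho>X \<rho>Y \<longlongrightarrow> 0) (at_right 0)"
    unfolding tail_tendsto_0_iff[OF Y]
    using tail_of_HJ_compact[OF X Y] HJ_compact_of_tail[OF X Y] by blast
  then show ?thesis unfolding iii tail by blast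
qed

end
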